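(* Consider the distributed locally equality-constrained problem $\mathcal P_{\mathrm d}$ of the context, and assume: (1) the graph $\mathcal G$ is undirected and connected; (2) each $f_i:\mathbb R^d\to\mathbb R$ and each $\mathbf h_i^{\mathrm d}:\mathbb R^d\to\mathbb R^{r_i}$ is twice continuously differentiable, and $\nabla^2 f_i$ and the Jacobian $\mathbf J_i^{\mathrm d}=\partial\mathbf h_i^{\mathrm d}/\partial\mathbf x_i$ are locally Lipschitz continuous; (3) there exist $\mathbf s_{\mathrm d}^{\ast}\in\Omega_{\mathrm d}$, an open neighborhood $\mathcal U_{\mathrm d}\subset\mathbb R^d$ of $\mathbf s_{\mathrm d}^{\ast}$ and $\rho_{\mathrm d}>0$ such that $\mathbf s_{\mathrm d}^{\ast}$ is a local minimizer of $F$ on $\Omega_{\mathrm d}\cap\mathcal U_{\mathrm d}$ and $F(\mathbf s)\ge F(\mathbf s_{\mathrm d}^{\ast})+\frac{\rho_{\mathrm d}}{2}\|\mathbf s-\mathbf s_{\mathrm d}^{\ast}\|^2$ for all $\mathbf s\in\Omega_{\mathrm d}\cap\mathcal U_{\mathrm d}$; (4) for every $\mathbf x=\operatorname{col}(\mathbf x_1,\ldots,\mathbf x_N)\in\mathcal X_{\mathrm d}\cap(\mathbf 1_N\otimes\mathcal U_{\mathrm d})$, $\operatorname{rank}\operatorname{col}(\mathbf J_1^{\mathrm d}(\mathbf x_1),\ldots,\mathbf J_N^{\mathrm d}(\mathbf x_N))=r$. Let $\mathbf x_{\mathrm d}^{\ast}:=\mathbf 1_N\otimes\mathbf s_{\mathrm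 d}^{\ast}$. Then $\mathbf x_{\mathrm d}^{\ast}$ is a locally exponentially stable equilibrium of the ideal feedback-linearization (FL) dynamics $$\dot{\mathbf x}=-\nabla f(\mathbf x)-\mathbf v-\tilde{\mathbf J}^{\mathrm d}(\mathbf x)^{\top}\bm\mu,\qquad \operatorname{col}(\mathbf v,\bm\mu)=\mathbf u_{\mathrm d}^{\mathrm q}(\mathbf x).$$ Specifically, for every $\alpha_{\mathrm{FL}}\in(0,\min\{\rho_{\mathrm d}/N,\alpha_G\})$ there exist constants $C_{\mathrm{FL}}>0$ and $\delta_{\mathrm{FL}}>0$ such that, for every initial condition with $\|\mathbf x(0)-\mathbf x_{\mathrm d}^{\ast}\|<\delta_{\mathrm{FL}}$, the corresponding solution satisfies $$\|\mathbf x(t)-\mathbf x_{\mathrm d}^{\ast}\|+\|\mathbf L\mathbf x(t)\|+\|\mathbf h^{\mathrm d}(\mathbf x(t))\|\le C_{\mathrm{FL}}e^{-\alpha_{\mathrm{FL}}t}\|\mathbf x(0)-\mathbf x_{\mathrm d}^{\ast}\|,\qquad t\ge0.$$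
   Context: Network: agents $\mathcal V=\{1,\ldots,N\}$ communicate over an undirected weighted graph $\mathcal G$ with symmetric adjacency matrix $[a_{ij}]$, $a_{ij}>0$ if $i,j$ can exchange information and $a_{ij}=0$ otherwise. The Laplacian $\mathbf L_{\mathcal G}$ has entries $[\mathbf L_{\mathcal G}]_{ij}=-a_{ij}$ ($i\ne j$) and $[\mathbf L_{\mathcal G}]_{ii}=\sum_j a_{ij}$. Put $\mathbf L:=\mathbf L_{\mathcal G}\otimes\mathbf I_d$. $\operatorname{col}$ denotes vertical concatenation, $\operatorname{blkdiag}$ the block-diagonal matrix, $\mathbf 1_N$ the all-ones vector, and $\mathbf 1_N\otimes\mathcal U:=\{\mathbf 1_N\otimes\mathbf s:\mathbf s\in\mathcal U\}$. Norms are Euclidean. Problem $\mathcal P_{\mathrm d}$: minimize $\sum_{i=1}^N f_i(\mathbf x_i)$ over $\mathbf x_1,\ldots,\mathbf x_N\in\mathbb R^d$ subject to $\mathbf x_i=\mathbf x_j$ for all $i,j$ and $\mathbf h_i^{\mathrm d}(\mathbf x_i)=\mathbf 0$ for all $i$, where $f_i:\mathbb R^d\to\mathbb R$, $\mathbf h_i^{\mathrm d}:\mathbb R^d\to\mathbb R^{r_i}$. Put $r:=\sum_i r_i$, $F(\mathbf s):=\sum_i f_i(\mathbf s)$, $\Omega_{\mathrm d}:=\{\mathbf s\in\mathbb R^d:\mathbf h_i^{\mathrm d}(\mathbf s)=\mathbf 0,\ i=1,\ldots,N\}$, $\mathcal X_{\mathrm d}:=\{\mathbf 1_N\otimes\mathbf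 s:\mathbf s\in\Omega_{\mathrm d}\}$. For $\mathbf x=\operatorname{col}(\mathbf x_1,\ldots,\mathbf x_N)\in\mathbb R^{Nd}$: $f(\mathbf x):=\sum_i f_i(\mathbf x_i)$, $\mathbf h^{\mathrm d}(\mathbf x):=\operatorname{col}(\mathbf h_1^{\mathrm d}(\mathbf x_1),\ldots,\mathbf h_N^{\mathrm d}(\mathbf x_N))$, $\tilde{\mathbf J}^{\mathrm d}(\mathbf x):=\operatorname{blkdiag}(\mathbf J_1^{\mathrm d}(\mathbf x_1),\ldots,\mathbf J_N^{\mathrm d}(\mathbf x_N))$. Output: $\mathbf y_{\mathrm d}(\mathbf x):=\operatorname{col}(\mathbf L\mathbf x,\mathbf h^{\mathrm d}(\mathbf x))\in\operatorname{Im}\mathbf L\times\mathbb R^r$. Put $\mathbf A_{\mathrm d}(\mathbf x):=\operatorname{col}(\mathbf L,\tilde{\mathbf J}^{\mathrm d}(\mathbf x))$, $\mathbf B_{\mathrm d}(\mathbf x):=[\,\mathbf I\ \ \tilde{\mathbf J}^{\mathrm d}(\mathbf x)^\top]$, $\mathbf M_{\mathrm d}(\mathbf x):=\mathbf A_{\mathrm d}(\mathbf x)\mathbf B_{\mathrm d}(\mathbf x)$. Assigned output vector field: $\mathbf G_{\mathrm d}:\operatorname{Im}\mathbf L\times\mathbb R^r\to\operatorname{Im}\mathbf L\times\mathbb R^r$ is a fixed continuously differentiable map with $\mathbf G_{\mathrm d}(\mathbf 0)=\mathbf 0$ such that the origin of $\dot{\mathbf y}=\mathbf G_{\mathrm d}(\mathbf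 y)$ is globally exponentially stable with convergence rate $\alpha_G>0$ (i.e. $\|\mathbf y(t)\|\le c\,e^{-\alpha_G t}\|\mathbf y(0)\|$ for some constant $c$ and all solutions). Ideal FL input: for $\mathbf x$ near $\mathcal X_{\mathrm d}\cap(\mathbf 1_N\otimes\mathcal U_{\mathrm d})$, $\mathbf u_{\mathrm d}^{\mathrm q}(\mathbf x)=\operatorname{col}(\mathbf v,\bm\mu)$ denotes the unique solution with $\mathbf v\in\operatorname{Im}\mathbf L$, $\bm\mu\in\mathbb R^r$ of $\mathbf M_{\mathrm d}(\mathbf x)\mathbf u_{\mathrm d}+\mathbf A_{\mathrm d}(\mathbf x)\nabla f(\mathbf x)+\mathbf G_{\mathrm d}(\mathbf y_{\mathrm d}(\mathbf x))=\mathbf 0$. *)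

theory Defs
  imports "HOL-Analysis.Analysis"
begin

definition C1_on :: "'a::real_normed_vector set \<Rightarrow> ('a \<Rightarrow> 'b::real_normed_vector) \<Rightarrow> bool" where
  "C1_on S g \<longleftrightarrow> (\<exists>g' :: 'a \<Rightarrow> 'a \<Rightarrow>\<^sub>L 'b. continuous_on S g' \<and>
     (\<forall>x\<in>S. (g has_derivative blinfun_apply (g' x)) (at x within S)))"

definition C2 :: "('a::real_normed_vector \<Rightarrow> 'b::real_normed_vector) \<Rightarrow> bool" where
  "C2 g \<longleftrightarrow> (\<exists>g' :: 'a \<Rightarrow> 'a \<Rightarrow>\<^sub>L 'b. C1_on UNIV g' \<and>
     (\<forall>x. (g has_derivative blinfun_apply (g' x)) (at x)))"

definition locally_lipschitz :: "('a::metric_space \<Rightarrow> 'b::metric_space) \<Rightarrow> bool" where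
  "locally_lipschitz g \<longleftrightarrow> (\<forall>x. \<exists>e>0. \<exists>K. K-lipschitz_on (cball x e) g)"

definition grad :: "('a::real_inner \<Rightarrow> real) \<Rightarrow> 'a \<Rightarrow> 'a" where
  "grad g x = (THE D. GDERIV g x :> D)"

definition hessian :: "(real^'k \<Rightarrow> real) \<Rightarrow> real^'k \<Rightarrow> real^'k^'k" where
  "hessian g x = jacobian (grad g) (at x)"

definition local_minimizer_on :: "'a::metric_space set \<Rightarrow> ('a \<Rightarrow> real) \<Rightarrow> 'a \<Rightarrow> bool" where
  "local_minimizer_on S g s \<longleftrightarrow> s \<in> S \<and> (\<exists>e>0. \<forall>t \<in> S \<inter> ball s e. g s \<le> g t)"

definition ode_solution ::
    "'a::real_normed_vector set \<Rightarrow> ('a \<Rightarrow> 'a) \<Rightarrow> real set \<Rightarrow> (real \<Rightarrow> 'a) \<Rightarrow> bool" where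
  "ode_solution D X I x \<longleftrightarrow>
     (\<forall>t\<in>I. x t \<in> D \<and> (x has_vector_derivative X (x t)) (at t within I))"

text \<open>
  \<open>x\<close> is the solution of the initial value problem: it exists for all times \<open>t \<ge> 0\<close>,
  and every other forward solution, on however short an interval, agrees with it.
\<close>

definition the_solution_from ::
    "'a::real_normed_vector set \<Rightarrow> ('a \<Rightarrow> 'a) \<Rightarrow> 'a \<Rightarrow> (real \<Rightarrow> 'a) \<Rightarrow> bool" where
  "the_solution_from D X x0 x \<longleftrightarrow> ode_solution D X {0..} x \<and> x 0 = x0 \<and>
     (\<forall>T>0. \<forall>z. ode_solution D X {0..<T} z \<and> z 0 = x0 \<longrightarrow> (\<forall>t\<in>{0..<T}. z t = x t))"

text \<open>
  Solutions on bounded intervals \<open>[0, T)\<close> are included on purpose: quantifying over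
  solutions on \<open>[0, \<infinity>)\<close> only would ignore trajectories with finite escape time.
\<close>

definition origin_globally_exp_stable ::
    "'a::real_normed_vector set \<Rightarrow> ('a \<Rightarrow> 'a) \<Rightarrow> real \<Rightarrow> bool" where
  "origin_globally_exp_stable S G \<alpha> \<longleftrightarrow> 0 \<in> S \<and> G 0 = 0 \<and>
     (\<exists>c. \<forall>T>0. \<forall>y. ode_solution S G {0..<T} y \<longrightarrow>
        (\<forall>t\<in>{0..<T}. norm (y t) \<le> c * exp (- \<alpha> * t) * norm (y 0)))"

definition equilibrium :: "'a::real_normed_vector set \<Rightarrow> ('a \<Rightarrow> 'a) \<Rightarrow> 'a \<Rightarrow> bool" where
  "equilibrium D X p \<longleftrightarrow> p \<in> D \<and> X p = 0"

definition locally_exp_stable ::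
    "'a::real_normed_vector set \<Rightarrow> ('a \<Rightarrow> 'a) \<Rightarrow> 'a \<Rightarrow> bool" where
  "locally_exp_stable D X p \<longleftrightarrow>
     (\<exists>\<alpha>>0. \<exists>C>0. \<exists>\<delta>>0. \<forall>x0. norm (x0 - p) < \<delta> \<longrightarrow>
        (\<exists>x. the_solution_from D X x0 x \<and>
           (\<forall>t\<ge>0. norm (x t - p) \<le> C * exp (- \<alpha> * t) * norm (x0 - p))))"

definition col :: "'a^'p::finite \<Rightarrow> 'a^'q::finite \<Rightarrow> 'a^('p + 'q)" where
  "col v w = (\<chi> k. case k of Inl p \<Rightarrow> v $ p | Inr q \<Rightarrow> w $ q)"

definition upper :: "'a^('p::finite + 'q::finite) \<Rightarrow> 'a^'p" where
  "upper u = (\<chi> p. u $ Inl p)"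

definition lower :: "'a^('p::finite + 'q::finite) \<Rightarrow> 'a^'q" where
  "lower u = (\<chi> q. u $ Inr q)"

text \<open>Horizontal concatenation of matrices (\<open>col\<close> on matrices concatenates their rows).\<close>

definition row_concat :: "'a^'p::finite^'k \<Rightarrow> 'a^'q::finite^'k \<Rightarrow> 'a^('p + 'q)^'k" where
  "row_concat A B = (\<chi> i. col (A $ i) (B $ i))"

definition blocks_col :: "('n::finite \<Rightarrow> 'a^'k::finite) \<Rightarrow> 'a^('n \<times> 'k)" where
  "blocks_col v = (\<chi> p. v (fst p) $ snd p)"

definition block :: "'a^('n::finite \<times> 'k::finite) \<Rightarrow> 'n \<Rightarrow> 'a^'k" where
  "block x i = (\<chi> j. x $ (i, j))"

definition blkdiag ::
    "('n::finite \<Rightarrow> real^'d::finite^'m::finite) \<Rightarrow> real^('n \<times> 'd)^('n \<times> 'm)" where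
  "blkdiag A = (\<chi> p q. if fst p = fst q then A (fst p) $ snd p $ snd q else 0)"

definition kron ::
    "real^'q::finite^'p::finite \<Rightarrow> real^'l::finite^'k::finite \<Rightarrow> real^('q \<times> 'l)^('p \<times> 'k)" where
  "kron A B = (\<chi> p q. A $ fst p $ fst q * B $ snd p $ snd q)"

definition kron_vec :: "real^'p::finite \<Rightarrow> real^'k::finite \<Rightarrow> real^('p \<times> 'k)" where
  "kron_vec v w = (\<chi> p. v $ fst p * w $ snd p)"

definition undirected_weighted_graph :: "real^'n^'n \<Rightarrow> bool" where
  "undirected_weighted_graph a \<longleftrightarrow>
     transpose a = a \<and> (\<forall>i j. 0 \<le> a $ i $ j) \<and> (\<forall>i. a $ i $ i = 0)"

definition connected_graph :: "real^'n^'n \<Rightarrow> bool" where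
  "connected_graph a \<longleftrightarrow> (\<forall>i j. (i, j) \<in> {(k, l). a $ k $ l > 0}\<^sup>*)"

definition laplacian :: "real^'n^'n \<Rightarrow> real^'n^'n" where
  "laplacian a = (\<chi> i j. if i = j then (\<Sum>k\<in>UNIV. a $ i $ k) else - a $ i $ j)"

definition stacked_laplacian :: "real^'n::finite^'n \<Rightarrow> real^('n \<times> 'd::finite)^('n \<times> 'd)" where
  "stacked_laplacian a = kron (laplacian a) (mat 1)"

text \<open>
  The agents are the elements of \<open>'n\<close>. The numbers of constraints may differ from agent to
  agent and may be zero, so the space of values of the constraints of agent \<open>i\<close> is the
  coordinate subspace of \<open>real^'m\<close> of the vectors supported on \<open>R i :: 'm set\<close>, of dimension
  \<open>card (R i)\<close>, where \<open>'m\<close> is an arbitrary finite type. The padding entries vanish, as do the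
  corresponding rows of Jacobians, which affects neither norms nor ranks.
\<close>

definition local_multipliers :: "('n \<Rightarrow> 'm set) \<Rightarrow> 'n \<Rightarrow> (real^'m) set" where
  "local_multipliers R i = {z. \<forall>k. k \<notin> R i \<longrightarrow> z $ k = 0}"

definition multipliers ::
    "('n::finite \<Rightarrow> 'm::finite set) \<Rightarrow> (real^('n \<times> 'm)) set" where
  "multipliers R = {\<mu>. \<forall>i. block \<mu> i \<in> local_multipliers R i}"

definition total_objective :: "('n::finite \<Rightarrow> real^'d \<Rightarrow> real) \<Rightarrow> real^'d \<Rightarrow> real" where
  "total_objective f s = (\<Sum>i\<in>UNIV. f i s)"

definition feasible_set :: "('n \<Rightarrow> real^'d \<Rightarrow> real^'m) \<Rightarrow> (real^'d) set" where
  "feasible_set h = {s. \<forall>i. h i s = 0}"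

definition consensus_lift :: "(real^'d::finite) set \<Rightarrow> (real^('n::finite \<times> 'd)) set" where
  "consensus_lift U = {kron_vec 1 s | s. s \<in> U}"

definition stacked_objective ::
    "('n::finite \<Rightarrow> real^'d::finite \<Rightarrow> real) \<Rightarrow> real^('n \<times> 'd) \<Rightarrow> real" where
  "stacked_objective f x = (\<Sum>i\<in>UNIV. f i (block x i))"

definition stacked_constraint ::
    "('n::finite \<Rightarrow> real^'d::finite \<Rightarrow> real^'m::finite) \<Rightarrow> real^('n \<times> 'd) \<Rightarrow> real^('n \<times> 'm)" where
  "stacked_constraint h x = blocks_col (\<lambda>i. h i (block x i))"

definition jac :: "(real^'d \<Rightarrow> real^'m) \<Rightarrow> real^'d \<Rightarrow> real^'d^'m" where
  "jac g s = jacobian g (at s)"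

definition blkdiag_jacobian ::
    "('n::finite \<Rightarrow> real^'d::finite \<Rightarrow> real^'m::finite) \<Rightarrow> real^('n \<times> 'd) \<Rightarrow>
     real^('n \<times> 'd)^('n \<times> 'm)" where
  "blkdiag_jacobian h x = blkdiag (\<lambda>i. jac (h i) (block x i))"

definition col_jacobian ::
    "('n::finite \<Rightarrow> real^'d::finite \<Rightarrow> real^'m::finite) \<Rightarrow> real^('n \<times> 'd) \<Rightarrow>
     real^'d^('n \<times> 'm)" where
  "col_jacobian h x = blocks_col (\<lambda>i. jac (h i) (block x i))"

definition output_space ::
    "real^'n::finite^'n \<Rightarrow> ('n \<Rightarrow> 'm::finite set) \<Rightarrow>
     (real^(('n \<times> 'd::finite) + ('n \<times> 'm))) set" where
  "output_space a R =
     {col v \<mu> | v \<mu>. v \<in> range (\<lambda>x. stacked_laplacian a *v x) \<and> \<mu> \<in> multipliers R}"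

definition fl_output ::
    "real^'n::finite^'n \<Rightarrow> ('n \<Rightarrow> real^'d::finite \<Rightarrow> real^'m::finite) \<Rightarrow>
     real^('n \<times> 'd) \<Rightarrow> real^(('n \<times> 'd) + ('n \<times> 'm))" where
  "fl_output a h x = col (stacked_laplacian a *v x) (stacked_constraint h x)"

definition fl_A ::
    "real^'n::finite^'n \<Rightarrow> ('n \<Rightarrow> real^'d::finite \<Rightarrow> real^'m::finite) \<Rightarrow>
     real^('n \<times> 'd) \<Rightarrow> real^('n \<times> 'd)^(('n \<times> 'd) + ('n \<times> 'm))" where
  "fl_A a h x = col (stacked_laplacian a) (blkdiag_jacobian h x)"

definition fl_B ::
    "('n::finite \<Rightarrow> real^'d::finite \<Rightarrow> real^'m::finite) \<Rightarrow>
     real^('n \<times> 'd) \<Rightarrow> real^(('n \<times> 'd) + ('n \<times> 'm))^('n \<times> 'd)" where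
  "fl_B h x = row_concat (mat 1) (transpose (blkdiag_jacobian h x))"

definition fl_M ::
    "real^'n::finite^'n \<Rightarrow> ('n \<Rightarrow> real^'d::finite \<Rightarrow> real^'m::finite) \<Rightarrow>
     real^('n \<times> 'd) \<Rightarrow> real^(('n \<times> 'd) + ('n \<times> 'm))^(('n \<times> 'd) + ('n \<times> 'm))" where
  "fl_M a h x = fl_A a h x ** fl_B h x"

definition is_fl_input ::
    "real^'n::finite^'n \<Rightarrow> ('n \<Rightarrow> 'm::finite set) \<Rightarrow> ('n \<Rightarrow> real^'d::finite \<Rightarrow> real) \<Rightarrow>
     ('n \<Rightarrow> real^'d \<Rightarrow> real^'m) \<Rightarrow>
     (real^(('n \<times> 'd) + ('n \<times> 'm)) \<Rightarrow> real^(('n \<times> 'd) + ('n \<times> 'm))) \<Rightarrow>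
     real^('n \<times> 'd) \<Rightarrow> real^(('n \<times> 'd) + ('n \<times> 'm)) \<Rightarrow> bool" where
  "is_fl_input a R f h G x u \<longleftrightarrow> u \<in> output_space a R \<and>
     fl_M a h x *v u + fl_A a h x *v grad (stacked_objective f) x + G (fl_output a h x) = 0"

text \<open>
  The dynamics are defined where the input equation is uniquely solvable; trajectories are
  required to stay in this set.
\<close>

definition fl_domain ::
    "real^'n::finite^'n \<Rightarrow> ('n \<Rightarrow> 'm::finite set) \<Rightarrow> ('n \<Rightarrow> real^'d::finite \<Rightarrow> real) \<Rightarrow>
     ('n \<Rightarrow> real^'d \<Rightarrow> real^'m) \<Rightarrow>
     (real^(('n \<times> 'd) + ('n \<times> 'm)) \<Rightarrow> real^(('n \<times> 'd) + ('n \<times> 'm))) \<Rightarrow>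
     (real^('n \<times> 'd)) set" where
  "fl_domain a R f h G = {x. \<exists>!u. is_fl_input a R f h G x u}"

definition fl_input ::
    "real^'n::finite^'n \<Rightarrow> ('n \<Rightarrow> 'm::finite set) \<Rightarrow> ('n \<Rightarrow> real^'d::finite \<Rightarrow> real) \<Rightarrow>
     ('n \<Rightarrow> real^'d \<Rightarrow> real^'m) \<Rightarrow>
     (real^(('n \<times> 'd) + ('n \<times> 'm)) \<Rightarrow> real^(('n \<times> 'd) + ('n \<times> 'm))) \<Rightarrow>
     real^('n \<times> 'd) \<Rightarrow> real^(('n \<times> 'd) + ('n \<times> 'm))" where
  "fl_input a R f h G x = (THE u. is_fl_input a R f h G x u)"

definition fl_field ::
    "real^'n::finite^'n \<Rightarrow> ('n \<Rightarrow> 'm::finite set) \<Rightarrow> ('n \<Rightarrow> real^'d::finite \<Rightarrow> real) \<Rightarrow>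
     ('n \<Rightarrow> real^'d \<Rightarrow> real^'m) \<Rightarrow>
     (real^(('n \<times> 'd) + ('n \<times> 'm)) \<Rightarrow> real^(('n \<times> 'd) + ('n \<times> 'm))) \<Rightarrow>
     real^('n \<times> 'd) \<Rightarrow> real^('n \<times> 'd)" where
  "fl_field a R f h G x =
     - grad (stacked_objective f) x - upper (fl_input a R f h G x)
     - transpose (blkdiag_jacobian h x) *v lower (fl_input a R f h G x)"

end

theory Submission
  imports Defs
begin

text \<open>
  Write \<open>p\<close> for the stacked optimum, \<open>y\<close> for the output and \<open>X\<close> for the feedback-linearization
  field. The input is made so that the derivative of \<open>y\<close> along \<open>X\<close> is \<open>G \<circ> y\<close>
  (\<open>fl_A_field\<close>). Hence, for every solution \<open>x\<close>, \<open>y (x t)\<close> is a solution of the assigned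
  output equation, and the stability of \<open>G\<close> applies to it directly, at the rate \<open>\<alpha>G\<close>.

  What remains is the motion along \<open>y = 0\<close>. The kernel of the derivative of \<open>y\<close> at \<open>p\<close>
  consists of the vectors \<open>kron_vec 1 \<zeta>\<close> with \<open>\<zeta>\<close> in the kernel of all constraint Jacobians. Paired
  with such a vector the disagreement part of the input disappears, because it is in the range of the
  Laplacian, and the multiplier part vanishes at \<open>p\<close>, because the Jacobians annihilate \<open>\<zeta>\<close>
  there. So the tangential part of \<open>X\<close> is differentiable at \<open>p\<close> as soon as the multiplier is
  continuous, and its derivative is minus the second derivative of the Lagrangian
  (\<open>tangential_linearization\<close>). By quadratic growth the latter is at least \<open>\<rho>\<close> on tangent vectors
  (\<open>lagrangian_second_derivative_ge\<close>, by the growth along feasible curves, which exist by the inverse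
  function theorem). Since \<open>kron_vec 1 \<zeta>\<close> has the squared norm \<open>CARD('n) * (\<zeta> \<bullet> \<zeta>)\<close>, the tangential
  rate is \<open>\<rho> / CARD('n)\<close>.

  The two rates are combined in \<open>exp_stable_of_output_dynamics\<close>: the squared norm of the tangential
  component of \<open>x - p\<close> is a Lyapunov function up to a multiple of the square of \<open>norm (y x)\<close>, and
  the tangential component together with \<open>y x\<close> bounds \<open>x - p\<close>.

  Existence and uniqueness of solutions follow from the Lipschitz continuity of \<open>X\<close> near \<open>p\<close>. It
  holds because the matrix \<open>fl_M\<close> is invertible on the output space at \<open>p\<close>
  (\<open>fl_M_injective\<close>, from connectedness and full rank), so that the input is a Lipschitz function of the
  state (\<open>lipschitz_near_linear_solution\<close>). A solution of the field truncated to a small ball exists for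
  all times by a fixed-point argument in a weighted norm, and the decay estimate keeps it in the ball.
\<close>

section \<open>Ordinary differential equations with Lipschitz right-hand side\<close>

text \<open>Continuous induction: \<open>step\<close> is contradicted at the first time at which \<open>g\<close> reaches \<open>r\<close>.\<close>

lemma continuous_stays_below:
  fixes g :: "real \<Rightarrow> real"
  assumes cont: "continuous_on {0..t} g" and t: "0 \<le> t" and g0: "g 0 < r"
    and step: "\<And>s. 0 < s \<Longrightarrow> s \<le> t \<Longrightarrow> (\<And>q. 0 \<le> q \<Longrightarrow> q < s \<Longrightarrow> g q < r) \<Longrightarrow> g s < r"
  shows "g t < r"
proof (rule ccontr)
  assume "\<not> g t < r"
  define Z where "Z = {0..t} \<inter> g -` {r..}"
  have "closed Z" unfolding Z_def
    by (intro continuous_closed_preimage cont) auto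
  moreover have "bounded Z"
    using bounded_subset[OF bounded_closed_interval, of Z 0 t] by (auto simp: Z_def)
  ultimately have "compact Z"
    by (simp add: compact_eq_bounded_closed)
  moreover have "Z \<noteq> {}"
    using t \<open>\<not> g t < r\<close> by (auto simp: Z_def)
  ultimately obtain s where s: "s \<in> Z" and least: "\<And>q. q \<in> Z \<Longrightarrow> s \<le> q"
    using compact_attains_inf[of Z] by metis
  have "s \<noteq> 0"
    using s g0 by (auto simp: Z_def)
  moreover have "g q < r" if "0 \<le> q" "q < s" for q
    using least[of q] that s by (force simp: Z_def)
  ultimately show False
    using step[of s] s by (force simp: Z_def)
qed

lemma antitone_if_derivative_nonpos:
  fixes \<phi> :: "real \<Rightarrow> real"
  assumes "0 \<le> t"
    and "\<And>s. s \<in> {0..t} \<Longrightarrow> (\<phi> has_real_derivative \<phi>' s) (at s within {0..t})"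
    and "\<And>s. s \<in> {0..t} \<Longrightarrow> \<phi>' s \<le> 0"
  shows "\<phi> t \<le> \<phi> 0"
proof -
  obtain s where "s \<in> {0..t}" "\<phi> t - \<phi> 0 = \<phi>' s * (t - 0)"
    using mvt_very_simple[of 0 t \<phi> "\<lambda>s q. \<phi>' s * q"] assms
    unfolding has_field_derivative_def by auto
  then show ?thesis
    using assms(1) assms(3)[of s] mult_nonpos_nonneg[of "\<phi>' s" t] by simp
qed

lemma norm_square_has_derivative:
  fixes w :: "real \<Rightarrow> 'a::real_inner"
  assumes "(w has_vector_derivative w') (at t within I)"
  shows "((\<lambda>t. w t \<bullet> w t) has_real_derivative 2 * (w t \<bullet> w')) (at t within I)"
proof -
  have "((\<lambda>t. w t \<bullet> w t) has_derivative (\<lambda>q. w t \<bullet> (q *\<^sub>R w') + (q *\<^sub>R w') \<bullet> w t)) (at t within I)"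
    using assms unfolding has_vector_derivative_def by (intro has_derivative_inner)
  then show ?thesis
    unfolding has_field_derivative_def
    by (rule has_derivative_eq_rhs) (auto simp: fun_eq_iff inner_commute)
qed

text \<open>Gronwall's argument: \<open>exp (- 2 * K * s) * norm (x s - z s) ^ 2\<close> cannot increase.\<close>

lemma lipschitz_ode_unique:
  fixes X :: "'a::real_inner \<Rightarrow> 'a"
  assumes lip: "K-lipschitz_on C X" and t: "0 \<le> t"
    and x: "ode_solution C X {0..t} x" and z: "ode_solution C X {0..t} z"
    and eq: "x 0 = z 0"
  shows "x t = z t"
proof -
  define w where "w = (\<lambda>s. x s - z s)"
  define \<phi>' where "\<phi>' = (\<lambda>s. exp (- 2 * K * s) * (2 * (w s \<bullet> (X (x s) - X (z s))))
    + (- 2 * K * exp (- 2 * K * s)) * (w s \<bullet> w s))"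
  have "exp (- 2 * K * t) * (w t \<bullet> w t) \<le> exp (- 2 * K * 0) * (w 0 \<bullet> w 0)"
  proof (rule antitone_if_derivative_nonpos[OF t, where \<phi>' = \<phi>'])
    fix s assume s: "s \<in> {0..t}"
    have "(w has_vector_derivative (X (x s) - X (z s))) (at s within {0..t})"
      using x z s unfolding ode_solution_def w_def
      by (intro has_vector_derivative_diff) auto
    from norm_square_has_derivative[OF this]
    show "((\<lambda>s. exp (- 2 * K * s) * (w s \<bullet> w s)) has_real_derivative \<phi>' s) (at s within {0..t})"
      unfolding \<phi>'_def by (auto intro!: derivative_eq_intros simp: algebra_simps)
    have "w s \<bullet> (X (x s) - X (z s)) \<le> norm (w s) * norm (X (x s) - X (z s))"
      by (rule norm_cauchy_schwarz)
    also have "\<dots> \<le> norm (w s) * (K * norm (w s))"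
      using x z s lip unfolding ode_solution_def w_def
      by (intro mult_left_mono lipschitz_on_normD[OF lip]) auto
    also have "\<dots> = K * (w s \<bullet> w s)"
      by (simp add: power2_norm_eq_inner[symmetric] power2_eq_square)
    finally have "exp (- 2 * K * s) * (2 * (w s \<bullet> (X (x s) - X (z s))))
        \<le> exp (- 2 * K * s) * (2 * (K * (w s \<bullet> w s)))"
      by (intro mult_left_mono) auto
    then show "\<phi>' s \<le> 0"
      by (simp add: \<phi>'_def algebra_simps)
  qed
  then have "w t \<bullet> w t \<le> 0"
    using eq by (simp add: w_def mult_le_0_iff)
  then have "w t \<bullet> w t = 0"
    using inner_ge_zero[of "w t"] by linarith
  then show ?thesis
    by (simp add: w_def)
qed

lemma integral_has_vector_derivative_halfline:
  fixes F :: "real \<Rightarrow> 'a::banach"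
  assumes cont: "continuous_on {0..} F" and t: "0 \<le> t"
  shows "((\<lambda>u. integral {0..u} F) has_vector_derivative F t) (at t within {0..})"
proof -
  have "((\<lambda>u. integral {0..u} F) has_vector_derivative F t) (at t within {0..t + 1})"
    using t by (intro integral_has_vector_derivative continuous_on_subset[OF cont]) auto
  moreover have "at t within {0..t + 1} = at t within {0..}"
    by (rule at_within_nhd[where S = "{..<t + 1}"]) auto
  ultimately show ?thesis by simp
qed

text \<open>
  In a norm weighted with \<open>exp (- b * t)\<close> integration has norm at most \<open>1 / b\<close>, on an interval
  of any length.
\<close>

lemma norm_damped_integral_le:
  fixes F :: "real \<Rightarrow> 'a::banach"
  assumes cont: "continuous_on {0..} F" and t: "0 \<le> t" and b: "0 < b" and M: "0 \<le> M"
    and F: "\<And>s. 0 \<le> s \<Longrightarrow> norm (F s) \<le> M * exp (b * s)"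
  shows "norm (exp (- b * t) *\<^sub>R integral {0..t} F) \<le> M / b"
proof -
  have "((\<lambda>s. M * exp (b * s)) has_integral (M * exp (b * t) / b - M * exp (b * 0) / b)) {0..t}"
    using t b
    by (intro fundamental_theorem_of_calculus)
       (auto simp: has_real_derivative_iff_has_vector_derivative[symmetric]
             intro!: derivative_eq_intros)
  moreover have "F integrable_on {0..t}"
    by (intro integrable_continuous_real continuous_on_subset[OF cont]) auto
  ultimately have "norm (integral {0..t} F) \<le> M * exp (b * t) / b - M * exp (b * 0) / b"
    using F integral_norm_bound_integral[of F "{0..t}" "\<lambda>s. M * exp (b * s)"]
    by (metis atLeastAtMost_iff has_integral_integrable integral_unique)
  also have "\<dots> \<le> M * exp (b * t) / b"
    using b M by simp
  finally have "exp (- b * t) * norm (integral {0..t} F) \<le> exp (- b * t) * (M * exp (b * t) / b)"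
    by (intro mult_left_mono) auto
  then show ?thesis
    by (simp add: exp_minus field_simps)
qed

text \<open>
  The Picard operator is a contraction on the whole half-line if solutions are measured with the
  weight \<open>exp (- b * t)\<close> for \<open>b\<close> large against the Lipschitz constant: the fixed point is
  \<open>g t = exp (- b * t) *\<^sub>R (x t - x0)\<close>, a bounded continuous function. It is extended
  to negative times by a constant, since the space of bounded continuous functions is a type.
\<close>

lemma lipschitz_ode_global_existence:
  fixes X :: "'a::banach \<Rightarrow> 'a"
  assumes lip: "K-lipschitz_on UNIV X"
  obtains x where "x 0 = x0"
    and "\<And>t. 0 \<le> t \<Longrightarrow> (x has_vector_derivative X (x t)) (at t within {0..})"
proof -
  have K: "0 \<le> K"
    using lip by (rule lipschitz_on_nonneg)
  define b where "b = 2 * (K + 1)"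
  have b: "0 < b" using K by (simp add: b_def)
  define F where "F = (\<lambda>(g :: real \<Rightarrow>\<^sub>C 'a) s. X (x0 + exp (b * s) *\<^sub>R g s))"
  define \<Phi> where "\<Phi> = (\<lambda>g t. exp (- b * t) *\<^sub>R integral {0..t} (F g))"
  have contX: "continuous_on S X" for S
    using lipschitz_on_continuous_on[OF lip] continuous_on_subset by blast
  have contF: "continuous_on {0..} (F g)" for g
    unfolding F_def by (intro continuous_on_compose2[OF contX[of UNIV]] continuous_intros) auto
  have cont\<Phi>: "continuous_on {0..} (\<Phi> g)" for g
  proof -
    have "continuous_on {0..} (\<lambda>t. integral {0..t} (F g))"
      by (rule continuous_on_vector_derivative, rule integral_has_vector_derivative_halfline[OF contF]) auto
    then show ?thesis
      unfolding \<Phi>_def by (intro continuous_intros)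
  qed
  have F_bound: "norm (F g s) \<le> (norm (X x0) + K * norm g) * exp (b * s)" if "0 \<le> s" for g s
  proof -
    have "norm (F g s) \<le> norm (X x0) + norm (F g s - X x0)"
      by (rule norm_triangle_sub)
    also have "norm (F g s - X x0) \<le> K * norm (exp (b * s) *\<^sub>R g s)"
      unfolding F_def using lipschitz_on_normD[OF lip, of "x0 + exp (b * s) *\<^sub>R g s" x0] by simp
    also have "\<dots> \<le> K * (exp (b * s) * norm g)"
      using K norm_bounded[of g s] by (intro mult_left_mono) auto
    finally have "norm (F g s) \<le> norm (X x0) * 1 + K * norm g * exp (b * s)"
      by (simp add: ac_simps)
    also have "\<dots> \<le> norm (X x0) * exp (b * s) + K * norm g * exp (b * s)"
      using that b by (intro add_right_mono mult_left_mono) auto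
    finally show ?thesis by (simp add: algebra_simps)
  qed
  have F_diff: "norm (F g s - F g' s) \<le> (K * dist g g') * exp (b * s)" for g g' s
  proof -
    have "norm (F g s - F g' s) \<le> K * norm (exp (b * s) *\<^sub>R g s - exp (b * s) *\<^sub>R g' s)"
      unfolding F_def
      using lipschitz_on_normD[OF lip, of "x0 + exp (b * s) *\<^sub>R g s" "x0 + exp (b * s) *\<^sub>R g' s"]
      by simp
    also have "\<dots> = K * (exp (b * s) * dist (g s) (g' s))"
      by (simp add: dist_norm flip: scaleR_diff_right)
    also have "\<dots> \<le> K * (exp (b * s) * dist g g')"
      using K dist_bounded[of g s g'] by (intro mult_left_mono) auto
    finally show ?thesis by (simp add: ac_simps)
  qed
  define T where "T = (\<lambda>g. Bcontfun (\<lambda>t. \<Phi> g (max 0 t)))"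
  have T: "T g t = \<Phi> g (max 0 t)" for g t
  proof -
    have "(\<lambda>t. \<Phi> g (max 0 t)) \<in> bcontfun"
    proof (rule bcontfun_normI)
      show "continuous_on UNIV (\<lambda>t. \<Phi> g (max 0 t))"
        by (intro continuous_on_compose2[OF cont\<Phi>] continuous_intros) auto
      show "norm (\<Phi> g (max 0 t)) \<le> (norm (X x0) + K * norm g) / b" for t
        unfolding \<Phi>_def using K by (intro norm_damped_integral_le[OF contF _ b] F_bound) auto
    qed
    then show ?thesis
      by (simp add: T_def Bcontfun_inverse)
  qed
  have "dist (T g) (T g') \<le> 1 / 2 * dist g g'" for g g'
  proof (rule dist_bound)
    fix t :: real
    let ?t = "max 0 t"
    have "\<Phi> g ?t - \<Phi> g' ?t = exp (- b * ?t) *\<^sub>R integral {0..?t} (\<lambda>s. F g s - F g' s)"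
      unfolding \<Phi>_def
      by (subst integral_diff)
         (auto intro!: integrable_continuous_real continuous_on_subset[OF contF]
               simp: scaleR_diff_right)
    also have "norm \<dots> \<le> (K * dist g g') / b"
      using K by (intro norm_damped_integral_le F_diff continuous_on_diff contF b) auto
    also have "\<dots> \<le> 1 / 2 * dist g g'"
    proof -
      have "K / b \<le> 1 / 2" using K by (simp add: b_def field_simps)
      from mult_right_mono[OF this, of "dist g g'"] show ?thesis by simp
    qed
    finally show "dist (T g t) (T g' t) \<le> 1 / 2 * dist g g'"
      by (simp add: T dist_norm)
  qed
  then obtain g where g: "T g = g"
    using banach_fix_type[of "1 / 2" T] by auto
  define x where "x = (\<lambda>t. x0 + integral {0..t} (F g))"
  have x: "x0 + exp (b * t) *\<^sub>R g t = x t" if "0 \<le> t" for t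
  proof -
    have "g t = \<Phi> g t" using T[of g t] g that by simp
    then show ?thesis by (simp add: x_def \<Phi>_def exp_minus)
  qed
  show thesis
  proof (rule that)
    show "x 0 = x0" by (simp add: x_def)
    fix t :: real assume t: "0 \<le> t"
    have "((\<lambda>t. x0 + integral {0..t} (F g)) has_vector_derivative 0 + F g t) (at t within {0..})"
      by (intro has_vector_derivative_add has_vector_derivative_const
          integral_has_vector_derivative_halfline[OF contF t])
    then show "(x has_vector_derivative X (x t)) (at t within {0..})"
      unfolding x_def[symmetric] by (simp add: F_def x[OF t])
  qed
qed

text \<open>
  Composing with the nearest-point map of the ball turns a field that is Lipschitz on the ball
  into one that is Lipschitz everywhere.
\<close>

lemma lipschitz_ode_truncated_existence:
  fixes X :: "'a::euclidean_space \<Rightarrow> 'a"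
  assumes lip: "K-lipschitz_on (cball p r) X" and r: "0 < r"
  obtains x where "x 0 = x0" "continuous_on {0..} x"
    and "\<And>t. 0 \<le> t \<Longrightarrow> x t \<in> cball p r \<Longrightarrow> (x has_vector_derivative X (x t)) (at t within {0..})"
proof -
  let ?c = "closest_point (cball p r)"
  have "(K * 1)-lipschitz_on UNIV (X \<circ> ?c)"
  proof (rule lipschitz_on_compose)
    show "1-lipschitz_on UNIV ?c"
      using r by (intro lipschitz_onI) (auto intro!: closest_point_lipschitz)
    show "K-lipschitz_on (range ?c) X"
      using r by (intro lipschitz_on_subset[OF lip]) (auto intro!: closest_point_in_set simp del: mem_cball)
  qed
  from lipschitz_ode_global_existence[OF this, of x0] obtain x where "x 0 = x0"
    and x: "\<And>t. 0 \<le> t \<Longrightarrow> (x has_vector_derivative (X \<circ> ?c) (x t)) (at t within {0..})"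
    by metis
  moreover have "continuous_on {0..} x"
    by (rule continuous_on_vector_derivative) (use x in auto)
  moreover have "(x has_vector_derivative X (x t)) (at t within {0..})"
    if "0 \<le> t" "x t \<in> cball p r" for t
    using x[OF that(1)] closest_point_self[OF that(2)] by simp
  ultimately show thesis
    using that by blast
qed

lemma ode_solution_subset:
  assumes "ode_solution D X I x" "J \<subseteq> I" "\<And>t. t \<in> J \<Longrightarrow> x t \<in> D'"
  shows "ode_solution D' X J x"
  using assms unfolding ode_solution_def
  by (meson has_vector_derivative_within_subset subsetD)

lemma ode_solution_continuous_on: "ode_solution D X I x \<Longrightarrow> continuous_on I x"
  unfolding ode_solution_def by (meson continuous_on_vector_derivative)

text \<open>
  A competitor that starts with \<open>x\<close> follows it as long as it stays in the ball, and so it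
  can never reach the boundary, from which \<open>x\<close> keeps a distance.
\<close>

lemma the_solution_fromI:
  fixes X :: "'a::real_inner \<Rightarrow> 'a"
  assumes lip: "K-lipschitz_on (cball p r) X" and D: "cball p r \<subseteq> D"
    and x: "ode_solution (ball p r) X {0..} x" and x0: "x 0 = x0"
  shows "the_solution_from D X x0 x"
proof -
  have x_ball: "x t \<in> ball p r" if "0 \<le> t" for t
    using x that by (simp add: ode_solution_def)
  have sol: "ode_solution D X {0..} x"
    by (rule ode_solution_subset[OF x]) (use x_ball D ball_subset_cball in blast)+
  have "z t = x t" if z: "ode_solution D X {0..<T} z" and z0: "z 0 = x0" and t: "t \<in> {0..<T}"
    for T z t
  proof -
    have agree: "z s = x s" if s: "0 \<le> s" "s \<le> t" and ball: "\<And>q. q \<in> {0..s} \<Longrightarrow> z q \<in> cball p r"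
      for s
    proof (rule lipschitz_ode_unique[OF lip \<open>0 \<le> s\<close>])
      show "ode_solution (cball p r) X {0..s} z"
        by (rule ode_solution_subset[OF z]) (use s t ball in auto)
      show "ode_solution (cball p r) X {0..s} x"
        by (rule ode_solution_subset[OF x]) (use x_ball less_imp_le in auto)
    qed (simp add: x0 z0)
    have z_cont: "continuous_on {0..t} z"
      by (rule continuous_on_subset[OF ode_solution_continuous_on[OF z]]) (use t in auto)
    have below: "dist p (z s) < r" if s: "0 \<le> s" "s \<le> t" for s
    proof (rule continuous_stays_below[where g = "\<lambda>q. dist p (z q)" and t = s])
      show "continuous_on {0..s} (\<lambda>q. dist p (z q))"
        by (intro continuous_intros continuous_on_subset[OF z_cont]) (use s in auto)
      show "dist p (z 0) < r"
        using x_ball[of 0] x0 z0 by simp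
      fix q assume q: "0 < q" "q \<le> s" and below: "\<And>q'. 0 \<le> q' \<Longrightarrow> q' < q \<Longrightarrow> dist p (z q') < r"
      have "continuous_on (closure {0..<q}) z"
        by (rule continuous_on_subset[OF z_cont]) (use q s in auto)
      moreover have "z ` {0..<q} \<subseteq> cball p r"
        using below by (auto simp: less_imp_le)
      ultimately have "z ` closure {0..<q} \<subseteq> cball p r"
        by (intro image_closure_subset) auto
      moreover have "closure {0..<q} = {0..q}"
        using q by simp
      ultimately have "z q = x q"
        using q s by (intro agree) (auto simp del: mem_cball)
      then show "dist p (z q) < r"
        using x_ball[of q] q by simp
    qed (rule s(1))
    show ?thesis
    proof (rule agree)
      show "z q \<in> cball p r" if "q \<in> {0..t}" for q
        using below[of q] that by simp
    qed (use t in auto)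
  qed
  then show ?thesis
    unfolding the_solution_from_def using sol x0 by blast
qed

section \<open>Lipschitz dependence on parameters\<close>

definition lipschitz_near :: "'a::metric_space \<Rightarrow> ('a \<Rightarrow> 'b::metric_space) \<Rightarrow> bool" where
  "lipschitz_near p g \<longleftrightarrow> (\<exists>e>0. \<exists>K. K-lipschitz_on (cball p e) g)"

lemma lipschitz_nearI: "0 < e \<Longrightarrow> K-lipschitz_on (cball p e) g \<Longrightarrow> lipschitz_near p g"
  by (auto simp: lipschitz_near_def)

lemma lipschitz_nearE:
  assumes "lipschitz_near p g" "0 < r"
  obtains e K where "0 < e" "e \<le> r" "0 \<le> K" "K-lipschitz_on (cball p e) g"
proof -
  obtain e K where e: "0 < e" "K-lipschitz_on (cball p e) g"
    using assms by (auto simp: lipschitz_near_def)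
  have "K-lipschitz_on (cball p (min e r)) g"
    by (rule lipschitz_on_subset[OF e(2)]) auto
  then show thesis
    using that[of "min e r" K] e assms(2) lipschitz_on_nonneg by auto
qed

lemma lipschitz_nearE2:
  assumes "lipschitz_near p f" "lipschitz_near p g" "0 < r"
  obtains e K L where "0 < e" "e \<le> r" "0 \<le> K" "0 \<le> L"
    "K-lipschitz_on (cball p e) f" "L-lipschitz_on (cball p e) g"
proof -
  obtain e K where e: "0 < e" "e \<le> r" "0 \<le> K" "K-lipschitz_on (cball p e) f"
    using assms lipschitz_nearE by blast
  obtain e' L where e': "0 < e'" "e' \<le> e" "0 \<le> L" "L-lipschitz_on (cball p e') g"
    using lipschitz_nearE[OF assms(2) e(1)] by blast
  have "K-lipschitz_on (cball p e') f"
    by (rule lipschitz_on_subset[OF e(4)]) (use e' in auto)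
  then show thesis
    using that[of e' K L] e e' by auto
qed

lemma lipschitz_near_isCont: "lipschitz_near p g \<Longrightarrow> isCont g p"
proof -
  assume "lipschitz_near p g"
  then obtain e K where e: "0 < e" "K-lipschitz_on (cball p e) g"
    by (auto simp: lipschitz_near_def)
  have "continuous_on (ball p e) g"
    by (rule continuous_on_subset[OF lipschitz_on_continuous_on[OF e(2)] ball_subset_cball])
  then show ?thesis
    using e(1) by (simp add: continuous_on_eq_continuous_at)
qed

lemma locally_lipschitz_iff: "locally_lipschitz g \<longleftrightarrow> (\<forall>p. lipschitz_near p g)"
  by (simp add: locally_lipschitz_def lipschitz_near_def)

lemma lipschitz_near_const: "lipschitz_near p (\<lambda>x. c)"
  by (rule lipschitz_nearI[OF zero_less_one lipschitz_on_constant])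

lemma lipschitz_near_cong:
  assumes "lipschitz_near p f" "0 < r" "\<And>x. x \<in> cball p r \<Longrightarrow> f x = g x"
  shows "lipschitz_near p g"
proof -
  obtain e K where e: "0 < e" "e \<le> r" "K-lipschitz_on (cball p e) f"
    using lipschitz_nearE[OF assms(1,2)] by metis
  have "K-lipschitz_on (cball p e) g"
    by (rule lipschitz_on_transform[OF e(3)]) (use e(2) assms(3) in auto)
  then show ?thesis
    using e(1) lipschitz_nearI by blast
qed

text \<open>
  The set \<open>S\<close> is for outer functions that are smooth only along a subspace, such as a vector
  field on the space of outputs.
\<close>

lemma lipschitz_near_compose_within:
  assumes f: "lipschitz_near p f" and e: "0 < e" and g: "L-lipschitz_on (S \<inter> cball (f p) e) g"
    and S: "\<And>x. f x \<in> S"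
  shows "lipschitz_near p (\<lambda>x. g (f x))"
proof -
  obtain r where r: "0 < r" "\<And>x. dist x p < r \<Longrightarrow> dist (f x) (f p) < e"
    using lipschitz_near_isCont[OF f] e by (metis LIM_def isCont_def dist_self)
  obtain d K where d: "0 < d" "d \<le> r / 2" "0 \<le> K" "K-lipschitz_on (cball p d) f"
    using lipschitz_nearE[OF f, of "r / 2"] r(1) by (metis half_gt_zero)
  have "f ` cball p d \<subseteq> S \<inter> cball (f p) e"
    using r d S by (force simp: dist_commute intro: less_imp_le)
  then have "(L * K)-lipschitz_on (cball p d) (g \<circ> f)"
    by (intro lipschitz_on_compose d lipschitz_on_subset[OF g])
  then show ?thesis
    using d(1) by (auto simp: o_def intro: lipschitz_nearI)
qed

lemma lipschitz_near_compose:
  assumes "lipschitz_near p f" "lipschitz_near (f p) g"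
  shows "lipschitz_near p (\<lambda>x. g (f x))"
  using assms(2) lipschitz_near_compose_within[OF assms(1), of _ _ UNIV g]
  by (auto simp: lipschitz_near_def[of "f p"])

lemma lipschitz_near_bounded_linear:
  assumes "bounded_linear F"
  shows "lipschitz_near p F"
proof -
  obtain B where "B-lipschitz_on (cball p 1) F"
    using bounded_linear.lipschitz_boundE[OF assms] by metis
  then show ?thesis
    by (rule lipschitz_nearI[OF zero_less_one])
qed

lemma lipschitz_near_add:
  fixes f g :: "'a::metric_space \<Rightarrow> 'b::real_normed_vector"
  assumes "lipschitz_near p f" "lipschitz_near p g"
  shows "lipschitz_near p (\<lambda>x. f x + g x)"
  by (rule lipschitz_nearE2[OF assms zero_less_one], rule lipschitz_nearI, assumption,
      rule lipschitz_on_add)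

lemma lipschitz_near_minus:
  fixes f :: "'a::metric_space \<Rightarrow> 'b::real_normed_vector"
  assumes "lipschitz_near p f"
  shows "lipschitz_near p (\<lambda>x. - f x)"
  by (rule lipschitz_nearE[OF assms zero_less_one], rule lipschitz_nearI, assumption,
      rule lipschitz_on_minus)

lemma lipschitz_on_cball_norm_le:
  fixes f :: "'a::metric_space \<Rightarrow> 'b::real_normed_vector"
  assumes "K-lipschitz_on (cball p e) f" "x \<in> cball p e"
  shows "norm (f x) \<le> norm (f p) + K * e"
proof -
  have "norm (f x) \<le> norm (f p) + norm (f x - f p)"
    by (rule norm_triangle_sub)
  also have "norm (f x - f p) \<le> K * dist x p"
    using assms(2) lipschitz_onD[OF assms(1), of x p]
    by (simp add: dist_norm) (metis assms(2) dist_norm dist_self mem_cball order_trans zero_le_dist)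
  also have "\<dots> \<le> K * e"
    using assms lipschitz_on_nonneg[OF assms(1)] by (intro mult_left_mono) (auto simp: dist_commute)
  finally show ?thesis by simp
qed

lemma lipschitz_near_bilinear:
  fixes prod :: "'b::real_normed_vector \<Rightarrow> 'c::real_normed_vector \<Rightarrow> 'd::real_normed_vector"
  assumes "bounded_bilinear prod" and f: "lipschitz_near p f" and g: "lipschitz_near p g"
  shows "lipschitz_near p (\<lambda>x. prod (f x) (g x))"
proof -
  interpret bounded_bilinear prod by fact
  obtain B where B: "0 < B" "\<And>a b. norm (prod a b) \<le> norm a * norm b * B"
    using pos_bounded by metis
  obtain e K L where e: "0 < e" and K: "0 \<le> K" "K-lipschitz_on (cball p e) f"
    and L: "0 \<le> L" "L-lipschitz_on (cball p e) g"
    using lipschitz_nearE2[OF f g zero_less_one] by metis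
  let ?C = "K * (norm (g p) + L * e) * B + (norm (f p) + K * e) * L * B"
  have "?C-lipschitz_on (cball p e) (\<lambda>x. prod (f x) (g x))"
  proof (rule lipschitz_onI)
    fix x y assume x: "x \<in> cball p e" and y: "y \<in> cball p e"
    have "prod (f x) (g x) - prod (f y) (g y) = prod (f x - f y) (g x) + prod (f y) (g x - g y)"
      by (simp add: diff_left diff_right)
    then have "dist (prod (f x) (g x)) (prod (f y) (g y))
        \<le> norm (f x - f y) * norm (g x) * B + norm (f y) * norm (g x - g y) * B"
      unfolding dist_norm using B(2) by (metis (no_types) add_mono norm_triangle_le)
    also have "\<dots> \<le> (K * dist x y) * (norm (g p) + L * e) * B + (norm (f p) + K * e) * (L * dist x y) * B"
      using B(1) K L e lipschitz_onD[OF K(2) x y] lipschitz_onD[OF L(2) x y]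
        lipschitz_on_cball_norm_le[OF K(2) y] lipschitz_on_cball_norm_le[OF L(2) x]
      by (intro add_mono mult_mono) (auto simp: dist_norm)
    finally show "dist (prod (f x) (g x)) (prod (f y) (g y)) \<le> ?C * dist x y"
      by (simp add: algebra_simps)
  next
    show "0 \<le> ?C" using B(1) K(1) L(1) e by auto
  qed
  then show ?thesis using e by (intro lipschitz_nearI)
qed

lemma lipschitz_near_sum:
  fixes f :: "'i \<Rightarrow> 'a::metric_space \<Rightarrow> 'b::real_normed_vector"
  assumes "\<And>i. i \<in> I \<Longrightarrow> lipschitz_near p (f i)"
  shows "lipschitz_near p (\<lambda>x. \<Sum>i\<in>I. f i x)"
  using assms by (induction I rule: infinite_finite_induct) (auto intro: lipschitz_near_add lipschitz_near_const)

lemma lipschitz_near_vec: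
  fixes f :: "'a::metric_space \<Rightarrow> 'b::real_normed_vector^'k"
  assumes "\<And>k. lipschitz_near p (\<lambda>x. f x $ k)"
  shows "lipschitz_near p f"
proof -
  have "\<exists>e K. 0 < e \<and> K-lipschitz_on (cball p e) (\<lambda>x. f x $ k)" for k
    using assms by (auto simp: lipschitz_near_def)
  then obtain e K where e: "\<And>k. 0 < e k" and K: "\<And>k. (K k)-lipschitz_on (cball p (e k)) (\<lambda>x. f x $ k)"
    by metis
  define d where "d = Min (range e)"
  have "0 < d" using e by (simp add: d_def)
  have d: "d \<le> e k" for k by (simp add: d_def)
  have "(\<Sum>k\<in>UNIV. K k)-lipschitz_on (cball p d) f"
  proof (rule lipschitz_onI)
    fix x y assume "x \<in> cball p d" "y \<in> cball p d"
    then have xy: "x \<in> cball p (e k)" "y \<in> cball p (e k)" for k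
      using d[of k] by auto
    have "dist (f x) (f y) \<le> (\<Sum>k\<in>UNIV. dist (f x $ k) (f y $ k))"
      unfolding dist_vec_def by (rule L2_set_le_sum) simp
    also have "\<dots> \<le> (\<Sum>k\<in>UNIV. K k * dist x y)"
      by (intro sum_mono lipschitz_onD[OF K xy])
    finally show "dist (f x) (f y) \<le> (\<Sum>k\<in>UNIV. K k) * dist x y"
      by (simp add: sum_distrib_right)
  qed (use K lipschitz_on_nonneg sum_nonneg in metis)
  then show ?thesis
    using \<open>0 < d\<close> by (rule lipschitz_nearI[rotated])
qed

text \<open>A continuous derivative is bounded near each point, and convexity allows the mean value theorem.\<close>

lemma C1_on_imp_lipschitz_within:
  assumes C1: "C1_on S g" and S: "convex S" and q: "q \<in> S"
  obtains e K where "0 < e" "K-lipschitz_on (S \<inter> cball q e) g"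
proof -
  obtain g' where cont: "continuous_on S g'"
    and g': "\<And>x. x \<in> S \<Longrightarrow> (g has_derivative blinfun_apply (g' x)) (at x within S)"
    using C1 by (auto simp: C1_on_def)
  obtain d where d: "0 < d" "\<And>x. x \<in> S \<Longrightarrow> dist x q < d \<Longrightarrow> dist (g' x) (g' q) < 1"
    using cont q unfolding continuous_on_iff by (metis zero_less_one)
  have bound: "onorm (g' x) \<le> norm (g' q) + 1" if "x \<in> S \<inter> cball q (d / 2)" for x
  proof -
    have "dist (g' x) (g' q) < 1"
      using d that by (intro d(2)) (auto simp: dist_commute)
    then have "norm (g' x) \<le> norm (g' q) + 1"
      using norm_triangle_sub[of "g' x" "g' q"] by (simp add: dist_norm)
    then show ?thesis by (simp add: norm_blinfun.rep_eq)
  qed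
  have "(norm (g' q) + 1)-lipschitz_on (S \<inter> cball q (d / 2)) g"
  proof (rule lipschitz_onI)
    fix x y assume xy: "x \<in> S \<inter> cball q (d / 2)" "y \<in> S \<inter> cball q (d / 2)"
    have "norm (g x - g y) \<le> (norm (g' q) + 1) * norm (x - y)"
    proof (rule differentiable_bound[OF _ _ _ xy])
      show "convex (S \<inter> cball q (d / 2))"
        using S by (intro convex_Int convex_cball)
    qed (use g' bound in \<open>auto intro: has_derivative_subset\<close>)
    then show "dist (g x) (g y) \<le> (norm (g' q) + 1) * dist x y"
      by (simp add: dist_norm)
  qed simp
  then show thesis
    using that[of "d / 2"] d(1) by simp
qed

lemma C1_on_UNIV_imp_lipschitz_near: "C1_on UNIV g \<Longrightarrow> lipschitz_near q g"
  by (erule C1_on_imp_lipschitz_within[OF _ convex_UNIV UNIV_I]) (simp, rule lipschitz_nearI)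

lemma bounded_bilinear_matrix_vector_mult:
  "bounded_bilinear ((*v) :: real^'n^'m \<Rightarrow> real^'n \<Rightarrow> real^'m)"
  unfolding bilinear_conv_bounded_bilinear[symmetric] bilinear_def
  by (auto intro!: linearI simp: matrix_vector_mult_add_rdistrib matrix_vector_right_distrib
      scaleR_matrix_vector_assoc matrix_vector_mult_scaleR)

lemma bounded_bilinear_matrix_matrix_mult:
  "bounded_bilinear ((**) :: real^'n^'m \<Rightarrow> real^'k^'n \<Rightarrow> real^'k^'m)"
  unfolding bilinear_conv_bounded_bilinear[symmetric] bilinear_def
  by (auto intro!: linearI simp: vec_eq_iff matrix_matrix_mult_def sum.distrib sum_distrib_left
      algebra_simps)

lemma injective_on_subspace_imp_onto:
  fixes A :: "real^'k^'k"
  assumes S: "subspace S" and maps: "\<And>w. w \<in> S \<Longrightarrow> A *v w \<in> S"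
    and inj: "\<And>w. w \<in> S \<Longrightarrow> A *v w = 0 \<Longrightarrow> w = 0"
  shows "(*v) A ` S = S"
proof (rule subspace_dim_equal)
  have lin: "linear ((*v) A)" by simp
  have "inj_on ((*v) A) S"
    using linear_injective_on_subspace_0[OF lin S] inj by blast
  then have "dim ((*v) A ` S) = dim S"
    using dim_image_eq[OF lin, of S] by (simp only: span_eq_iff[THEN iffD2, OF S])
  then show "dim S \<le> dim ((*v) A ` S)" by simp
  show "subspace ((*v) A ` S)"
    by (rule linear_subspace_image[OF lin S])
qed (use S maps in auto)

text \<open>
  Invertibility on \<open>S\<close> at \<open>p\<close> gives \<open>m * norm w \<le> norm (M p *v w)\<close> there, with
  \<open>m / 2\<close> instead of \<open>m\<close> as long as \<open>M x\<close> differs from \<open>M p\<close>, as an operator, by at most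
  \<open>m / 2\<close>. This lower bound makes the solution unique, and it bounds differences of solutions
  by differences of the data.
\<close>

lemma lipschitz_near_linear_solution:
  fixes M :: "'a::metric_space \<Rightarrow> real^'k^'k" and b :: "'a \<Rightarrow> real^'k"
  assumes S: "subspace S" and maps: "\<And>x w. w \<in> S \<Longrightarrow> M x *v w \<in> S" and b: "\<And>x. b x \<in> S"
    and inj: "\<And>w. w \<in> S \<Longrightarrow> M p *v w = 0 \<Longrightarrow> w = 0"
    and lipM: "lipschitz_near p M" and lipb: "lipschitz_near p b"
  obtains u e where "lipschitz_near p u" "0 < e"
    "\<forall>x\<in>cball p e. \<forall>w. w \<in> S \<and> M x *v w = b x \<longleftrightarrow> w = u x"
proof -
  interpret mv: bounded_bilinear "(*v) :: real^'k^'k \<Rightarrow> real^'k \<Rightarrow> real^'k"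
    by (rule bounded_bilinear_matrix_vector_mult)
  obtain B where B: "0 < B" "\<And>A w. norm ((A::real^'k^'k) *v w) \<le> norm A * norm w * B"
    using mv.pos_bounded by metis
  obtain m where m: "0 < m" "\<And>w. w \<in> S \<Longrightarrow> m * norm w \<le> norm (M p *v w)"
    using injective_imp_isometric[OF closed_subspace[OF S] S, of "(*v) (M p)"] inj by auto

  obtain e1 K1 L1 where e1: "0 < e1" and K1: "0 \<le> K1" "K1-lipschitz_on (cball p e1) M"
    and L1: "0 \<le> L1" "L1-lipschitz_on (cball p e1) b"
    using lipschitz_nearE2[OF lipM lipb zero_less_one] by metis
  define e where "e = min e1 (m / (2 * B * (K1 + 1)))"
  have e: "0 < e" "e \<le> e1" "K1 * e * B \<le> m / 2"
  proof -
    show "0 < e" "e \<le> e1" using e1 m B K1 by (auto simp: e_def)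
    have "K1 * e * B \<le> (K1 + 1) * (m / (2 * B * (K1 + 1))) * B"
      using K1 B m \<open>0 < e\<close> by (intro mult_right_mono mult_mono) (auto simp: e_def)
    also have "\<dots> = m / 2"
    proof -
      have "B * (K1 + 1) \<noteq> 0" using B(1) K1(1) by auto
      then show ?thesis by (simp add: field_simps del: distrib_left_numeral)
    qed
    finally show "K1 * e * B \<le> m / 2" .
  qed
  have lipM': "K1-lipschitz_on (cball p e) M" and lipb': "L1-lipschitz_on (cball p e) b"
    using e(2) by (auto intro: lipschitz_on_subset[OF K1(2)] lipschitz_on_subset[OF L1(2)])
  have lower: "m / 2 * norm w \<le> norm (M x *v w)" if x: "x \<in> cball p e" and w: "w \<in> S" for x w
  proof -
    have "norm ((M p - M x) *v w) \<le> norm (M p - M x) * norm w * B"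
      by (rule B(2))
    also have "\<dots> \<le> (K1 * e) * norm w * B"
    proof -
      have "norm (M p - M x) \<le> K1 * dist p x"
        using lipschitz_onD[OF lipM', of p x] x e(1) by (simp add: dist_norm)
      also have "\<dots> \<le> K1 * e" using x K1 by (intro mult_left_mono) auto
      finally show ?thesis using B(1) by (intro mult_right_mono) auto
    qed
    also have "\<dots> \<le> m / 2 * norm w"
      using mult_right_mono[OF e(3), of "norm w"] by (simp add: ac_simps)
    finally have "norm (M p *v w) \<le> norm (M x *v w) + m / 2 * norm w"
      using norm_triangle_sub[of "M p *v w" "M x *v w"] by (simp add: mv.diff_left)
    then show ?thesis using m(2)[OF w] by (simp add: field_simps)
  qed
  have unique: "\<exists>!w. w \<in> S \<and> M x *v w = b x" if x: "x \<in> cball p e" for x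
  proof (rule ex_ex1I)
    have "(*v) (M x) ` S = S"
    proof (rule injective_on_subspace_imp_onto[OF S maps])
      show "w = 0" if "w \<in> S" "M x *v w = 0" for w
        using lower[OF x that(1)] that(2) m(1) by (simp add: mult_le_0_iff)
    qed
    then show "\<exists>w. w \<in> S \<and> M x *v w = b x" using b[of x] by (metis imageE)
    fix w w' assume "w \<in> S \<and> M x *v w = b x" "w' \<in> S \<and> M x *v w' = b x"
    then show "w = w'"
      using lower[OF x, of "w - w'"] m(1) subspace_diff[OF S, of w w']
      by (simp add: mv.diff_right mult_le_0_iff)
  qed
  define u where "u = (\<lambda>x. THE w. w \<in> S \<and> M x *v w = b x)"
  have u: "u x \<in> S" "M x *v u x = b x" if "x \<in> cball p e" for x
    using theI'[OF unique[OF that]] by (auto simp: u_def)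
  define Bu where "Bu = 2 / m * (norm (b p) + L1 * e)"
  have Bu: "norm (u x) \<le> Bu" if x: "x \<in> cball p e" for x
  proof -
    have "m / 2 * norm (u x) \<le> norm (b p) + L1 * e"
      using lower[OF x u(1)[OF x]] u(2)[OF x] lipschitz_on_cball_norm_le[OF lipb' x] by simp
    then show ?thesis using m(1) by (simp add: Bu_def field_simps)
  qed
  have "0 \<le> Bu" using Bu[of p] e(1) order_trans[OF norm_ge_zero] by auto
  define L where "L = 2 / m * (L1 + K1 * Bu * B)"
  have "L-lipschitz_on (cball p e) u"
  proof (rule lipschitz_onI)
    fix x y assume x: "x \<in> cball p e" and y: "y \<in> cball p e"
    have "m / 2 * norm (u x - u y) \<le> norm (M x *v (u x - u y))"
      by (rule lower[OF x subspace_diff[OF S u(1)[OF x] u(1)[OF y]]])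
    also have "M x *v (u x - u y) = (b x - b y) - (M x - M y) *v u y"
      by (simp add: mv.diff_right mv.diff_left u(2)[OF x] u(2)[OF y])
    also have "norm \<dots> \<le> norm (b x - b y) + norm (M x - M y) * norm (u y) * B"
      using B(2)[of "M x - M y" "u y"] norm_triangle_ineq4[of "b x - b y" "(M x - M y) *v u y"] by linarith
    also have "\<dots> \<le> L1 * dist x y + (K1 * dist x y) * Bu * B"
      using lipschitz_onD[OF lipb' x y] lipschitz_onD[OF lipM' x y] Bu[OF y] B(1) K1(1) \<open>0 \<le> Bu\<close>
      by (intro add_mono mult_mono) (auto simp flip: dist_norm)
    finally show "dist (u x) (u y) \<le> L * dist x y"
      using m(1) by (simp add: L_def dist_norm field_simps)
  next
    show "0 \<le> L" using m(1) K1(1) L1(1) B(1) \<open>0 \<le> Bu\<close> by (simp add: L_def)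
  qed
  then have "lipschitz_near p u" by (rule lipschitz_nearI[OF e(1)])
  moreover have "\<forall>x\<in>cball p e. \<forall>w. w \<in> S \<and> M x *v w = b x \<longleftrightarrow> w = u x"
    using u unique by blast
  ultimately show thesis using that e(1) by blast
qed

section \<open>Second-order necessary conditions from quadratic growth\<close>

lemma orthogonal_projection_exists:
  fixes T :: "'a::euclidean_space set"
  assumes T: "subspace T"
  obtains P where "bounded_linear P" "\<And>w. P w \<in> T" "\<And>w. w \<in> T \<Longrightarrow> P w = w"
    "\<And>v w. P v \<bullet> w = v \<bullet> P w"
proof -
  obtain B where B: "B \<subseteq> T" "pairwise orthogonal B" "\<And>b. b \<in> B \<Longrightarrow> norm b = 1"
    "independent B" "span B = T"
    using orthonormal_basis_subspace[OF T] by metis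
  have "finite B" using B(4) by (rule independent_imp_finite)
  define P where "P = (\<lambda>w. \<Sum>b\<in>B. (w \<bullet> b) *\<^sub>R b)"
  show thesis
  proof
    show "bounded_linear P"
      unfolding P_def
      by (intro bounded_linear_sum bounded_linear_compose[OF bounded_linear_scaleR_left]
          bounded_linear_inner_left)
    show "P w \<in> T" for w
      unfolding P_def using T B(1) by (intro subspace_sum subspace_scale) auto
    show "P w = w" if "w \<in> T" for w
      unfolding P_def using that B \<open>finite B\<close> by (intro orthonormal_basis_expand) auto
    show "P v \<bullet> w = v \<bullet> P w" for v w
      unfolding P_def by (simp add: inner_sum_left inner_sum_right inner_commute mult.commute)
  qed
qed

lemma linear_inverse_blinfun:
  fixes A :: "'a::euclidean_space \<Rightarrow>\<^sub>L 'a"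
  assumes "\<And>\<xi>. A \<xi> = 0 \<Longrightarrow> \<xi> = 0"
  obtains A' where "A' o\<^sub>L A = id_blinfun"
proof -
  have lin: "linear (blinfun_apply A)"
    by (rule bounded_linear.linear[OF blinfun.bounded_linear_right])
  then have "inj (blinfun_apply A)"
    using assms linear_injective_0 by blast
  then obtain g where g: "linear g" "g \<circ> blinfun_apply A = id"
    using linear_injective_left_inverse[OF lin] by blast
  have "Blinfun g o\<^sub>L A = id_blinfun"
    using g by (intro blinfun_eqI)
      (simp add: bounded_linear_Blinfun_apply linear_conv_bounded_linear[symmetric] fun_eq_iff)
  then show thesis by (rule that)
qed

text \<open>
  Let \<open>H\<close> be the derivative of \<open>h\<close> at \<open>s\<close> and \<open>P\<close> the orthogonal projection onto its kernel.
  The map \<open>\<Phi> q = P (q - s) + adjoint H (h q)\<close> has the injective derivative \<open>P + adjoint H \<circ> H\<close>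
  at \<open>s\<close>, so it is a local diffeomorphism there. The two summands of \<open>\<Phi>\<close> are orthogonal. Hence the
  inverse of \<open>\<Phi>\<close> takes the line through \<open>\<zeta>\<close>, which is in the kernel, to a curve along which
  \<open>adjoint H (h q)\<close> vanishes, and with it \<open>h q\<close>, by regularity. The velocity of the curve is \<open>\<zeta>\<close>,
  because the derivative of \<open>\<Phi>\<close> fixes \<open>\<zeta>\<close>.
\<close>

lemma feasible_curve:
  fixes h :: "'a::euclidean_space \<Rightarrow> 'b::euclidean_space" and h' :: "'a \<Rightarrow> 'a \<Rightarrow>\<^sub>L 'b"
  assumes deriv: "\<And>x. (h has_derivative blinfun_apply (h' x)) (at x)"
    and cont: "continuous_on UNIV h'"
    and hs: "h s = 0" and hW: "\<And>x. h x \<in> W"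
    and regular: "\<And>\<mu>. \<mu> \<in> W \<Longrightarrow> (\<And>\<xi>. h' s \<xi> \<bullet> \<mu> = 0) \<Longrightarrow> \<mu> = 0"
    and \<zeta>: "h' s \<zeta> = 0"
  obtains c where "c 0 = s" "(c has_vector_derivative \<zeta>) (at 0)"
    "\<forall>\<^sub>F t in at 0. h (c t) = 0"
proof -
  define T where "T = {\<xi>. h' s \<xi> = 0}"
  have T: "subspace T"
    unfolding T_def by (rule subspaceI) (auto simp: blinfun.add_right blinfun.scaleR_right)
  obtain P where P: "bounded_linear P" "\<And>w. P w \<in> T" "\<And>w. w \<in> T \<Longrightarrow> P w = w"
    "\<And>v w. P v \<bullet> w = v \<bullet> P w"
    using orthogonal_projection_exists[OF T] by metis
  have lin: "linear (blinfun_apply (h' s))"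
    by (rule bounded_linear.linear[OF blinfun.bounded_linear_right])
  define Ha where "Ha = adjoint (blinfun_apply (h' s))"
  have Ha: "\<xi> \<bullet> Ha y = h' s \<xi> \<bullet> y" for \<xi> y
    unfolding Ha_def by (rule adjoint_works[OF lin])
  have Ha_bl: "bounded_linear Ha"
    unfolding Ha_def using adjoint_linear[OF lin] by (simp add: linear_conv_bounded_linear)
  have Ha0: "Ha 0 = 0" using Ha_bl by (rule bounded_linear.linear[THEN linear_0])
  define \<Phi> where "\<Phi> = (\<lambda>q. P (q - s) + Ha (h q))"
  define \<Phi>' where "\<Phi>' = (\<lambda>q. Blinfun P + (Blinfun Ha o\<^sub>L h' q))"
  have \<Phi>'_apply: "\<Phi>' q \<xi> = P \<xi> + Ha (h' q \<xi>)" for q \<xi>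
    by (simp add: \<Phi>'_def plus_blinfun.rep_eq bounded_linear_Blinfun_apply P(1) Ha_bl)
  have \<Phi>_deriv: "(\<Phi> has_derivative blinfun_apply (\<Phi>' q)) (at q)" for q
  proof -
    have "(\<Phi> has_derivative (\<lambda>\<xi>. P (\<xi> - 0) + Ha (h' q \<xi>))) (at q)"
      unfolding \<Phi>_def
      by (intro has_derivative_add bounded_linear.has_derivative[OF P(1)]
          bounded_linear.has_derivative[OF Ha_bl] has_derivative_diff has_derivative_ident
          has_derivative_const deriv)
    then show ?thesis
      by (rule has_derivative_eq_rhs) (simp add: \<Phi>'_apply fun_eq_iff)
  qed
  have "\<xi> = 0" if "\<Phi>' s \<xi> = 0" for \<xi>
  proof -
    have eq: "P \<xi> + Ha (h' s \<xi>) = 0"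
      using that by (simp add: \<Phi>'_apply)
    have "h' s (P \<xi>) = 0" using P(2)[of \<xi>] by (simp add: T_def)
    then have "P \<xi> \<bullet> (P \<xi> + Ha (h' s \<xi>)) = P \<xi> \<bullet> P \<xi>"
      by (simp add: inner_add_right Ha)
    then have "P \<xi> = 0" using eq by simp
    then have "\<xi> \<bullet> Ha (h' s \<xi>) = 0" using eq by simp
    then have "\<xi> \<in> T" by (simp add: Ha T_def)
    then show ?thesis using P(3) \<open>P \<xi> = 0\<close> by simp
  qed
  then obtain A' where "A' o\<^sub>L \<Phi>' s = id_blinfun"
    using linear_inverse_blinfun by metis
  moreover have "continuous_on UNIV \<Phi>'"
    unfolding \<Phi>'_def by (intro continuous_intros cont)
  ultimately obtain U V g g' where inv: "open (V :: 'a set)" "\<Phi> s \<in> V" "homeomorphism U V \<Phi> g"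
    "s \<in> U" "\<And>y. y \<in> V \<Longrightarrow> (g has_derivative (g' y)) (at y)"
    "\<And>y. y \<in> V \<Longrightarrow> g' y = inv (blinfun_apply (\<Phi>' (g y)))"
    "\<And>y. y \<in> V \<Longrightarrow> bij (blinfun_apply (\<Phi>' (g y)))"
    using inverse_function_theorem[OF open_UNIV \<Phi>_deriv _ UNIV_I] by (metis UNIV_I)
  have P0: "P 0 = 0" using P(1) by (rule bounded_linear.linear[THEN linear_0])
  have \<Phi>s: "\<Phi> s = 0" by (simp add: \<Phi>_def hs P0 Ha0)
  have g0: "g 0 = s"
    using homeomorphism_apply1[OF inv(3,4)] by (simp add: \<Phi>s)
  define c where "c = (\<lambda>t. g (t *\<^sub>R \<zeta>))"
  show thesis
  proof
    show "c 0 = s" by (simp add: c_def g0)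
    have "\<Phi>' s \<zeta> = \<zeta>" using \<zeta> P(3)[of \<zeta>] by (simp add: \<Phi>'_apply T_def Ha0)
    then have g'\<zeta>: "g' 0 \<zeta> = \<zeta>"
      using inv(2) inv(6,7)[of 0] by (simp add: \<Phi>s g0) (metis bij_inv_eq_iff)
    have lin_deriv: "((\<lambda>t::real. t *\<^sub>R \<zeta>) has_vector_derivative \<zeta>) (at 0)"
      by (auto intro!: derivative_eq_intros)
    moreover have "(g has_derivative g' 0) (at (0 *\<^sub>R \<zeta>) within range (\<lambda>t. t *\<^sub>R \<zeta>))"
      using inv(2,5) by (auto simp: \<Phi>s intro: has_derivative_at_withinI)
    ultimately have "((g \<circ> (\<lambda>t. t *\<^sub>R \<zeta>)) has_vector_derivative g' 0 \<zeta>) (at 0)"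
      by (rule vector_derivative_diff_chain_within)
    then show "(c has_vector_derivative \<zeta>) (at 0)"
      by (simp add: c_def o_def g'\<zeta>)
    have "((\<lambda>t::real. t *\<^sub>R \<zeta>) \<longlongrightarrow> 0 *\<^sub>R \<zeta>) (at 0)"
      by (intro tendsto_intros)
    then have "\<forall>\<^sub>F t::real in at 0. t *\<^sub>R \<zeta> \<in> V"
      using inv(1,2) by (intro topological_tendstoD) (auto simp: \<Phi>s)
    then show "\<forall>\<^sub>F t in at 0. h (c t) = 0"
    proof (rule eventually_mono)
      fix t :: real assume t: "t *\<^sub>R \<zeta> \<in> V"
      let ?a = "Ha (h (c t))"
      have eq: "P (c t - s) + ?a = t *\<^sub>R \<zeta>"
        using homeomorphism_apply2[OF inv(3) t] by (simp add: c_def \<Phi>_def)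
      then have "?a = t *\<^sub>R \<zeta> - P (c t - s)"
        by (simp add: algebra_simps)
      also have "\<dots> \<in> T"
        using \<zeta> P(2) by (intro subspace_diff[OF T] subspace_scale[OF T]) (simp_all add: T_def)
      finally have "?a \<bullet> ?a = 0"
        by (subst Ha) (simp add: T_def)
      then have "?a = 0" by simp
      then have "h' s \<xi> \<bullet> h (c t) = 0" for \<xi>
        using Ha[of \<xi> "h (c t)"] by simp
      then show "h (c t) = 0"
        by (rule regular[OF hW])
    qed
  qed
qed

text \<open>Along a feasible curve with velocity \<open>\<zeta>\<close> the function \<open>F\<close> has a local minimum at \<open>s\<close>.\<close>

lemma constrained_minimizer_stationary:
  fixes F :: "'a::euclidean_space \<Rightarrow> real" and h :: "'a \<Rightarrow> 'b::euclidean_space"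
    and h' :: "'a \<Rightarrow> 'a \<Rightarrow>\<^sub>L 'b"
  assumes deriv: "\<And>x. (h has_derivative blinfun_apply (h' x)) (at x)"
    and cont: "continuous_on UNIV h'"
    and hs: "h s = 0" and hW: "\<And>x. h x \<in> W"
    and regular: "\<And>\<mu>. \<mu> \<in> W \<Longrightarrow> (\<And>\<xi>. h' s \<xi> \<bullet> \<mu> = 0) \<Longrightarrow> \<mu> = 0"
    and F: "(F has_derivative F') (at s)"
    and U: "open U" "s \<in> U" and min: "\<And>q. q \<in> U \<Longrightarrow> h q = 0 \<Longrightarrow> F s \<le> F q"
    and \<zeta>: "h' s \<zeta> = 0"
  shows "F' \<zeta> = 0"
proof -
  obtain c where c: "c 0 = s" "(c has_vector_derivative \<zeta>) (at 0)"
    "\<forall>\<^sub>F t in at 0. h (c t) = 0"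
    using feasible_curve[OF deriv cont hs hW regular \<zeta>] by metis
  have "((F \<circ> c) has_vector_derivative F' \<zeta>) (at 0)"
    using c(1) F by (intro vector_derivative_diff_chain_within[OF c(2)])
      (simp add: has_derivative_at_withinI)
  then have D: "DERIV (F \<circ> c) 0 :> F' \<zeta>"
    by (simp add: has_real_derivative_iff_has_vector_derivative)
  have "isCont c 0" using c(2) by (rule has_vector_derivative_continuous)
  then have "\<forall>\<^sub>F t in at 0. c t \<in> U"
    using U c(1) by (intro topological_tendstoD) (auto simp: isCont_def)
  with c(3) have "\<forall>\<^sub>F t in at 0. (F \<circ> c) 0 \<le> (F \<circ> c) t"
    by eventually_elim (simp add: c(1) min)
  then obtain d where "0 < d" "\<And>t. t \<noteq> 0 \<Longrightarrow> dist t 0 < d \<Longrightarrow> (F \<circ> c) 0 \<le> (F \<circ> c) t"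
    unfolding eventually_at by auto
  then have "\<forall>t. \<bar>0 - t\<bar> < d \<longrightarrow> (F \<circ> c) 0 \<le> (F \<circ> c) t"
    by (metis abs_minus_commute diff_0_right dist_real_def order_refl)
  then show ?thesis
    using DERIV_local_min[OF D \<open>0 < d\<close>] by simp
qed

text \<open>
  Taylor's formula for a function whose derivative is differentiable at the single point \<open>s\<close>:
  the mean value theorem is applied to \<open>l (s + \<tau> *\<^sub>R w)\<close> minus its expected quadratic part.
\<close>

lemma second_order_upper_bound:
  fixes l :: "'a::real_normed_vector \<Rightarrow> real" and l' :: "'a \<Rightarrow> 'a \<Rightarrow>\<^sub>L real"
  assumes l: "\<And>x. (l has_derivative blinfun_apply (l' x)) (at x)"
    and D: "(l' has_derivative D) (at s)" and l's: "l' s = 0" and \<epsilon>: "0 < \<epsilon>"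
  obtains d where "0 < d"
    "\<And>w. norm w < d \<Longrightarrow> l (s + w) \<le> l s + D w w / 2 + \<epsilon> * (norm w)\<^sup>2"
proof -
  have D_bl: "bounded_linear D" using D by (rule has_derivative_bounded_linear)
  obtain d where d: "0 < d"
    "\<And>y. norm (y - s) < d \<Longrightarrow> norm (l' y - l' s - D (y - s)) \<le> \<epsilon> * norm (y - s)"
    using D \<epsilon> unfolding has_derivative_at_alt by blast
  show thesis
  proof (rule that[OF d(1)])
    fix w :: 'a assume w: "norm w < d"
    define \<phi> where "\<phi> = (\<lambda>\<tau>::real. l (s + \<tau> *\<^sub>R w) - \<tau>\<^sup>2 / 2 * D w w)"
    have "(\<phi> has_derivative (\<lambda>h. h * (l' (s + \<tau> *\<^sub>R w) w - \<tau> * D w w))) (at \<tau> within {0..1})" for \<tau>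
    proof -
      have line: "((\<lambda>\<tau>. s + \<tau> *\<^sub>R w) has_derivative (\<lambda>h. h *\<^sub>R w)) (at \<tau> within {0..1})"
        by (auto intro!: derivative_eq_intros)
      have "((\<lambda>\<tau>. l (s + \<tau> *\<^sub>R w)) has_derivative (\<lambda>h. l' (s + \<tau> *\<^sub>R w) (h *\<^sub>R w))) (at \<tau> within {0..1})"
        by (rule has_derivative_compose[OF line l])
      then show ?thesis
        unfolding \<phi>_def
        by (auto intro!: derivative_eq_intros simp: blinfun.scaleR_right algebra_simps)
    qed
    then obtain \<tau> where \<tau>: "\<tau> \<in> {0..1}" "\<phi> 1 - \<phi> 0 = l' (s + \<tau> *\<^sub>R w) w - \<tau> * D w w"
      using mvt_very_simple[of 0 1 \<phi>] by force
    have small: "norm (\<tau> *\<^sub>R w) \<le> norm w"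
      using \<tau>(1) by (simp add: mult_left_le_one_le)
    have "l' (s + \<tau> *\<^sub>R w) w - \<tau> * D w w = (l' (s + \<tau> *\<^sub>R w) - D (\<tau> *\<^sub>R w)) w"
      using D_bl by (simp add: blinfun.diff_left linear_simps blinfun.scaleR_left)
    also have "\<dots> \<le> norm (l' (s + \<tau> *\<^sub>R w) - D (\<tau> *\<^sub>R w)) * norm w"
      using norm_blinfun[of "l' (s + \<tau> *\<^sub>R w) - D (\<tau> *\<^sub>R w)" w] by (simp add: abs_le_iff)
    also have "\<dots> \<le> (\<epsilon> * norm (\<tau> *\<^sub>R w)) * norm w"
      using d(2)[of "s + \<tau> *\<^sub>R w"] small w l's by (intro mult_right_mono) auto
    also have "\<dots> \<le> (\<epsilon> * norm w) * norm w"
      using small \<epsilon> by (intro mult_right_mono mult_left_mono) auto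
    finally show "l (s + w) \<le> l s + D w w / 2 + \<epsilon> * (norm w)\<^sup>2"
      using \<tau>(2) by (simp add: \<phi>_def power2_eq_square)
  qed
qed

text \<open>
  On feasible points the Lagrangian \<open>F q + h q \<bullet> \<mu>\<close> equals \<open>F\<close>, and it is stationary at \<open>s\<close>, so
  the growth of \<open>F\<close> along a feasible curve with velocity \<open>\<zeta>\<close> bounds the second derivative of
  the Lagrangian in the direction \<open>\<zeta>\<close>.
\<close>

lemma lagrangian_second_derivative_ge:
  fixes F :: "'a::euclidean_space \<Rightarrow> real" and h :: "'a \<Rightarrow> 'b::euclidean_space"
    and F' :: "'a \<Rightarrow> 'a \<Rightarrow>\<^sub>L real" and h' :: "'a \<Rightarrow> 'a \<Rightarrow>\<^sub>L 'b"
  assumes h: "\<And>x. (h has_derivative blinfun_apply (h' x)) (at x)"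
    and cont: "continuous_on UNIV h'"
    and h': "(h' has_derivative h'') (at s)"
    and F: "\<And>x. (F has_derivative blinfun_apply (F' x)) (at x)"
    and F': "(F' has_derivative F'') (at s)"
    and hs: "h s = 0" and hW: "\<And>x. h x \<in> W"
    and regular: "\<And>\<mu>. \<mu> \<in> W \<Longrightarrow> (\<And>\<xi>. h' s \<xi> \<bullet> \<mu> = 0) \<Longrightarrow> \<mu> = 0"
    and stationary: "\<And>\<xi>. F' s \<xi> + h' s \<xi> \<bullet> \<mu> = 0"
    and U: "open U" "s \<in> U"
    and growth: "\<And>q. q \<in> U \<Longrightarrow> h q = 0 \<Longrightarrow> F s + \<rho> / 2 * (norm (q - s))\<^sup>2 \<le> F q"
    and \<zeta>: "h' s \<zeta> = 0"
  shows "\<rho> * (\<zeta> \<bullet> \<zeta>) \<le> F'' \<zeta> \<zeta> + h'' \<zeta> \<zeta> \<bullet> \<mu>"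
proof -
  define l where "l = (\<lambda>q. F q + h q \<bullet> \<mu>)"
  define l' where "l' = (\<lambda>q. F' q + (blinfun_inner_left \<mu> o\<^sub>L h' q))"
  define D where "D = (\<lambda>w. F'' w + (blinfun_inner_left \<mu> o\<^sub>L h'' w))"
  have l: "(l has_derivative blinfun_apply (l' x)) (at x)" for x
  proof -
    have "(l has_derivative (\<lambda>\<xi>. F' x \<xi> + h' x \<xi> \<bullet> \<mu>)) (at x)"
      unfolding l_def by (intro has_derivative_add has_derivative_inner_left F h)
    then show ?thesis
      by (rule has_derivative_eq_rhs) (simp add: l'_def plus_blinfun.rep_eq fun_eq_iff)
  qed
  have D: "(l' has_derivative D) (at s)"
    unfolding l'_def D_def
    by (intro has_derivative_add F'
        bounded_linear.has_derivative[OF bounded_bilinear.bounded_linear_right[OF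
          bounded_bilinear_blinfun_compose]] h')
  have D_apply: "D w v = F'' w v + h'' w v \<bullet> \<mu>" for w v
    by (simp add: D_def plus_blinfun.rep_eq)
  have l's: "l' s = 0"
    using stationary by (intro blinfun_eqI) (simp add: l'_def plus_blinfun.rep_eq)
  obtain c where c: "c 0 = s" "(c has_vector_derivative \<zeta>) (at 0)"
    "\<forall>\<^sub>F t in at 0. h (c t) = 0"
    using feasible_curve[OF h cont hs hW regular \<zeta>] by metis
  \<comment> \<open>Dividing the second-order bound at \<open>c t\<close> by \<open>t\<^sup>2\<close> turns it into a bound for the
      difference quotients \<open>v t\<close>, which converge to \<open>\<zeta>\<close>.\<close>
  define v where "v = (\<lambda>t. (1 / t) *\<^sub>R (c t - s))"
  have v_lim: "(v \<longlongrightarrow> \<zeta>) (at 0)"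
  proof -
    have "((\<lambda>t. norm (c t - s - t *\<^sub>R \<zeta>) / norm t) \<longlongrightarrow> 0) (at 0)"
      using c(2) unfolding has_vector_derivative_def has_derivative_at by (simp add: c(1))
    then have "((\<lambda>t. norm (v t - \<zeta>)) \<longlongrightarrow> 0) (at 0)"
    proof (rule Lim_transform_eventually)
      have *: "norm (c t - s - t *\<^sub>R \<zeta>) / norm t = norm (v t - \<zeta>)" if "t \<noteq> 0" for t
      proof -
        have "v t - \<zeta> = (1 / t) *\<^sub>R (c t - s - t *\<^sub>R \<zeta>)"
          using that by (simp add: v_def scaleR_diff_right)
        then show ?thesis by (simp add: divide_inverse abs_inverse mult.commute)
      qed
      show "\<forall>\<^sub>F t in at 0. norm (c t - s - t *\<^sub>R \<zeta>) / norm t = norm (v t - \<zeta>)"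
        by (rule eventually_mono[OF eventually_neq_at_within]) (rule *)
    qed
    then show ?thesis
      by (simp add: tendsto_norm_zero_iff LIM_zero_iff)
  qed
  have D_bl: "bounded_linear D" using D by (rule has_derivative_bounded_linear)
  have bound: "\<rho> / 2 * (\<zeta> \<bullet> \<zeta>) \<le> D \<zeta> \<zeta> / 2 + \<epsilon> * (\<zeta> \<bullet> \<zeta>)" if \<epsilon>: "0 < \<epsilon>" for \<epsilon>
  proof (rule tendsto_le[of "at (0::real)"])
    show "((\<lambda>t. \<rho> / 2 * (v t \<bullet> v t)) \<longlongrightarrow> \<rho> / 2 * (\<zeta> \<bullet> \<zeta>)) (at 0)"
      by (intro tendsto_intros v_lim)
    show "((\<lambda>t. D (v t) (v t) / 2 + \<epsilon> * (v t \<bullet> v t)) \<longlongrightarrow> D \<zeta> \<zeta> / 2 + \<epsilon> * (\<zeta> \<bullet> \<zeta>)) (at 0)"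
      by (intro tendsto_intros v_lim blinfun.tendsto bounded_linear.tendsto[OF D_bl]) simp
    obtain d where d: "0 < d"
      "\<And>w. norm w < d \<Longrightarrow> l (s + w) \<le> l s + D w w / 2 + \<epsilon> * (norm w)\<^sup>2"
      using second_order_upper_bound[OF l D l's \<epsilon>] by metis
    have c_lim: "(c \<longlongrightarrow> s) (at 0)"
      using has_vector_derivative_continuous[OF c(2)] c(1) by (simp add: isCont_def)
    have "\<forall>\<^sub>F t in at 0. c t \<in> U"
      using U by (intro topological_tendstoD[OF c_lim]) auto
    moreover have "\<forall>\<^sub>F t in at 0. dist (c t) s < d"
      by (rule tendstoD[OF c_lim d(1)])
    moreover have "\<forall>\<^sub>F t in at (0::real). t \<noteq> 0"
      by (rule eventually_neq_at_within)
    ultimately show "\<forall>\<^sub>F t in at 0. \<rho> / 2 * (v t \<bullet> v t) \<le> D (v t) (v t) / 2 + \<epsilon> * (v t \<bullet> v t)"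
      using c(3)
    proof eventually_elim
      case (elim t)
      define w where "w = c t - s"
      have w: "w = t *\<^sub>R v t" using elim by (simp add: w_def v_def)
      have "F s + \<rho> / 2 * (norm w)\<^sup>2 \<le> F (c t)"
        unfolding w_def using elim by (intro growth) auto
      also have "\<dots> = l (s + w)" using elim by (simp add: l_def w_def)
      also have "\<dots> \<le> l s + D w w / 2 + \<epsilon> * (norm w)\<^sup>2"
        using elim by (intro d(2)) (simp add: w_def dist_norm)
      finally have "\<rho> / 2 * (w \<bullet> w) \<le> D w w / 2 + \<epsilon> * (w \<bullet> w)"
        by (simp add: l_def hs power2_norm_eq_inner)
      then have "t\<^sup>2 * (\<rho> / 2 * (v t \<bullet> v t)) \<le> t\<^sup>2 * (D (v t) (v t) / 2 + \<epsilon> * (v t \<bullet> v t))"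
        using D_bl
        by (simp add: w linear_simps blinfun.scaleR_left blinfun.scaleR_right power2_eq_square algebra_simps)
      then show ?case using elim by (simp add: mult_le_cancel_left)
    qed
  qed simp
  have "\<rho> / 2 * (\<zeta> \<bullet> \<zeta>) - D \<zeta> \<zeta> / 2 \<le> e" if "0 < e" for e
  proof -
    have "\<rho> / 2 * (\<zeta> \<bullet> \<zeta>) - D \<zeta> \<zeta> / 2 \<le> e / (\<zeta> \<bullet> \<zeta> + 1) * (\<zeta> \<bullet> \<zeta>)"
      using bound[of "e / (\<zeta> \<bullet> \<zeta> + 1)"] divide_pos_pos[OF that, of "\<zeta> \<bullet> \<zeta> + 1"]
        inner_ge_zero[of \<zeta>] by linarith
    also have "\<dots> \<le> e"
    proof -
      have "0 < \<zeta> \<bullet> \<zeta> + 1" by (simp add: add_nonneg_pos)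
      then show ?thesis using that by (simp add: pos_divide_le_eq algebra_simps)
    qed
    finally show ?thesis .
  qed
  then have "\<rho> / 2 * (\<zeta> \<bullet> \<zeta>) - D \<zeta> \<zeta> / 2 \<le> 0"
    by (metis field_le_epsilon add_0)
  then show ?thesis by (simp add: D_apply)
qed

section \<open>Stability from the output dynamics and the tangential linearization\<close>

text \<open>On the orthogonal complement of its kernel \<open>A\<close> is injective, hence bounded below.\<close>

lemma norm_complement_le_kernel_map:
  fixes A :: "'e::euclidean_space \<Rightarrow> 'y::euclidean_space"
  assumes A: "bounded_linear A"
    and P: "bounded_linear P" "\<And>w. A (P w) = 0" "\<And>w. A w = 0 \<Longrightarrow> P w = w" "\<And>v w. P v \<bullet> w = v \<bullet> P w"
  obtains c where "0 < c" "\<And>w. norm (w - P w) \<le> c * norm (A w)"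
proof -
  interpret A: bounded_linear A by fact
  define N where "N = {w. \<forall>z. A z = 0 \<longrightarrow> w \<bullet> z = 0}"
  have N: "subspace N" unfolding N_def
    by (rule subspaceI) (auto simp: inner_add_left)
  have "\<forall>w\<in>N. A w = 0 \<longrightarrow> w = 0"
    by (auto simp: N_def)
  then obtain e where e: "0 < e" "\<And>w. w \<in> N \<Longrightarrow> e * norm w \<le> norm (A w)"
    using injective_imp_isometric[OF closed_subspace[OF N] N A] by metis
  show thesis
  proof (rule that[of "1 / e"])
    fix w
    have "w - P w \<in> N"
      using P(3,4) by (simp add: N_def inner_diff_left)
    then show "norm (w - P w) \<le> 1 / e * norm (A w)"
      using e(1) e(2)[of "w - P w"] by (simp add: A.diff P(2) field_simps)
  qed (use e(1) in simp)
qed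

lemma weighted_young:
  fixes a b g E :: real
  assumes g: "0 < g"
  shows "E * (a * b) \<le> g / 2 * a\<^sup>2 + E\<^sup>2 / (2 * g) * b\<^sup>2"
proof -
  have "0 \<le> (g * a - E * b)\<^sup>2" by simp
  then have "2 * g * (E * (a * b)) \<le> g\<^sup>2 * a\<^sup>2 + E\<^sup>2 * b\<^sup>2"
    by (simp add: power2_eq_square algebra_simps)
  also have "\<dots> = 2 * g * (g / 2 * a\<^sup>2 + E\<^sup>2 / (2 * g) * b\<^sup>2)"
    using g by (simp add: power2_eq_square distrib_left)
  finally show ?thesis using g by simp
qed

text \<open>
  Here \<open>P\<close> is the orthogonal projection onto the tangent space of \<open>y = 0\<close> at \<open>p\<close>. The
  component of \<open>x - p\<close> orthogonal to the tangent space is bounded by \<open>y x\<close> up to terms of higher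
  order. Therefore \<open>P (x - p)\<close> and \<open>y x\<close> together measure the distance to \<open>p\<close>, and \<open>y x\<close>
  perturbs the tangential motion only through a product with \<open>P (x - p)\<close>, which is split by Young's
  inequality: half of the gap \<open>\<beta> - \<alpha>\<close> pays for it, the other half for the errors of linearization.
\<close>

lemma tangential_dissipation:
  fixes X :: "'e::euclidean_space \<Rightarrow> 'e" and y :: "'e \<Rightarrow> 'y::euclidean_space"
  assumes Xp: "X p = 0" and A: "(y has_derivative A) (at p)" and yp: "y p = 0"
    and tangential: "\<And>z. A z = 0 \<Longrightarrow>
      \<exists>k. ((\<lambda>x. z \<bullet> X x) has_derivative k) (at p) \<and> k z \<le> - \<beta> * (z \<bullet> z)"
    and \<alpha>: "\<alpha> < \<beta>"
  obtains P r c1 c2 where "bounded_linear P" "\<And>v w. P v \<bullet> w = v \<bullet> P w" "\<And>w. P (P w) = P w"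
    "0 < r" "0 < c1" "0 < c2"
    "\<And>x. norm (x - p) \<le> r \<Longrightarrow> norm (x - p) \<le> c1 * (norm (P (x - p)) + norm (y x))"
    "\<And>x. norm (x - p) \<le> r \<Longrightarrow>
      P (x - p) \<bullet> X x \<le> - \<alpha> * (P (x - p) \<bullet> P (x - p)) + c2 * (norm (y x))\<^sup>2"
proof -
  have A_bl: "bounded_linear A" using A by (rule has_derivative_bounded_linear)
  then interpret A: bounded_linear A .
  define T where "T = {z. A z = 0}"
  have T: "subspace T" unfolding T_def by (rule subspaceI) (auto simp: A.add A.scaleR)
  obtain P where P_bl: "bounded_linear P" and PT: "\<And>w. P w \<in> T"
    and P_id: "\<And>w. w \<in> T \<Longrightarrow> P w = w" and P_adj: "\<And>v w. P v \<bullet> w = v \<bullet> P w"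
    using orthogonal_projection_exists[OF T] by metis
  interpret P: bounded_linear P by fact
  have "A (P w) = 0" "A w = 0 \<Longrightarrow> P w = w" for w
    using PT P_id by (simp_all add: T_def)
  then obtain c where c: "0 < c" "\<And>w. norm (w - P w) \<le> c * norm (A w)"
    using norm_complement_le_kernel_map[OF A_bl P_bl _ _ P_adj] by metis
  obtain k where k: "\<And>z. z \<in> T \<Longrightarrow> ((\<lambda>x. z \<bullet> X x) has_derivative k z) (at p)"
    "\<And>z. z \<in> T \<Longrightarrow> k z z \<le> - \<beta> * (z \<bullet> z)"
    using tangential unfolding T_def mem_Collect_eq by metis
  \<comment> \<open>The coordinates of \<open>P (X x)\<close> are the pairings of \<open>X x\<close> with the tangent vectors \<open>P b\<close>.\<close>
  define L where "L = (\<lambda>w. \<Sum>b\<in>Basis. k (P b) w *\<^sub>R b)"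
  have L: "((\<lambda>x. P (X x)) has_derivative L) (at p)"
  proof (rule has_derivative_componentwise_within[THEN iffD2], rule ballI)
    fix b :: 'e assume b: "b \<in> Basis"
    have "(\<lambda>x. P (X x) \<bullet> b) = (\<lambda>x. P b \<bullet> X x)"
      by (simp add: P_adj inner_commute)
    moreover have "(\<lambda>w. L w \<bullet> b) = k (P b)"
      unfolding L_def using b by (simp add: inner_sum_left inner_Basis if_distrib sum.delta cong: if_cong)
    ultimately show "((\<lambda>x. P (X x) \<bullet> b) has_derivative (\<lambda>w. L w \<bullet> b)) (at p)"
      using k(1)[OF PT] by simp
  qed
  have L_tangential: "z \<bullet> L z \<le> - \<beta> * (z \<bullet> z)" if z: "z \<in> T" for z
  proof -
    have "((\<lambda>x. z \<bullet> P (X x)) has_derivative (\<lambda>w. z \<bullet> L w)) (at p)"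
      by (rule has_derivative_inner_right[OF L])
    moreover have "(\<lambda>x. z \<bullet> P (X x)) = (\<lambda>x. z \<bullet> X x)"
      using P_id[OF z] P_adj by metis
    ultimately have "(\<lambda>w. z \<bullet> L w) = k z"
      using k(1)[OF z] has_derivative_unique by metis
    then show ?thesis using k(2)[OF z] by (metis (no_types))
  qed
  have L_bl: "bounded_linear L" using L by (rule has_derivative_bounded_linear)
  then interpret L: bounded_linear L .
  obtain \<kappa> where \<kappa>: "0 < \<kappa>" "\<And>w. norm (L w) \<le> \<kappa> * norm w"
    using L.pos_bounded by (metis mult.commute)
  \<comment> \<open>The first bound on \<open>\<epsilon>\<close> lets \<open>\<epsilon> * norm (x - p)\<close> be absorbed in \<open>norm (x - p)\<close>; by the second
      one the linearization errors cost at most half of the gap \<open>\<beta> - \<alpha>\<close>.\<close>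
  define m where "m = 2 * \<kappa> * c + 2"
  define \<epsilon> where "\<epsilon> = min (1 / (2 * c)) ((\<beta> - \<alpha>) / (2 * m))"
  have "0 < m" using c(1) \<kappa>(1) by (simp add: m_def add_pos_pos)
  have \<epsilon>: "0 < \<epsilon>" "2 * c * \<epsilon> \<le> 1" "\<epsilon> * m \<le> (\<beta> - \<alpha>) / 2"
  proof -
    show "0 < \<epsilon>" using c(1) \<alpha> \<open>0 < m\<close> by (simp add: \<epsilon>_def)
    have "2 * c * \<epsilon> \<le> 2 * c * (1 / (2 * c))"
      using c(1) by (intro mult_left_mono) (auto simp: \<epsilon>_def)
    then show "2 * c * \<epsilon> \<le> 1" using c(1) by simp
    have "\<epsilon> * m \<le> (\<beta> - \<alpha>) / (2 * m) * m"
      using \<open>0 < m\<close> by (intro mult_right_mono) (auto simp: \<epsilon>_def)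
    then show "\<epsilon> * m \<le> (\<beta> - \<alpha>) / 2"
      using \<open>0 < m\<close> by simp
  qed
  obtain d1 where d1: "0 < d1"
    "\<And>x. norm (x - p) < d1 \<Longrightarrow> norm (y x - y p - A (x - p)) \<le> \<epsilon> * norm (x - p)"
    using A \<epsilon>(1) unfolding has_derivative_at_alt by blast
  obtain d2 where d2: "0 < d2"
    "\<And>x. norm (x - p) < d2 \<Longrightarrow> norm (P (X x) - P (X p) - L (x - p)) \<le> \<epsilon> * norm (x - p)"
    using L \<epsilon>(1) unfolding has_derivative_at_alt by blast
  define r where "r = min d1 d2 / 2"
  define E where "E = 2 * c * \<kappa> + 1"
  have E: "0 < E" using c(1) \<kappa>(1) by (simp add: E_def add_pos_pos)
  have main: "norm (x - p) \<le> 2 * norm (P (x - p)) + 2 * c * norm (y x) \<and>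
      P (x - p) \<bullet> X x \<le> - \<alpha> * (P (x - p) \<bullet> P (x - p)) + E\<^sup>2 / (2 * (\<beta> - \<alpha>)) * (norm (y x))\<^sup>2"
    if x: "norm (x - p) \<le> r" for x
  proof -
    define w where "w = x - p"
    define z where "z = P w"
    define q where "q = w - z"
    have zT: "z \<in> T" by (simp add: z_def PT)
    have "0 < r" using d1(1) d2(1) by (simp add: r_def)
    have near: "norm (x - p) < d1" "norm (x - p) < d2"
      using x \<open>0 < r\<close> by (auto simp: r_def)
    have "norm (A w) \<le> norm (y x) + norm (y x - A w)"
      using norm_triangle_sub[of "A w" "y x"] by (simp add: norm_minus_commute)
    also have "\<dots> \<le> norm (y x) + \<epsilon> * norm w"
      using d1(2)[OF near(1)] by (simp add: yp w_def)
    finally have q: "norm q \<le> c * (norm (y x) + \<epsilon> * norm w)"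
      unfolding q_def z_def using c(1) by (intro order_trans[OF c(2) mult_left_mono]) auto
    have "norm w \<le> norm z + norm q"
      using norm_triangle_ineq[of z q] by (simp add: q_def)
    moreover have "c * \<epsilon> * norm w \<le> 1 / 2 * norm w"
      using \<epsilon>(2) by (intro mult_right_mono) auto
    ultimately have w: "norm w \<le> 2 * norm z + 2 * c * norm (y x)"
      using q by (simp add: algebra_simps)
    have "c * \<epsilon> * norm w \<le> c * \<epsilon> * (2 * norm z + 2 * c * norm (y x))"
      using w c(1) \<epsilon>(1) by (intro mult_left_mono) auto
    also have "\<dots> = 2 * c * \<epsilon> * norm z + (2 * c * \<epsilon>) * (c * norm (y x))"
      by (simp add: algebra_simps)
    also have "\<dots> \<le> 2 * c * \<epsilon> * norm z + 1 * (c * norm (y x))"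
      using \<epsilon>(2) c(1) by (intro add_left_mono mult_right_mono) auto
    finally have q': "norm q \<le> 2 * c * norm (y x) + 2 * c * \<epsilon> * norm z"
      using q by (simp add: algebra_simps)
    have "z \<bullet> X x = z \<bullet> P (X x)"
      using P_id[OF zT] P_adj by metis
    also have "\<dots> = z \<bullet> L z + z \<bullet> L q + z \<bullet> (P (X x) - L w)"
      by (simp add: q_def L.diff inner_diff_right)
    also have "\<dots> \<le> - \<beta> * (z \<bullet> z) + norm z * (\<kappa> * norm q) + norm z * (\<epsilon> * norm w)"
    proof (intro add_mono L_tangential zT)
      show "z \<bullet> L q \<le> norm z * (\<kappa> * norm q)"
        using norm_cauchy_schwarz[of z "L q"] mult_left_mono[OF \<kappa>(2)[of q], of "norm z"] by simp
      have "norm (P (X x) - L w) \<le> \<epsilon> * norm w"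
        using d2(2)[OF near(2)] by (simp add: w_def Xp P.zero)
      then show "z \<bullet> (P (X x) - L w) \<le> norm z * (\<epsilon> * norm w)"
        using norm_cauchy_schwarz[of z "P (X x) - L w"]
          mult_left_mono[of "norm (P (X x) - L w)" "\<epsilon> * norm w" "norm z"] by simp
    qed
    also have "\<dots> \<le> - \<beta> * (z \<bullet> z) + norm z * (\<kappa> * (2 * c * norm (y x) + 2 * c * \<epsilon> * norm z))
        + norm z * (\<epsilon> * (2 * norm z + 2 * c * norm (y x)))"
      using q' w \<kappa>(1) \<epsilon>(1) by (intro add_mono order_refl mult_left_mono) auto
    also have "\<dots> = - \<beta> * (z \<bullet> z) + (\<epsilon> * m) * (z \<bullet> z)
        + (2 * c * \<kappa> + 2 * c * \<epsilon>) * (norm z * norm (y x))"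
      by (simp add: m_def algebra_simps power2_norm_eq_inner[symmetric] power2_eq_square)
    also have "\<dots> \<le> - \<beta> * (z \<bullet> z) + (\<beta> - \<alpha>) / 2 * (z \<bullet> z) + E * (norm z * norm (y x))"
      using \<epsilon> by (intro add_mono order_refl mult_right_mono) (auto simp: E_def)
    also have "E * (norm z * norm (y x)) \<le> (\<beta> - \<alpha>) / 2 * (z \<bullet> z) + E\<^sup>2 / (2 * (\<beta> - \<alpha>)) * (norm (y x))\<^sup>2"
      using weighted_young[of "\<beta> - \<alpha>" E "norm z" "norm (y x)"] \<alpha>
      by (simp add: power2_norm_eq_inner)
    finally have "z \<bullet> X x \<le> - \<alpha> * (z \<bullet> z) + E\<^sup>2 / (2 * (\<beta> - \<alpha>)) * (norm (y x))\<^sup>2"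
      by (simp add: field_simps)
    then show ?thesis using w by (simp add: z_def w_def)
  qed
  show thesis
  proof (rule that[OF P_bl P_adj])
    show "P (P w) = P w" for w by (rule P_id[OF PT])
    show "0 < r" using d1(1) d2(1) by (simp add: r_def)
    show "0 < max 2 (2 * c)" by simp
    show "0 < E\<^sup>2 / (2 * (\<beta> - \<alpha>))" using E \<alpha> by simp
    fix x assume x: "norm (x - p) \<le> r"
    have "norm (x - p) \<le> 2 * norm (P (x - p)) + 2 * c * norm (y x)"
      using main[OF x] by blast
    also have "\<dots> \<le> max 2 (2 * c) * norm (P (x - p)) + max 2 (2 * c) * norm (y x)"
      by (intro add_mono mult_right_mono) auto
    finally show "norm (x - p) \<le> max 2 (2 * c) * (norm (P (x - p)) + norm (y x))"
      by (simp add: distrib_left)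
    show "P (x - p) \<bullet> X x \<le> - \<alpha> * (P (x - p) \<bullet> P (x - p)) + E\<^sup>2 / (2 * (\<beta> - \<alpha>)) * (norm (y x))\<^sup>2"
      using main[OF x] by blast
  qed
qed

text \<open>
  Along the flow \<open>y\<close> obeys its own equation and therefore decays at the rate \<open>\<alpha>G\<close>;
  the squared norm of the tangential component is damped at the rate \<open>2 * \<alpha>\<close> and driven by the
  square of \<open>y\<close>, which decays faster. The function \<open>\<phi>\<close> below is non-increasing.
\<close>

lemma decay_while_near:
  fixes X :: "'e::euclidean_space \<Rightarrow> 'e" and y :: "'e \<Rightarrow> 'y::euclidean_space"
  assumes P: "bounded_linear P" "\<And>v w. P v \<bullet> w = v \<bullet> P w" "\<And>w. P (P w) = P w"
    and c2: "0 < c2" and dissipation: "\<And>x. norm (x - p) \<le> r \<Longrightarrow>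
      P (x - p) \<bullet> X x \<le> - \<alpha> * (P (x - p) \<bullet> P (x - p)) + c2 * (norm (y x))\<^sup>2"
    and y: "\<And>x. (y has_derivative A x) (at x)" and yS: "\<And>x. y x \<in> S"
    and out: "\<And>x. norm (x - p) \<le> r \<Longrightarrow> A x (X x) = G (y x)"
    and G: "\<And>T z t. 0 < T \<Longrightarrow> ode_solution S G {0..<T} z \<Longrightarrow> t \<in> {0..<T} \<Longrightarrow>
      norm (z t) \<le> cG * exp (- \<alpha>G * t) * norm (z 0)"
    and \<alpha>: "\<alpha> < \<alpha>G"
    and x: "ode_solution (cball p r) X {0..<T} x" and t: "t \<in> {0..<T}"
  shows "norm (y (x t)) \<le> cG * exp (- \<alpha>G * t) * norm (y (x 0))"
    and "exp (2 * \<alpha> * t) * (norm (P (x t - p)))\<^sup>2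
      \<le> (norm (P (x 0 - p)))\<^sup>2 + c2 * cG\<^sup>2 / (\<alpha>G - \<alpha>) * (norm (y (x 0)))\<^sup>2"
proof -
  have near: "norm (x s - p) \<le> r" if "s \<in> {0..<T}" for s
    using x that by (force simp: ode_solution_def dist_norm norm_minus_commute)
  have "ode_solution S G {0..<T} (y \<circ> x)"
    unfolding ode_solution_def
  proof (intro ballI conjI)
    fix s assume s: "s \<in> {0..<T}"
    show "(y \<circ> x) s \<in> S" by (simp add: yS)
    have "(x has_vector_derivative X (x s)) (at s within {0..<T})"
      using x s by (simp add: ode_solution_def)
    then have "((y \<circ> x) has_vector_derivative A (x s) (X (x s))) (at s within {0..<T})"
      by (rule vector_derivative_diff_chain_within) (rule has_derivative_at_withinI[OF y])
    then show "((y \<circ> x) has_vector_derivative G ((y \<circ> x) s)) (at s within {0..<T})"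
      by (simp add: out[OF near[OF s]])
  qed
  then have y_decay: "norm (y (x s)) \<le> cG * exp (- \<alpha>G * s) * norm (y (x 0))" if "s \<in> {0..<T}" for s
    using G[of T "y \<circ> x" s] that by (simp add: o_def)
  then show "norm (y (x t)) \<le> cG * exp (- \<alpha>G * t) * norm (y (x 0))"
    using t by blast
  define z where "z = (\<lambda>s. P (x s - p))"
  define M where "M = c2 * cG\<^sup>2 / (\<alpha>G - \<alpha>) * (norm (y (x 0)))\<^sup>2"
  define \<phi> where "\<phi> = (\<lambda>s. exp (2 * \<alpha> * s) * (z s \<bullet> z s) + M * exp (- 2 * (\<alpha>G - \<alpha>) * s))"
  define \<phi>' where "\<phi>' = (\<lambda>s. exp (2 * \<alpha> * s) * (2 * (z s \<bullet> P (X (x s))))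
    + (2 * \<alpha> * exp (2 * \<alpha> * s)) * (z s \<bullet> z s) - 2 * (\<alpha>G - \<alpha>) * M * exp (- 2 * (\<alpha>G - \<alpha>) * s))"
  have M: "0 \<le> M" using c2 \<alpha> by (simp add: M_def)
  have "\<phi> t \<le> \<phi> 0"
  proof (rule antitone_if_derivative_nonpos[where \<phi>' = \<phi>'])
    fix s assume s': "s \<in> {0..t}"
    then have s: "s \<in> {0..<T}" using t by auto
    have "(x has_vector_derivative X (x s)) (at s within {0..t})"
    proof -
      have "{0..t} \<subseteq> {0..<T}" using t by auto
      then have "ode_solution UNIV X {0..t} x" by (rule ode_solution_subset[OF x]) simp
      then show ?thesis using s' by (simp add: ode_solution_def)
    qed
    then have "(z has_vector_derivative P (X (x s) - 0)) (at s within {0..t})"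
      unfolding z_def
      by (intro bounded_linear.has_vector_derivative[OF P(1)] has_vector_derivative_diff
          has_vector_derivative_const)
    from norm_square_has_derivative[OF this]
    show "(\<phi> has_real_derivative \<phi>' s) (at s within {0..t})"
      unfolding \<phi>_def \<phi>'_def by (auto intro!: derivative_eq_intros simp: algebra_simps)
    have "z s \<bullet> P (X (x s)) = z s \<bullet> X (x s)"
      using P(2)[of "P (x s - p)" "X (x s)"] P(3) by (simp add: z_def)
    also have "\<dots> \<le> - \<alpha> * (z s \<bullet> z s) + c2 * (norm (y (x s)))\<^sup>2"
      unfolding z_def by (rule dissipation[OF near[OF s]])
    also have "(norm (y (x s)))\<^sup>2 \<le> (cG * exp (- \<alpha>G * s) * norm (y (x 0)))\<^sup>2"
      using y_decay[OF s] by (intro power_mono) auto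
    also have "\<dots> = cG\<^sup>2 * exp (- 2 * \<alpha>G * s) * (norm (y (x 0)))\<^sup>2"
      by (simp add: power_mult_distrib exp_double[symmetric])
    finally have "z s \<bullet> P (X (x s)) \<le> - \<alpha> * (z s \<bullet> z s)
        + c2 * (cG\<^sup>2 * exp (- 2 * \<alpha>G * s) * (norm (y (x 0)))\<^sup>2)"
      using c2 by simp
    also have "c2 * (cG\<^sup>2 * exp (- 2 * \<alpha>G * s) * (norm (y (x 0)))\<^sup>2)
        = (\<alpha>G - \<alpha>) * M * exp (- 2 * \<alpha>G * s)"
      using \<alpha> by (simp add: M_def)
    finally have "exp (2 * \<alpha> * s) * (z s \<bullet> P (X (x s)))
        \<le> exp (2 * \<alpha> * s) * (- \<alpha> * (z s \<bullet> z s) + (\<alpha>G - \<alpha>) * M * exp (- 2 * \<alpha>G * s))"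
      by (intro mult_left_mono) auto
    also have "\<dots> = - \<alpha> * exp (2 * \<alpha> * s) * (z s \<bullet> z s)
        + (\<alpha>G - \<alpha>) * M * exp (- 2 * (\<alpha>G - \<alpha>) * s)"
    proof -
      have "exp (- 2 * (\<alpha>G - \<alpha>) * s) = exp (2 * \<alpha> * s) * exp (- 2 * \<alpha>G * s)"
        by (simp add: exp_add[symmetric] algebra_simps)
      then show ?thesis by (simp add: algebra_simps)
    qed
    finally show "\<phi>' s \<le> 0" by (simp add: \<phi>'_def algebra_simps)
  qed (use t in auto)
  moreover have "0 \<le> M * exp (- 2 * (\<alpha>G - \<alpha>) * t)" using M by simp
  ultimately have "exp (2 * \<alpha> * t) * (z t \<bullet> z t) \<le> z 0 \<bullet> z 0 + M"
    by (simp add: \<phi>_def)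
  then show "exp (2 * \<alpha> * t) * (norm (P (x t - p)))\<^sup>2
      \<le> (norm (P (x 0 - p)))\<^sup>2 + c2 * cG\<^sup>2 / (\<alpha>G - \<alpha>) * (norm (y (x 0)))\<^sup>2"
    by (simp add: z_def M_def power2_norm_eq_inner)
qed

text \<open>
  The decay estimate holds as long as a solution stays in a small ball, and it keeps the solution
  in that ball if the initial value is close enough to \<open>p\<close>; so the solution of the truncated
  equation never meets the truncation. Solutions of \<open>G\<close> on bounded intervals appear
  because during this argument the solution is controlled on a bounded interval only.
\<close>

lemma exp_stable_of_output_dynamics:
  fixes X :: "'e::euclidean_space \<Rightarrow> 'e" and y :: "'e \<Rightarrow> 'y::euclidean_space"
  assumes r: "0 < r" and lip: "K-lipschitz_on (cball p r) X" and D: "cball p r \<subseteq> D"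
    and Xp: "X p = 0"
    and y: "\<And>x. (y has_derivative A x) (at x)" and yp: "y p = 0" and yS: "\<And>x. y x \<in> S"
    and out: "\<And>x. x \<in> cball p r \<Longrightarrow> A x (X x) = G (y x)"
    and G: "origin_globally_exp_stable S G \<alpha>G"
    and tangential: "\<And>z. A p z = 0 \<Longrightarrow>
      \<exists>k. ((\<lambda>x. z \<bullet> X x) has_derivative k) (at p) \<and> k z \<le> - \<beta> * (z \<bullet> z)"
    and \<alpha>: "\<alpha> < \<beta>" "\<alpha> < \<alpha>G" "0 < \<alpha>"
  shows "\<exists>C>0. \<exists>\<delta>>0. \<forall>x0. norm (x0 - p) < \<delta> \<longrightarrow>
    (\<exists>x. the_solution_from D X x0 x \<and>
      (\<forall>t\<ge>0. norm (x t - p) + norm (y (x t)) \<le> C * exp (- \<alpha> * t) * norm (x0 - p)))"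
proof -
  obtain P r0 c1 c2 where P: "bounded_linear P" "\<And>v w. P v \<bullet> w = v \<bullet> P w" "\<And>w. P (P w) = P w"
    and r0: "0 < r0" and c1: "0 < c1" and c2: "0 < c2"
    and dist: "\<And>x. norm (x - p) \<le> r0 \<Longrightarrow> norm (x - p) \<le> c1 * (norm (P (x - p)) + norm (y x))"
    and dissipation: "\<And>x. norm (x - p) \<le> r0 \<Longrightarrow>
      P (x - p) \<bullet> X x \<le> - \<alpha> * (P (x - p) \<bullet> P (x - p)) + c2 * (norm (y x))\<^sup>2"
  proof (rule tangential_dissipation[OF Xp y yp tangential \<alpha>(1)])
    fix P r0 c1 c2
    assume "bounded_linear P" "\<And>v w. P v \<bullet> w = v \<bullet> P w" "\<And>w. P (P w) = P w" "0 < (r0::real)"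
      "0 < (c1::real)" "0 < (c2::real)"
      "\<And>x. norm (x - p) \<le> r0 \<Longrightarrow> norm (x - p) \<le> c1 * (norm (P (x - p)) + norm (y x))"
      "\<And>x. norm (x - p) \<le> r0 \<Longrightarrow>
        P (x - p) \<bullet> X x \<le> - \<alpha> * (P (x - p) \<bullet> P (x - p)) + c2 * (norm (y x))\<^sup>2"
    then show thesis by (rule that)
  qed
  obtain c where c: "\<forall>T>0. \<forall>z. ode_solution S G {0..<T} z \<longrightarrow>
      (\<forall>t\<in>{0..<T}. norm (z t) \<le> c * exp (- \<alpha>G * t) * norm (z 0))"
    using G unfolding origin_globally_exp_stable_def by blast
  define cG where "cG = max c 0"
  have cG: "0 \<le> cG" by (simp add: cG_def)
  have G': "norm (z t) \<le> cG * exp (- \<alpha>G * t) * norm (z 0)"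
    if "0 < T" "ode_solution S G {0..<T} z" "t \<in> {0..<T}" for T z t
  proof -
    have "norm (z t) \<le> c * exp (- \<alpha>G * t) * norm (z 0)" using c that by blast
    also have "\<dots> \<le> cG * exp (- \<alpha>G * t) * norm (z 0)"
      by (intro mult_right_mono) (auto simp: cG_def)
    finally show ?thesis .
  qed
  obtain r1 k where r1: "0 < r1" and k: "0 \<le> k" "\<And>x. norm (x - p) < r1 \<Longrightarrow> norm (y x) \<le> k * norm (x - p)"
  proof -
    obtain d where d: "0 < d" "\<And>x. norm (x - p) < d \<Longrightarrow> norm (y x - y p - A p (x - p)) \<le> 1 * norm (x - p)"
      using y[of p] zero_less_one unfolding has_derivative_at_alt by blast
    obtain B where B: "0 < B" "\<And>w. norm (A p w) \<le> norm w * B"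
      using bounded_linear.pos_bounded[OF has_derivative_bounded_linear[OF y]] by metis
    show thesis
    proof (rule that[of d "1 + B"])
      show "norm (y x) \<le> (1 + B) * norm (x - p)" if "norm (x - p) < d" for x
        using d(2)[OF that] B(2)[of "x - p"] norm_triangle_sub[of "y x" "A p (x - p)"]
        by (simp add: yp algebra_simps)
    qed (use d B in auto)
  qed
  define \<sigma> where "\<sigma> = min r (min r0 r1) / 2"
  have \<sigma>: "0 < \<sigma>" "\<sigma> \<le> r" "\<sigma> \<le> r0" "\<sigma> < r1"
    using r r0 r1 by (auto simp: \<sigma>_def)
  obtain \<pi> where \<pi>: "0 < \<pi>" "\<And>w. norm (P w) \<le> norm w * \<pi>"
    using bounded_linear.pos_bounded[OF P(1)] by metis
  define N where "N = sqrt (\<pi>\<^sup>2 + c2 * cG\<^sup>2 / (\<alpha>G - \<alpha>) * k\<^sup>2)"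
  have N0: "0 \<le> \<pi>\<^sup>2 + c2 * cG\<^sup>2 / (\<alpha>G - \<alpha>) * k\<^sup>2"
    using c2 \<alpha> by simp
  then have N: "0 \<le> N" "N\<^sup>2 = \<pi>\<^sup>2 + c2 * cG\<^sup>2 / (\<alpha>G - \<alpha>) * k\<^sup>2"
    by (auto simp: N_def)
  define C where "C = c1 * N + (c1 + 1) * (cG * k) + 1"
  have C: "0 < C" using c1 N(1) cG k(1) by (simp add: C_def add_nonneg_pos)
  have estimate: "norm (x t - p) + norm (y (x t)) \<le> C * exp (- \<alpha> * t) * norm (x 0 - p)"
    if x: "ode_solution (cball p \<sigma>) X {0..<T} x" and t: "t \<in> {0..<T}" for x T t
  proof -
    have near: "norm (x s - p) \<le> \<sigma>" if "s \<in> {0..<T}" for s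
      using x that by (force simp: ode_solution_def dist_norm norm_minus_commute)
    have "0 \<in> {0..<T}" using t by simp
    have y0: "norm (y (x 0)) \<le> k * norm (x 0 - p)"
      using near[OF \<open>0 \<in> {0..<T}\<close>] \<sigma> by (intro k(2)) auto
    note decay = decay_while_near[OF P c2 dissipation y yS out G' \<alpha>(2) x t]
    have "norm (y (x t)) \<le> cG * exp (- \<alpha>G * t) * norm (y (x 0))"
      using \<sigma> by (intro decay) (auto simp: dist_norm norm_minus_commute)
    also have "\<dots> \<le> cG * exp (- \<alpha> * t) * (k * norm (x 0 - p))"
      using cG \<alpha> t y0 by (intro mult_mono) (auto intro: mult_right_mono)
    finally have yt: "norm (y (x t)) \<le> cG * k * exp (- \<alpha> * t) * norm (x 0 - p)"
      by (simp add: ac_simps)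
    have "exp (2 * \<alpha> * t) * (norm (P (x t - p)))\<^sup>2
        \<le> (norm (P (x 0 - p)))\<^sup>2 + c2 * cG\<^sup>2 / (\<alpha>G - \<alpha>) * (norm (y (x 0)))\<^sup>2"
      using \<sigma> by (intro decay) (auto simp: dist_norm norm_minus_commute)
    also have "\<dots> \<le> (norm (x 0 - p) * \<pi>)\<^sup>2 + c2 * cG\<^sup>2 / (\<alpha>G - \<alpha>) * (k * norm (x 0 - p))\<^sup>2"
      using \<pi>(2) y0 c2 \<alpha> by (intro add_mono mult_left_mono power_mono) auto
    also have "\<dots> = (N * norm (x 0 - p))\<^sup>2"
      by (simp add: power_mult_distrib N(2) algebra_simps)
    finally have "(exp (\<alpha> * t) * norm (P (x t - p)))\<^sup>2 \<le> (N * norm (x 0 - p))\<^sup>2"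
      by (simp add: power_mult_distrib exp_double[symmetric] mult.assoc)
    then have "exp (\<alpha> * t) * norm (P (x t - p)) \<le> N * norm (x 0 - p)"
      by (rule power2_le_imp_le) (use N(1) in simp)
    then have zt: "norm (P (x t - p)) \<le> N * exp (- \<alpha> * t) * norm (x 0 - p)"
      by (simp add: exp_minus field_simps)
    have "norm (x t - p) + norm (y (x t)) \<le> c1 * norm (P (x t - p)) + (c1 + 1) * norm (y (x t))"
      using dist[of "x t"] near[OF t] \<sigma> by (simp add: algebra_simps)
    also have "\<dots> \<le> c1 * (N * exp (- \<alpha> * t) * norm (x 0 - p))
        + (c1 + 1) * (cG * k * exp (- \<alpha> * t) * norm (x 0 - p))"
      using c1 zt yt by (intro add_mono mult_left_mono) auto
    also have "\<dots> = (C - 1) * (exp (- \<alpha> * t) * norm (x 0 - p))"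
      by (simp add: C_def algebra_simps)
    also have "\<dots> \<le> C * (exp (- \<alpha> * t) * norm (x 0 - p))"
      by (intro mult_right_mono) auto
    finally show ?thesis by (simp add: mult.assoc)
  qed
  define \<delta> where "\<delta> = \<sigma> / (2 * (C + 1))"
  have \<delta>: "0 < \<delta>" "\<delta> < \<sigma>" "C * \<delta> < \<sigma>"
    using \<sigma>(1) C by (auto simp: \<delta>_def field_simps add_pos_pos)
  have lip': "K-lipschitz_on (cball p \<sigma>) X"
    using \<sigma>(2) by (intro lipschitz_on_subset[OF lip]) auto
  have "\<exists>x. the_solution_from D X x0 x \<and>
      (\<forall>t\<ge>0. norm (x t - p) + norm (y (x t)) \<le> C * exp (- \<alpha> * t) * norm (x0 - p))"
    if x0: "norm (x0 - p) < \<delta>" for x0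
  proof -
    obtain x where init: "x 0 = x0" and cont: "continuous_on {0..} x"
      and x: "\<And>t. 0 \<le> t \<Longrightarrow> x t \<in> cball p \<sigma> \<Longrightarrow> (x has_vector_derivative X (x t)) (at t within {0..})"
      using lipschitz_ode_truncated_existence[OF lip' \<sigma>(1)] by metis
    have sol: "ode_solution (cball p \<sigma>) X {0..<T} x"
      if below: "\<And>s. 0 \<le> s \<Longrightarrow> s < T \<Longrightarrow> norm (x s - p) < \<sigma>" for T
    proof -
      have in_ball: "x s \<in> cball p \<sigma>" if "s \<in> {0..<T}" for s
        using below[of s] that by (simp add: dist_norm norm_minus_commute)
      have "ode_solution (cball p \<sigma>) X ({0..} \<inter> {0..<T}) x"
        unfolding ode_solution_def
      proof (intro ballI conjI)
        fix s assume s: "s \<in> {0..} \<inter> {0..<T}"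
        then show "x s \<in> cball p \<sigma>" by (intro in_ball) simp
        then show "(x has_vector_derivative X (x s)) (at s within {0..} \<inter> {0..<T})"
          using s has_vector_derivative_within_subset[OF x[of s], of "{0..} \<inter> {0..<T}"] by auto
      qed
      then show ?thesis by (rule ode_solution_subset) (auto simp del: mem_cball intro: in_ball)
    qed
    have stays: "norm (x t - p) < \<sigma>" if t: "0 \<le> t" for t
    proof (rule continuous_stays_below[where g = "\<lambda>s. norm (x s - p)" and t = t])
      show "continuous_on {0..t} (\<lambda>s. norm (x s - p))"
        by (intro continuous_intros continuous_on_subset[OF cont]) auto
      show "norm (x 0 - p) < \<sigma>" using init x0 \<delta> by simp
      fix s assume s: "0 < s" "s \<le> t" and below: "\<And>q. 0 \<le> q \<Longrightarrow> q < s \<Longrightarrow> norm (x q - p) < \<sigma>"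
      have "norm (x q - p) \<le> C * \<delta>" if q: "q \<in> {0..<s}" for q
      proof -
        have "norm (x q - p) \<le> norm (x q - p) + norm (y (x q))" by simp
        also have "\<dots> \<le> C * exp (- \<alpha> * q) * norm (x 0 - p)"
          by (rule estimate[OF sol[OF below] q])
        also have "\<dots> \<le> C * 1 * \<delta>"
          using C q \<alpha> x0 init by (intro mult_mono) auto
        finally show ?thesis by simp
      qed
      then have "(\<lambda>q. norm (x q - p)) ` {0..<s} \<subseteq> {..C * \<delta>}" by auto
      moreover have "continuous_on (closure {0..<s}) (\<lambda>q. norm (x q - p))"
        by (intro continuous_intros continuous_on_subset[OF cont]) (use s in auto)
      ultimately have "(\<lambda>q. norm (x q - p)) ` closure {0..<s} \<subseteq> {..C * \<delta>}"
        by (intro image_closure_subset) auto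
      moreover have "s \<in> closure {0..<s}" using s by simp
      ultimately have "norm (x s - p) \<le> C * \<delta>" by blast
      then show "norm (x s - p) < \<sigma>" using \<delta>(3) by simp
    qed (rule t)
    have "norm (x t - p) + norm (y (x t)) \<le> C * exp (- \<alpha> * t) * norm (x0 - p)" if "0 \<le> t" for t
      using estimate[OF sol[of "t + 1"], of t] stays that init by simp
    moreover have "the_solution_from D X x0 x"
    proof (rule the_solution_fromI[where x = x, OF lip'])
      show "cball p \<sigma> \<subseteq> D" using D \<sigma>(2) by auto
      show "ode_solution (ball p \<sigma>) X {0..} x"
        using x stays by (auto simp: ode_solution_def dist_norm norm_minus_commute less_imp_le)
    qed (rule init)
    ultimately show ?thesis by blast
  qed
  then show ?thesis using C \<delta>(1) by blast
qed

section \<open>Block vectors, gradients and Jacobians\<close>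

lemma block_nth [simp]: "block x i $ j = x $ (i, j)"
  by (simp add: block_def)

lemma block_blocks_col [simp]: "block (blocks_col v) i = v i"
  by (simp add: vec_eq_iff blocks_col_def)

lemma block_kron_vec_one [simp]: "block (kron_vec 1 s) i = s"
  by (simp add: vec_eq_iff kron_vec_def)

lemma block_eqI: "(\<And>i. block x i = block y i) \<Longrightarrow> x = y"
  by (metis block_nth prod.exhaust vec_eq_iff)

lemma block_linear_simps [simp]:
  fixes x y :: "real^('n::finite \<times> 'k::finite)"
  shows "block (x + y) i = block x i + block y i" "block (x - y) i = block x i - block y i"
    "block (- x) i = - block x i" "block (c *\<^sub>R x) i = c *\<^sub>R block x i" "block (0 :: real^('n \<times> 'k)) i = 0"
  by (simp_all add: vec_eq_iff)

lemma bounded_linear_block: "bounded_linear (\<lambda>x :: real^('n::finite \<times> 'k::finite). block x i)"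
  unfolding linear_conv_bounded_linear[symmetric] by (rule linearI) simp_all

lemma inner_blocks:
  fixes x y :: "real^('n::finite \<times> 'k::finite)"
  shows "x \<bullet> y = (\<Sum>i\<in>UNIV. block x i \<bullet> block y i)"
  by (simp add: inner_vec_def sum.cartesian_product)

lemma has_derivative_blocks_col:
  fixes F :: "'n::finite \<Rightarrow> 'a::real_normed_vector \<Rightarrow> real^'k::finite"
  assumes "\<And>i. (F i has_derivative F' i) net"
  shows "((\<lambda>x. blocks_col (\<lambda>i. F i x)) has_derivative (\<lambda>w. blocks_col (\<lambda>i. F' i w))) net"
proof -
  define e where "e = (\<lambda>(i::'n) (v::real^'k). blocks_col (\<lambda>j. if j = i then v else 0))"
  have "bounded_linear (e i)" for i
    unfolding linear_conv_bounded_linear[symmetric] e_def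
    by (rule linearI; rule block_eqI) auto
  moreover have sum: "blocks_col v = (\<Sum>i\<in>UNIV. e i (v i))" for v
    by (simp add: vec_eq_iff e_def blocks_col_def if_distrib[of "\<lambda>u. u $ _"] cong: if_cong)
  ultimately show ?thesis
    unfolding sum
    by (intro has_derivative_sum bounded_linear.has_derivative[OF _ assms])
qed

lemma upper_col [simp]: "upper (col v w) = v" and lower_col [simp]: "lower (col v w) = w"
  and col_upper_lower [simp]: "col (upper u) (lower u) = u"
  by (simp_all add: vec_eq_iff upper_def lower_def col_def split: sum.split)

lemma col_nth [simp]: "col v w $ Inl i = v $ i" "col v w $ Inr j = w $ j"
  by (simp_all add: col_def)

lemma col_linear_simps:
  fixes v v' :: "real^'p::finite" and w w' :: "real^'q::finite"
  shows "col v w + col v' w' = col (v + v') (w + w')" "- col v w = col (- v) (- w)"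
    "c *\<^sub>R col v w = col (c *\<^sub>R v) (c *\<^sub>R w)" "col 0 0 = (0 :: real^('p + 'q))"
  by (simp_all add: vec_eq_iff col_def split: sum.split)

lemma upper_lower_linear:
  fixes u :: "real^('p::finite + 'q::finite)"
  shows "bounded_linear (upper :: real^('p + 'q) \<Rightarrow> real^'p)"
    and "bounded_linear (lower :: real^('p + 'q) \<Rightarrow> real^'q)"
  unfolding linear_conv_bounded_linear[symmetric]
  by (rule linearI; simp add: vec_eq_iff upper_def lower_def)+

lemma sum_UNIV_Plus:
  fixes F :: "'p::finite + 'q::finite \<Rightarrow> 'c::comm_monoid_add"
  shows "(\<Sum>k\<in>UNIV. F k) = (\<Sum>p\<in>UNIV. F (Inl p)) + (\<Sum>q\<in>UNIV. F (Inr q))"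
  by (simp add: UNIV_Plus_UNIV[symmetric] sum.Plus del: UNIV_Plus_UNIV)

lemma norm_le_norm_col:
  fixes v :: "real^'p::finite" and w :: "real^'q::finite"
  shows "norm v \<le> norm (col v w)" and "norm w \<le> norm (col v w)"
proof -
  have "col v w \<bullet> col v w = v \<bullet> v + w \<bullet> w"
    by (simp add: inner_vec_def sum_UNIV_Plus)
  then show "norm v \<le> norm (col v w)" "norm w \<le> norm (col v w)"
    by (auto simp: norm_le)
qed

lemma col_matrix_vector_mult:
  fixes A :: "real^'k^'p::finite" and B :: "real^'k^'q::finite"
  shows "col A B *v x = col (A *v x) (B *v x)"
  by (simp add: vec_eq_iff matrix_vector_mult_def col_def split: sum.split)

lemma row_concat_matrix_vector_mult:
  fixes A :: "real^'p::finite^'k" and B :: "real^'q::finite^'k"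
  shows "row_concat A B *v u = A *v upper u + B *v lower u"
  by (simp add: vec_eq_iff matrix_vector_mult_def row_concat_def sum_UNIV_Plus upper_def lower_def)

lemma block_blkdiag_mult:
  fixes A :: "'n::finite \<Rightarrow> real^'d::finite^'m::finite"
  shows "block (blkdiag A *v w) i = A i *v block w i"
proof -
  have "(\<Sum>q\<in>UNIV. (if i = fst q then A i $ k $ snd q else 0) * w $ q)
      = (\<Sum>l\<in>UNIV. A i $ k $ l * w $ (i, l))" for k
  proof -
    have "(\<Sum>q\<in>UNIV. (if i = fst q then A i $ k $ snd q else 0) * w $ q)
        = (\<Sum>j\<in>UNIV. \<Sum>l\<in>UNIV. (if i = j then A i $ k $ l else 0) * w $ (j, l))"
      by (subst sum.cartesian_product) (auto intro!: sum.cong)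
    also have "\<dots> = (\<Sum>j\<in>UNIV. if i = j then (\<Sum>l\<in>UNIV. A i $ k $ l * w $ (j, l)) else 0)"
      by (intro sum.cong) auto
    finally show ?thesis by simp
  qed
  then show ?thesis
    by (simp add: vec_eq_iff matrix_vector_mult_def blkdiag_def cong: if_cong)
qed

lemma grad_inner:
  fixes g :: "'a::euclidean_space \<Rightarrow> real"
  assumes "(g has_derivative g') (at x)"
  shows "\<xi> \<bullet> grad g x = g' \<xi>"
proof -
  have lin: "linear g'" using assms by (rule has_derivative_linear)
  define D where "D = (\<Sum>b\<in>Basis. g' b *\<^sub>R b)"
  have D: "g' \<xi> = \<xi> \<bullet> D" for \<xi>
  proof -
    have "g' \<xi> = g' (\<Sum>b\<in>Basis. (\<xi> \<bullet> b) *\<^sub>R b)" by (simp add: euclidean_representation)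
    also have "\<dots> = (\<Sum>b\<in>Basis. (\<xi> \<bullet> b) * g' b)"
      using lin by (simp add: linear_sum linear_cmul)
    finally show ?thesis by (simp add: D_def inner_sum_right mult.commute)
  qed
  have "GDERIV g x :> D"
    using assms unfolding gderiv_def D[abs_def] .
  moreover have "D' = D" if "GDERIV g x :> D'" for D'
  proof -
    have "(\<lambda>\<xi>. \<xi> \<bullet> D') = (\<lambda>\<xi>. \<xi> \<bullet> D)"
      using that \<open>GDERIV g x :> D\<close> has_derivative_unique unfolding gderiv_def by blast
    then show ?thesis by (metis inner_commute vector_eq_ldot)
  qed
  ultimately have "grad g x = D"
    unfolding grad_def by (intro the_equality)
  then show ?thesis by (simp add: D)
qed

lemma jac_mult:
  assumes "(g has_derivative g') (at s)"
  shows "jac g s *v \<xi> = g' \<xi>"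
  using matrix_vector_mul(1)[of g']
    has_derivative_linear[OF assms] frechet_derivative_at[OF assms]
  by (simp add: jac_def jacobian_def matrix_works linear_matrix_vector_mul_eq)

lemma has_derivative_stacked_objective:
  assumes "\<And>i s. (f i has_derivative f' i s) (at s)"
  shows "(stacked_objective f has_derivative (\<lambda>w. \<Sum>i\<in>UNIV. f' i (block x i) (block w i))) (at x)"
  unfolding stacked_objective_def
  by (intro has_derivative_sum has_derivative_compose[OF _ assms]
      bounded_linear.has_derivative[OF bounded_linear_block] has_derivative_ident)

lemma has_derivative_stacked_constraint:
  assumes "\<And>i s. (h i has_derivative h' i s) (at s)"
  shows "(stacked_constraint h has_derivative (\<lambda>w. blkdiag_jacobian h x *v w)) (at x)"
proof -
  have "(stacked_constraint h has_derivative (\<lambda>w. blocks_col (\<lambda>i. h' i (block x i) (block w i)))) (at x)"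
    unfolding stacked_constraint_def[abs_def]
    by (intro has_derivative_blocks_col has_derivative_compose[OF _ assms]
        bounded_linear.has_derivative[OF bounded_linear_block] has_derivative_ident)
  also have "(\<lambda>w. blocks_col (\<lambda>i. h' i (block x i) (block w i))) = (\<lambda>w. blkdiag_jacobian h x *v w)"
    by (intro ext block_eqI) (simp add: blkdiag_jacobian_def block_blkdiag_mult jac_mult[OF assms])
  finally show ?thesis .
qed

text \<open>
  The transpose maps the space of vectors supported on \<open>I\<close> onto its range, and both spaces have
  dimension \<open>card I\<close>. Rows outside \<open>I\<close> are the padding of constraint Jacobians.
\<close>

lemma transpose_injective_of_rank_eq_card:
  fixes J :: "real^'d^'q"
  assumes zero: "\<And>q. q \<notin> I \<Longrightarrow> J $ q = 0" and rank: "rank J = card I"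
    and \<mu>: "\<And>q. q \<notin> I \<Longrightarrow> \<mu> $ q = 0" and ker: "transpose J *v \<mu> = 0"
  shows "\<mu> = 0"
proof -
  define W where "W = {\<mu> :: real^'q. \<forall>q. q \<notin> I \<longrightarrow> \<mu> $ q = 0}"
  have W: "subspace W" unfolding W_def by (rule subspaceI) auto
  have lin: "linear ((*v) (transpose J))" by simp
  have "transpose J *v \<nu> = transpose J *v (\<chi> q. if q \<in> I then \<nu> $ q else 0)" for \<nu>
    using zero by (simp add: vec_eq_iff matrix_vector_mult_def transpose_def) (auto intro!: sum.cong)
  moreover have "(\<chi> q. if q \<in> I then \<nu> $ q else 0) \<in> W" for \<nu>
    by (simp add: W_def)
  ultimately have image: "(*v) (transpose J) ` W = range ((*v) (transpose J))"
    by blast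
  obtain B where B: "B \<subseteq> W" "independent B" "W \<subseteq> span B" "card B = dim W"
    using basis_exists[of W] by metis
  have finB: "finite B" using B(2) by (rule independent_imp_finite)
  have spanB: "span B = W" using B(1,3) W by (metis span_minimal subset_antisym)
  have dimW: "dim W = card I"
    using dim_substandard_cart[of I, where 'a=real] by (simp add: W_def dim_vec_eq)
  let ?f = "(*v) (transpose J)"
  have "dim (?f ` W) = card I"
    unfolding image rank_dim_range[of "transpose J", symmetric] rank_transpose by (rule rank)
  moreover have "span (?f ` B) = ?f ` W"
    using linear_span_image[OF lin, of B] spanB by simp
  ultimately have dim_fB: "dim (?f ` B) = card B"
    using B(4) dimW by (metis dim_span)
  have card_fB: "card (?f ` B) = card B"
    using card_image_le[OF finB, of ?f] dim_le_card[of "?f ` B" "?f ` B"] finB dim_fB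
      span_superset[of "?f ` B"] by auto
  then have "inj_on ?f B" using finB by (simp add: eq_card_imp_inj_on)
  moreover have "independent (?f ` B)"
    by (rule card_le_dim_spanning[of _ "?f ` B"])
      (simp_all only: finB dim_fB card_fB finite_imageI span_superset order_refl)
  ultimately have "inj_on ?f (span B)"
    using linear_inj_on_span_iff_independent_image[OF lin] by blast
  moreover have "\<mu> \<in> W" using \<mu> by (simp add: W_def)
  ultimately show ?thesis
    using linear_injective_on_subspace_0[OF lin W] ker spanB by metis
qed

lemma mem_multipliers: "\<mu> \<in> multipliers R \<longleftrightarrow> (\<forall>i k. k \<notin> R i \<longrightarrow> \<mu> $ (i, k) = 0)"
  by (auto simp: multipliers_def local_multipliers_def)

lemma subspace_multipliers: "subspace (multipliers R)"
  by (rule subspaceI) (auto simp: mem_multipliers)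

lemma local_multipliers_derivative:
  assumes g: "(g has_derivative g') (at s)" and maps: "\<And>s. g s \<in> local_multipliers R i"
  shows "g' \<xi> \<in> local_multipliers R i"
  unfolding local_multipliers_def mem_Collect_eq
proof (intro allI impI)
  fix k assume k: "k \<notin> R i"
  have "((\<lambda>s. g s $ k) has_derivative (\<lambda>\<xi>. g' \<xi> $ k)) (at s)"
    by (rule bounded_linear.has_derivative[OF bounded_linear_vec_nth g])
  moreover have "(\<lambda>s. g s $ k) = (\<lambda>s. 0)"
    using maps k by (simp add: local_multipliers_def)
  ultimately have "(\<lambda>\<xi>. g' \<xi> $ k) = (\<lambda>\<xi>. 0)"
    using has_derivative_unique has_derivative_const by metis
  then show "g' \<xi> $ k = 0" by metis
qed

lemma block_col_jacobian_mult: "block (col_jacobian h x *v \<xi>) i = jac (h i) (block x i) *v \<xi>"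
  by (simp add: vec_eq_iff matrix_vector_mult_def col_jacobian_def blocks_col_def)

lemma multiplier_zero_of_full_rank:
  assumes rank: "rank (col_jacobian h (kron_vec 1 s)) = (\<Sum>i\<in>UNIV. card (R i))"
    and h: "\<And>i s. (h i has_derivative h' i s) (at s)" and maps: "\<And>i s. h i s \<in> local_multipliers R i"
    and \<mu>: "\<mu> \<in> multipliers R" and ker: "\<And>\<xi>. (\<Sum>i\<in>UNIV. h' i s \<xi> \<bullet> block \<mu> i) = 0"
  shows "\<mu> = 0"
proof (rule transpose_injective_of_rank_eq_card)
  let ?J = "col_jacobian h (kron_vec 1 s)"
  show "rank ?J = card (Sigma UNIV R)"
    using rank by (simp add: card_SigmaI)
  fix q assume q: "q \<notin> Sigma UNIV R"
  show "\<mu> $ q = 0"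
    using \<mu> q by (cases q) (auto simp: mem_multipliers)
  have "(?J *v \<xi>) $ q = 0" for \<xi>
  proof -
    have "(?J *v \<xi>) $ q = block (?J *v \<xi>) (fst q) $ snd q" by simp
    also have "\<dots> = h' (fst q) s \<xi> $ snd q"
      by (simp only: block_col_jacobian_mult block_kron_vec_one jac_mult[OF h])
    also have "\<dots> = 0"
      using local_multipliers_derivative[OF h maps, of "fst q" s \<xi>] q
      by (cases q) (auto simp: local_multipliers_def)
    finally show ?thesis .
  qed
  from this[of "axis _ 1"] show "?J $ q = 0"
    by (simp add: matrix_vector_mult_basis column_def vec_eq_iff)
next
  let ?J = "col_jacobian h (kron_vec 1 s)"
  let ?v = "transpose ?J *v \<mu>"
  have "?v \<bullet> ?v = \<mu> \<bullet> (?J *v ?v)"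
    unfolding transpose_matrix_vector by (rule dot_lmul_matrix)
  also have "\<dots> = (\<Sum>i\<in>UNIV. h' i s ?v \<bullet> block \<mu> i)"
    by (simp add: inner_blocks block_col_jacobian_mult jac_mult[OF h] inner_commute del: transpose_matrix_vector)
  also have "\<dots> = 0" by (rule ker)
  finally show "?v = 0" by (simp del: transpose_matrix_vector)
qed

section \<open>The graph Laplacian\<close>

lemma sum_laplacian_row:
  fixes v :: "'n::finite \<Rightarrow> 'b::real_vector"
  shows "(\<Sum>j\<in>UNIV. laplacian a $ i $ j *\<^sub>R v j)
    = (\<Sum>j\<in>UNIV. a $ i $ j *\<^sub>R (v i - v j)) + a $ i $ i *\<^sub>R v i"
proof -
  have "(\<Sum>j\<in>UNIV. laplacian a $ i $ j *\<^sub>R v j)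
      = (\<Sum>j\<in>UNIV. (if j = i then ((\<Sum>k\<in>UNIV. a $ i $ k) + a $ i $ i) *\<^sub>R v i else 0) - a $ i $ j *\<^sub>R v j)"
    by (rule sum.cong) (auto simp: laplacian_def scaleR_left_distrib)
  also have "\<dots> = (\<Sum>j\<in>UNIV. a $ i $ j *\<^sub>R (v i - v j)) + a $ i $ i *\<^sub>R v i"
    by (simp add: sum_subtractf scaleR_diff_right scaleR_left_distrib scaleR_sum_left)
  finally show ?thesis .
qed

lemma block_stacked_laplacian:
  fixes x :: "real^('n::finite \<times> 'd::finite)"
  assumes "undirected_weighted_graph a"
  shows "block (stacked_laplacian a *v x) i = (\<Sum>j\<in>UNIV. a $ i $ j *\<^sub>R (block x i - block x j))"
proof -
  have "(stacked_laplacian a *v x) $ (i, k) = (\<Sum>j\<in>UNIV. laplacian a $ i $ j * x $ (j, k))" for k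
  proof -
    have "(stacked_laplacian a *v x) $ (i, k)
        = (\<Sum>j\<in>UNIV. \<Sum>l\<in>UNIV. laplacian a $ i $ j * mat 1 $ k $ l * x $ (j, l))"
      by (subst sum.cartesian_product)
        (simp add: matrix_vector_mult_def stacked_laplacian_def kron_def case_prod_beta)
    also have "\<dots> = (\<Sum>j\<in>UNIV. \<Sum>l\<in>UNIV. if k = l then laplacian a $ i $ j * x $ (j, l) else 0)"
      by (intro sum.cong) (auto simp: mat_def)
    finally show ?thesis by simp
  qed
  then have "block (stacked_laplacian a *v x) i = (\<Sum>j\<in>UNIV. laplacian a $ i $ j *\<^sub>R block x j)"
    by (simp add: vec_eq_iff)
  then show ?thesis
    using assms by (simp add: sum_laplacian_row undirected_weighted_graph_def)
qed

lemma stacked_laplacian_selfadjoint: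
  assumes "undirected_weighted_graph a"
  shows "(stacked_laplacian a *v x) \<bullet> y = x \<bullet> (stacked_laplacian a *v y)"
proof -
  have "a $ i $ j = a $ j $ i" for i j
    using assms unfolding undirected_weighted_graph_def transpose_def by (metis vec_lambda_beta)
  then have "laplacian a $ i $ j = laplacian a $ j $ i" for i j
    by (simp add: laplacian_def)
  then have "transpose (stacked_laplacian a) = stacked_laplacian a"
    by (simp add: vec_eq_iff transpose_def stacked_laplacian_def kron_def mat_def)
  then have "(stacked_laplacian a *v x) \<bullet> y = (x v* stacked_laplacian a) \<bullet> y"
    by (metis transpose_matrix_vector)
  then show ?thesis by (simp only: dot_lmul_matrix)
qed

lemma stacked_laplacian_consensus:
  "undirected_weighted_graph a \<Longrightarrow> stacked_laplacian a *v kron_vec 1 s = 0"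
  by (rule block_eqI) (simp add: block_stacked_laplacian)

text \<open>
  \<open>x \<bullet> L x\<close> is half the sum of \<open>a $ i $ j * norm (x\<^sub>i - x\<^sub>j) ^ 2\<close>, so neighbours agree on the
  kernel of \<open>L\<close>, and agreement spreads along the paths of the graph.
\<close>

lemma consensus_of_laplacian_kernel:
  fixes x :: "real^('n::finite \<times> 'd::finite)"
  assumes graph: "undirected_weighted_graph a" and connected: "connected_graph a"
    and ker: "stacked_laplacian a *v x = 0"
  obtains s where "x = kron_vec 1 s"
proof -
  have sym: "a $ i $ j = a $ j $ i" and nonneg: "0 \<le> a $ i $ j" for i j
    using graph unfolding undirected_weighted_graph_def transpose_def by (metis vec_lambda_beta, blast)
  let ?d = "\<lambda>i j. block x i - block x j"
  have "(\<Sum>i\<in>UNIV. \<Sum>j\<in>UNIV. a $ i $ j * (block x i \<bullet> ?d i j)) = x \<bullet> (stacked_laplacian a *v x)"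
    by (simp add: inner_blocks[of x] block_stacked_laplacian[OF graph] inner_sum_right)
  then have zero: "(\<Sum>i\<in>UNIV. \<Sum>j\<in>UNIV. a $ i $ j * (block x i \<bullet> ?d i j)) = 0"
    by (simp add: ker)
  have "(\<Sum>i\<in>UNIV. \<Sum>j\<in>UNIV. a $ i $ j * (block x j \<bullet> ?d i j))
      = (\<Sum>j\<in>UNIV. \<Sum>i\<in>UNIV. a $ i $ j * (block x j \<bullet> ?d i j))"
    by (rule sum.swap)
  also have "\<dots> = - (\<Sum>j\<in>UNIV. \<Sum>i\<in>UNIV. a $ j $ i * (block x j \<bullet> ?d j i))"
    by (simp add: sum_negf[symmetric] sym[of _ "_"] inner_diff_right algebra_simps)
  finally have "(\<Sum>i\<in>UNIV. \<Sum>j\<in>UNIV. a $ i $ j * (block x j \<bullet> ?d i j)) = 0"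
    by (simp add: zero)
  with zero have "(\<Sum>i\<in>UNIV. \<Sum>j\<in>UNIV. a $ i $ j * (?d i j \<bullet> ?d i j)) = 0"
    by (simp only: inner_diff_left right_diff_distrib sum_subtractf diff_self)
  then have "a $ i $ j * (?d i j \<bullet> ?d i j) = 0" for i j
    using nonneg by (simp add: sum_nonneg_eq_0_iff sum_nonneg)
  then have edge: "block x i = block x j" if "a $ i $ j > 0" for i j
    using that by (metis inner_eq_zero_iff less_irrefl mult_eq_0_iff right_minus_eq)
  have "block x i = block x j" if "(i, j) \<in> {(k, l). a $ k $ l > 0}\<^sup>*" for i j
    using that by induction (auto dest: edge)
  then have "block x i = block x j" for i j
    using connected by (auto simp: connected_graph_def)
  then have "x = kron_vec 1 (block x undefined)"
    by (intro block_eqI) simp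
  then show thesis by (rule that)
qed

section \<open>The feedback-linearization dynamics\<close>

lemma has_derivative_col:
  fixes F :: "'a::real_normed_vector \<Rightarrow> real^'p::finite" and H :: "'a \<Rightarrow> real^'q::finite"
  assumes F: "(F has_derivative F') net" and H: "(H has_derivative H') net"
  shows "((\<lambda>x. col (F x) (H x)) has_derivative (\<lambda>w. col (F' w) (H' w))) net"
proof -
  have "bounded_linear (\<lambda>v :: real^'p. col v (0 :: real^'q))"
    "bounded_linear (\<lambda>w :: real^'q. col (0 :: real^'p) w)"
    unfolding linear_conv_bounded_linear[symmetric]
    by (rule linearI; simp add: col_linear_simps)+
  then have "((\<lambda>x. col (F x) 0 + col 0 (H x)) has_derivative (\<lambda>w. col (F' w) 0 + col 0 (H' w))) net"
    by (intro has_derivative_add bounded_linear.has_derivative[OF _ F] bounded_linear.has_derivative[OF _ H])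
  then show ?thesis by (simp add: col_linear_simps)
qed

text \<open>
  Since \<open>norm (F x)\<close> is bounded by a multiple of \<open>norm (x - p)\<close>, continuity of \<open>m\<close> makes
  \<open>F x \<bullet> (m x - m p)\<close> a term of higher order.
\<close>

lemma has_derivative_inner_vanishing:
  fixes F m :: "'a::real_normed_vector \<Rightarrow> 'b::real_inner"
  assumes F: "(F has_derivative F') (at p)" and Fp: "F p = 0" and m: "isCont m p"
  shows "((\<lambda>x. F x \<bullet> m x) has_derivative (\<lambda>w. F' w \<bullet> m p)) (at p)"
proof -
  have F'_bl: "bounded_linear F'" using F by (rule has_derivative_bounded_linear)
  obtain B where B: "0 < B" "\<And>w. norm (F' w) \<le> norm w * B"
    using bounded_linear.pos_bounded[OF F'_bl] by metis
  have "((\<lambda>x. F x \<bullet> (m x - m p)) has_derivative (\<lambda>w. 0)) (at p)"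
    unfolding has_derivative_at_alt
  proof (intro conjI allI impI)
    fix e :: real assume e: "0 < e"
    obtain d1 where d1: "0 < d1"
      "\<And>x. norm (x - p) < d1 \<Longrightarrow> norm (F x - F p - F' (x - p)) \<le> 1 * norm (x - p)"
      using F zero_less_one unfolding has_derivative_at_alt by blast
    have "0 < e / (B + 1)" using e B by simp
    then obtain d2 where d2: "0 < d2" "\<And>x. dist x p < d2 \<Longrightarrow> dist (m x) (m p) < e / (B + 1)"
      using m unfolding continuous_at_eps_delta by metis
    have "norm (F x \<bullet> (m x - m p) - F p \<bullet> (m p - m p) - 0) \<le> e * norm (x - p)"
      if x: "norm (x - p) < min d1 d2" for x
    proof -
      have "norm (F x) \<le> (B + 1) * norm (x - p)"
        using d1(2)[of x] B(2)[of "x - p"] x norm_triangle_sub[of "F x" "F' (x - p)"]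
        by (simp add: Fp algebra_simps)
      moreover have "norm (m x - m p) \<le> e / (B + 1)"
        using d2(2)[of x] x by (simp add: dist_norm)
      ultimately have "norm (F x) * norm (m x - m p) \<le> ((B + 1) * norm (x - p)) * (e / (B + 1))"
        using B(1) by (intro mult_mono) auto
      also have "\<dots> = e * norm (x - p)" using B(1) by simp
      finally show ?thesis
        using Cauchy_Schwarz_ineq2[of "F x" "m x - m p"] by simp
    qed
    then show "\<exists>d>0. \<forall>x. norm (x - p) < d \<longrightarrow>
        norm (F x \<bullet> (m x - m p) - F p \<bullet> (m p - m p) - 0) \<le> e * norm (x - p)"
      using d1(1) d2(1) by (intro exI[of _ "min d1 d2"]) simp
  qed simp
  moreover have "((\<lambda>x. F x \<bullet> m p) has_derivative (\<lambda>w. F' w \<bullet> m p)) (at p)"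
    by (rule has_derivative_inner_left[OF F])
  ultimately have "((\<lambda>x. F x \<bullet> m p + F x \<bullet> (m x - m p)) has_derivative (\<lambda>w. F' w \<bullet> m p + 0)) (at p)"
    by (intro has_derivative_add)
  then show ?thesis by (simp add: inner_diff_right)
qed

text \<open>
  The derivatives are parameters, so that one choice of them is shared by all lemmas. They are
  linear maps, which gives second derivatives a meaning in the operator norm.
\<close>

locale local_equality_problem =
  fixes a :: "real^'n::finite^'n"
    and R :: "'n \<Rightarrow> 'm::finite set"
    and f :: "'n \<Rightarrow> real^'d::finite \<Rightarrow> real"
    and h :: "'n \<Rightarrow> real^'d \<Rightarrow> real^'m"
    and G :: "real^(('n \<times> 'd) + ('n \<times> 'm)) \<Rightarrow> real^(('n \<times> 'd) + ('n \<times> 'm))"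
    and s_opt :: "real^'d" and U :: "(real^'d) set" and \<rho> :: real
    and Df :: "'n \<Rightarrow> real^'d \<Rightarrow> (real^'d) \<Rightarrow>\<^sub>L real"
    and D2f :: "'n \<Rightarrow> real^'d \<Rightarrow> (real^'d) \<Rightarrow>\<^sub>L ((real^'d) \<Rightarrow>\<^sub>L real)"
    and Dh :: "'n \<Rightarrow> real^'d \<Rightarrow> (real^'d) \<Rightarrow>\<^sub>L (real^'m)"
    and D2h :: "'n \<Rightarrow> real^'d \<Rightarrow> (real^'d) \<Rightarrow>\<^sub>L ((real^'d) \<Rightarrow>\<^sub>L (real^'m))"
  assumes h_maps: "\<And>i s. h i s \<in> local_multipliers R i"
    and G_maps: "\<And>y. y \<in> output_space a R \<Longrightarrow> G y \<in> output_space a R"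
    and G_C1: "C1_on (output_space a R) G"
    and G_zero: "G 0 = 0"
    and graph: "undirected_weighted_graph a" "connected_graph a"
    and Df: "\<And>i s. (f i has_derivative Df i s) (at s)"
    and D2f: "\<And>i s. (Df i has_derivative D2f i s) (at s)"
    and Df_C1: "\<And>i. C1_on UNIV (Df i)"
    and Dh: "\<And>i s. (h i has_derivative Dh i s) (at s)"
    and D2h: "\<And>i s. (Dh i has_derivative D2h i s) (at s)"
    and jac_lipschitz: "\<And>i. locally_lipschitz (jac (h i))"
    and feasible: "\<And>i. h i s_opt = 0"
    and U: "open U" "s_opt \<in> U"
    and rho_pos: "0 < \<rho>"
    and growth: "\<And>s. s \<in> feasible_set h \<inter> U \<Longrightarrow>
      total_objective f s_opt + \<rho> / 2 * (norm (s - s_opt))\<^sup>2 \<le> total_objective f s"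
    and full_rank: "rank (col_jacobian h (kron_vec 1 s_opt)) = (\<Sum>i\<in>UNIV. card (R i))"
begin

abbreviation "p \<equiv> kron_vec 1 s_opt :: real^('n \<times> 'd)"
abbreviation "L \<equiv> stacked_laplacian a :: real^('n \<times> 'd)^('n \<times> 'd)"
abbreviation "S \<equiv> output_space a R :: (real^(('n \<times> 'd) + ('n \<times> 'm))) set"
abbreviation "J \<equiv> blkdiag_jacobian h"
abbreviation "grad_f \<equiv> grad (stacked_objective f)"
abbreviation "u \<equiv> fl_input a R f h G"
abbreviation "X \<equiv> fl_field a R f h G"

subsection \<open>The output map\<close>

lemma mem_output_space:
  "w \<in> S \<longleftrightarrow> upper w \<in> range (\<lambda>x. L *v x) \<and> lower w \<in> multipliers R"
proof -
  have "w = col v \<mu> \<longleftrightarrow> upper w = v \<and> lower w = \<mu>" for v \<mu>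
    by (metis upper_col lower_col col_upper_lower)
  then show ?thesis by (auto simp: output_space_def)
qed

lemma subspace_output_space: "subspace (S)"
proof -
  have S: "S = upper -` range (\<lambda>x. L *v x) \<inter> lower -` multipliers R"
    by (auto simp: mem_output_space)
  have "subspace (range (\<lambda>x. L *v x))"
    by (intro linear_subspace_image) auto
  then show ?thesis
    using upper_lower_linear[THEN bounded_linear.linear] subspace_multipliers[of R]
    unfolding S by (intro subspace_inter linear_subspace_vimage)
qed

lemma block_J_mult: "block (J x *v w) i = Dh i (block x i) (block w i)"
  by (simp add: blkdiag_jacobian_def block_blkdiag_mult jac_mult[OF Dh])

lemma fl_A_mult: "fl_A a h x *v w = col (L *v w) (J x *v w)"
  by (simp add: fl_A_def col_matrix_vector_mult)

lemma fl_B_mult: "fl_B h x *v w = upper w + transpose (J x) *v lower w"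
  by (simp add: fl_B_def row_concat_matrix_vector_mult del: transpose_matrix_vector)

lemma fl_A_maps: "fl_A a h x *v w \<in> S"
  using local_multipliers_derivative[OF Dh h_maps]
  by (simp add: mem_output_space fl_A_mult multipliers_def block_J_mult)

lemma fl_M_maps: "fl_M a h x *v w \<in> S"
  by (simp add: fl_M_def fl_A_maps flip: matrix_vector_mul_assoc)

lemma fl_output_maps: "fl_output a h x \<in> S"
  using h_maps by (simp add: mem_output_space fl_output_def multipliers_def stacked_constraint_def)

lemma has_derivative_fl_output: "(fl_output a h has_derivative (\<lambda>w. fl_A a h x *v w)) (at x)"
  unfolding fl_output_def[abs_def] fl_A_mult
  by (intro has_derivative_col has_derivative_stacked_constraint[OF Dh]
      bounded_linear_imp_has_derivative matrix_vector_mul_bounded_linear)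

lemma fl_output_opt: "fl_output a h p = 0"
proof -
  have "stacked_constraint h p = 0"
    by (rule block_eqI) (simp add: stacked_constraint_def feasible)
  then show ?thesis
    by (simp add: fl_output_def stacked_laplacian_consensus graph col_linear_simps)
qed

text \<open>The tangent space of the constraint set at the optimum.\<close>

lemma fl_A_kernel:
  assumes "fl_A a h p *v z = 0"
  obtains \<zeta> where "z = kron_vec 1 \<zeta>" "\<And>i. Dh i s_opt \<zeta> = 0"
proof -
  have "col (L *v z) (J p *v z) = 0" using assms by (simp add: fl_A_mult)
  then have z: "L *v z = 0" "J p *v z = 0"
    by (metis upper_col upper_lower_linear(1) linear_simps(3), metis lower_col upper_lower_linear(2) linear_simps(3))
  obtain \<zeta> where \<zeta>: "z = kron_vec 1 \<zeta>"
    using consensus_of_laplacian_kernel[OF graph z(1)] by metis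
  have "Dh i s_opt \<zeta> = block (J p *v z) i" for i
    by (simp add: block_J_mult \<zeta>)
  then show thesis using that \<zeta> z(2) by simp
qed

lemma inner_consensus_upper:
  assumes "w \<in> S"
  shows "kron_vec 1 \<zeta> \<bullet> upper w = 0"
proof -
  obtain x where "upper w = L *v x" using assms by (auto simp: mem_output_space)
  then show ?thesis
    using stacked_laplacian_selfadjoint[OF graph(1), of "kron_vec 1 \<zeta>" x]
    by (simp add: stacked_laplacian_consensus graph)
qed

lemma inner_transpose_J:
  "z \<bullet> (transpose (J x) *v \<mu>) = (\<Sum>i\<in>UNIV. Dh i (block x i) (block z i) \<bullet> block \<mu> i)"
proof -
  have "z \<bullet> (transpose (J x) *v \<mu>) = (J x *v z) \<bullet> \<mu>"
    by (simp only: transpose_matrix_vector inner_commute[of z] dot_lmul_matrix inner_commute[of \<mu>])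
  then show ?thesis by (simp add: inner_blocks block_J_mult)
qed

lemma multiplier_zero:
  assumes "\<mu> \<in> multipliers R" "\<And>\<xi>. (\<Sum>i\<in>UNIV. Dh i s_opt \<xi> \<bullet> block \<mu> i) = 0"
  shows "\<mu> = 0"
  using multiplier_zero_of_full_rank[OF full_rank Dh h_maps] assms by blast

lemma inner_grad_stacked_objective:
  "w \<bullet> grad_f x = (\<Sum>i\<in>UNIV. Df i (block x i) (block w i))"
  by (rule grad_inner[OF has_derivative_stacked_objective[OF Df]])

subsection \<open>The input near the optimum\<close>

text \<open>
  A solution \<open>w\<close> of \<open>M p *v w = 0\<close> gives \<open>B p *v w\<close> tangent to the constraint set, hence
  of the form \<open>kron_vec 1 \<xi>\<close>; it is orthogonal to such vectors, because the upper part of \<open>w\<close>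
  is in the range of the Laplacian and \<open>J p *v kron_vec 1 \<xi> = 0\<close>.
\<close>

lemma fl_M_injective:
  assumes w: "w \<in> S" and ker: "fl_M a h p *v w = 0"
  shows "w = 0"
proof -
  let ?b = "fl_B h p *v w"
  have "fl_A a h p *v ?b = 0"
    using ker by (simp add: fl_M_def matrix_vector_mul_assoc)
  then obtain \<xi> where \<xi>: "?b = kron_vec 1 \<xi>" "\<And>i. Dh i s_opt \<xi> = 0"
    using fl_A_kernel by metis
  have pair: "kron_vec 1 \<zeta> \<bullet> ?b = (\<Sum>i\<in>UNIV. Dh i s_opt \<zeta> \<bullet> block (lower w) i)" for \<zeta>
    by (simp add: fl_B_mult inner_add_right inner_consensus_upper[OF w] inner_transpose_J
        del: transpose_matrix_vector)
  have "?b \<bullet> ?b = kron_vec 1 \<xi> \<bullet> ?b" by (simp only: \<xi>(1))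
  also have "\<dots> = 0" by (simp add: pair \<xi>(2))
  finally have b: "?b = 0" by simp
  have "lower w = 0"
    using w pair by (intro multiplier_zero) (auto simp: mem_output_space b)
  moreover from this b have "upper w = 0" by (simp add: fl_B_mult)
  ultimately show ?thesis by (metis col_linear_simps(4) col_upper_lower)
qed

lemma lipschitz_near_nth:
  fixes g :: "'a::metric_space \<Rightarrow> 'b::real_normed_vector^'k"
  assumes "lipschitz_near x g"
  shows "lipschitz_near x (\<lambda>x. g x $ k)"
  by (rule lipschitz_near_compose[OF assms lipschitz_near_bounded_linear[OF bounded_linear_vec_nth]])

lemma lipschitz_near_block: "lipschitz_near x (\<lambda>x :: real^('n \<times> 'd). block x i)"
  by (rule lipschitz_near_bounded_linear[OF bounded_linear_block])

lemma lipschitz_near_J: "lipschitz_near x J"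
proof (rule lipschitz_near_vec, rule lipschitz_near_vec)
  fix q :: "'n \<times> 'm" and r :: "'n \<times> 'd"
  have "lipschitz_near x (\<lambda>x. jac (h (fst q)) (block x (fst q)))"
    using jac_lipschitz
    by (intro lipschitz_near_compose[OF lipschitz_near_block]) (simp add: locally_lipschitz_iff)
  then have "lipschitz_near x (\<lambda>x. jac (h (fst q)) (block x (fst q)) $ snd q $ snd r)"
    by (intro lipschitz_near_nth)
  then show "lipschitz_near x (\<lambda>x. J x $ q $ r)"
    by (cases "fst q = fst r")
      (simp_all add: blkdiag_jacobian_def blkdiag_def lipschitz_near_const)
qed

lemma lipschitz_near_fl_A: "lipschitz_near x (fl_A a h)"
proof (rule lipschitz_near_vec)
  fix k
  show "lipschitz_near x (\<lambda>x. fl_A a h x $ k)"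
    by (cases k) (simp_all add: fl_A_def lipschitz_near_const lipschitz_near_nth[OF lipschitz_near_J])
qed

lemma lipschitz_near_fl_B: "lipschitz_near x (fl_B h)"
proof (rule lipschitz_near_vec, rule lipschitz_near_vec)
  fix q k
  have J: "lipschitz_near x (\<lambda>x. J x $ r $ q)" for r
    by (intro lipschitz_near_nth lipschitz_near_J)
  show "lipschitz_near x (\<lambda>x. fl_B h x $ q $ k)"
    by (cases k) (simp_all add: fl_B_def row_concat_def transpose_def lipschitz_near_const J)
qed

lemma lipschitz_near_grad: "lipschitz_near x grad_f"
proof (rule lipschitz_near_vec)
  fix q
  note Df_lip = C1_on_UNIV_imp_lipschitz_near[OF Df_C1]
  have "(\<lambda>x. grad_f x $ q) = (\<lambda>x. \<Sum>i\<in>UNIV. Df i (block x i) (block (axis q 1) i))"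
    by (simp add: cart_eq_inner_axis inner_commute[of _ "axis q 1"] inner_grad_stacked_objective)
  moreover have "lipschitz_near x (\<lambda>x. \<Sum>i\<in>UNIV. Df i (block x i) (block (axis q 1) i))"
    by (intro lipschitz_near_sum lipschitz_near_compose[OF lipschitz_near_compose[OF lipschitz_near_block Df_lip]]
        lipschitz_near_bounded_linear blinfun.bounded_linear_left)
  ultimately show "lipschitz_near x (\<lambda>x. grad_f x $ q)" by simp
qed

lemma lipschitz_near_G_output: "lipschitz_near x (\<lambda>x. G (fl_output a h x))"
proof -
  have y: "lipschitz_near x (fl_output a h)"
  proof (rule lipschitz_near_vec)
    fix k :: "('n \<times> 'd) + ('n \<times> 'm)"
    show "lipschitz_near x (\<lambda>x. fl_output a h x $ k)"
    proof (cases k)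
      case (Inl q)
      have "lipschitz_near x (\<lambda>x. (L *v x) $ q)"
        by (intro lipschitz_near_bounded_linear bounded_linear_compose[OF bounded_linear_vec_nth]
            matrix_vector_mul_bounded_linear)
      then show ?thesis by (simp add: Inl fl_output_def)
    next
      case (Inr q)
      have "continuous_on UNIV (Dh i)" for i
        using D2h by (intro has_derivative_continuous_on) (auto intro: has_derivative_at_withinI)
      then have "C1_on UNIV (h i)" for i
        using Dh unfolding C1_on_def by (intro exI[of _ "Dh i"]) simp
      then have "lipschitz_near s (h i)" for i s
        by (rule C1_on_UNIV_imp_lipschitz_near)
      then have "lipschitz_near x (\<lambda>x. h (fst q) (block x (fst q)) $ snd q)"
        by (intro lipschitz_near_nth lipschitz_near_compose[OF lipschitz_near_block])
      then show ?thesis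
        by (simp add: Inr fl_output_def stacked_constraint_def blocks_col_def)
    qed
  qed
  obtain e K where e: "0 < e" "K-lipschitz_on (S \<inter> cball (fl_output a h x) e) G"
    by (rule C1_on_imp_lipschitz_within[OF G_C1 subspace_imp_convex[OF subspace_output_space] fl_output_maps])
  show ?thesis
    by (rule lipschitz_near_compose_within[OF y e fl_output_maps])
qed

text \<open>
  With \<open>b x = - (A x *v grad_f x + G (y x))\<close> the input is the solution in the output space of
  \<open>M x *v w = b x\<close>.
\<close>

lemma fl_input_near:
  obtains e where "0 < e" "cball p e \<subseteq> fl_domain a R f h G" "lipschitz_near p u"
    "\<And>x. x \<in> cball p e \<Longrightarrow> is_fl_input a R f h G x (u x)"
proof -
  define b where "b = (\<lambda>x. - (fl_A a h x *v grad_f x + G (fl_output a h x)))"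
  have bS: "b x \<in> S" for x
    unfolding b_def using subspace_output_space fl_A_maps G_maps[OF fl_output_maps]
    by (intro subspace_neg subspace_add)
  have lipM: "lipschitz_near p (fl_M a h)"
    unfolding fl_M_def[abs_def]
    by (rule lipschitz_near_bilinear[OF bounded_bilinear_matrix_matrix_mult lipschitz_near_fl_A lipschitz_near_fl_B])
  have lipb: "lipschitz_near p b"
    unfolding b_def
    by (intro lipschitz_near_minus lipschitz_near_add lipschitz_near_G_output
        lipschitz_near_bilinear[OF bounded_bilinear_matrix_vector_mult] lipschitz_near_fl_A lipschitz_near_grad)
  obtain v e where v: "lipschitz_near p v" "0 < e"
    "\<forall>x\<in>cball p e. \<forall>w. w \<in> S \<and> fl_M a h x *v w = b x \<longleftrightarrow> w = v x"
    by (rule lipschitz_near_linear_solution[OF subspace_output_space fl_M_maps bS fl_M_injective lipM lipb])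
  have is_input: "is_fl_input a R f h G x w \<longleftrightarrow> w = v x" if x: "x \<in> cball p e" for x w
  proof -
    have "is_fl_input a R f h G x w \<longleftrightarrow> w \<in> S \<and> fl_M a h x *v w = b x"
      unfolding is_fl_input_def b_def by (simp only: eq_neg_iff_add_eq_0 add.assoc)
    then show ?thesis using v(3) x by blast
  qed
  have v_eq: "v x = u x" if x: "x \<in> cball p e" for x
    unfolding fl_input_def is_input[OF x] by simp
  show thesis
  proof (rule that[OF v(2)])
    show "cball p e \<subseteq> fl_domain a R f h G"
      using is_input by (auto simp: fl_domain_def simp del: mem_cball)
    show "lipschitz_near p u"
      by (rule lipschitz_near_cong[OF v(1,2) v_eq])
    show "is_fl_input a R f h G x (u x)" if "x \<in> cball p e" for x
      using is_input[OF that] v_eq[OF that] by simp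
  qed
qed

lemma fl_field_eq: "X x = - (grad_f x + fl_B h x *v u x)"
  by (simp add: fl_field_def fl_B_mult)

text \<open>The purpose of the input: outputs evolve along the assigned vector field.\<close>

lemma fl_A_field:
  assumes "is_fl_input a R f h G x (u x)"
  shows "fl_A a h x *v X x = G (fl_output a h x)"
proof -
  have "fl_A a h x *v (grad_f x + fl_B h x *v u x)
      = fl_M a h x *v u x + fl_A a h x *v grad_f x"
    by (simp add: fl_M_def matrix_vector_right_distrib matrix_vector_mul_assoc)
  also have "\<dots> = - G (fl_output a h x)"
    using assms by (simp add: is_fl_input_def eq_neg_iff_add_eq_0)
  finally show ?thesis
    unfolding fl_field_eq by (simp only: linear_neg[OF matrix_vector_mul_linear] minus_minus)
qed

lemma lipschitz_near_fl_field:
  assumes "lipschitz_near x u"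
  shows "lipschitz_near x X"
  unfolding fl_field_eq[abs_def]
  by (intro lipschitz_near_minus lipschitz_near_add lipschitz_near_grad assms
      lipschitz_near_bilinear[OF bounded_bilinear_matrix_vector_mult] lipschitz_near_fl_B)

text \<open>
  The upper part of the input is in the range of the Laplacian and so is orthogonal to directions
  of consensus; the multiplier remains.
\<close>

lemma inner_consensus_field:
  assumes "is_fl_input a R f h G x (u x)"
  shows "kron_vec 1 \<zeta> \<bullet> X x = - (\<Sum>i\<in>UNIV. Df i (block x i) \<zeta>)
    - (\<Sum>i\<in>UNIV. Dh i (block x i) \<zeta> \<bullet> block (lower (u x)) i)"
proof -
  have "u x \<in> S" using assms by (simp add: is_fl_input_def)
  then show ?thesis
    by (simp add: fl_field_def inner_diff_right inner_grad_stacked_objective inner_transpose_J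
        inner_consensus_upper del: transpose_matrix_vector)
qed

subsection \<open>The optimum\<close>

text \<open>On consensus vectors the constraints of the agents act as one constraint on the common value.\<close>

definition joint_constraint :: "real^'d \<Rightarrow> real^('n \<times> 'm)" where
  "joint_constraint s = blocks_col (\<lambda>i. h i s)"

text \<open>
  The insertion of a block as a bounded linear map expresses \<open>D_joint\<close> as a sum of compositions, which
  is differentiable in the operator norm.
\<close>

definition inject_block :: "'n \<Rightarrow> (real^'m) \<Rightarrow>\<^sub>L (real^('n \<times> 'm))" where
  "inject_block i = Blinfun (\<lambda>v. blocks_col (\<lambda>j. if j = i then v else 0))"

definition D_joint :: "real^'d \<Rightarrow> (real^'d) \<Rightarrow>\<^sub>L (real^('n \<times> 'm))" where
  "D_joint s = (\<Sum>i\<in>UNIV. inject_block i o\<^sub>L Dh i s)"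

definition D2_joint :: "(real^'d) \<Rightarrow> (real^'d) \<Rightarrow>\<^sub>L (real^('n \<times> 'm))" where
  "D2_joint w = (\<Sum>i\<in>UNIV. inject_block i o\<^sub>L D2h i s_opt w)"

lemma block_inject_block: "block (inject_block i v) j = (if j = i then v else 0)"
proof -
  have "bounded_linear (\<lambda>v :: real^'m. blocks_col (\<lambda>j. if j = i then v else 0))"
    unfolding linear_conv_bounded_linear[symmetric]
    by (rule linearI; rule block_eqI) auto
  then show ?thesis by (simp add: inject_block_def bounded_linear_Blinfun_apply)
qed

lemma block_sum: "block (\<Sum>i\<in>I. F i) j = (\<Sum>i\<in>I. block (F i) j)"
  for F :: "'b \<Rightarrow> real^('n \<times> 'm)"
  by (induction I rule: infinite_finite_induct) auto

lemma block_D_joint: "block (D_joint s \<xi>) i = Dh i s \<xi>"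
  by (simp add: D_joint_def blinfun.sum_left block_sum block_inject_block)

lemma block_D2_joint: "block (D2_joint w \<xi>) i = D2h i s_opt w \<xi>"
  by (simp add: D2_joint_def blinfun.sum_left block_sum block_inject_block)

lemma has_derivative_joint_constraint: "(joint_constraint has_derivative D_joint s) (at s)"
proof -
  have "(joint_constraint has_derivative (\<lambda>\<xi>. blocks_col (\<lambda>i. Dh i s \<xi>))) (at s)"
    unfolding joint_constraint_def[abs_def] by (rule has_derivative_blocks_col[OF Dh])
  moreover have "(\<lambda>\<xi>. blocks_col (\<lambda>i. Dh i s \<xi>)) = D_joint s"
    by (intro ext block_eqI) (simp add: block_D_joint)
  ultimately show ?thesis by simp
qed

lemma has_derivative_sum_inject:
  "((\<lambda>s. \<Sum>i\<in>UNIV. inject_block i o\<^sub>L Dh i s) has_derivative (\<lambda>w. \<Sum>i\<in>UNIV. inject_block i o\<^sub>L D2h i s w)) (at s)"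
  by (intro has_derivative_sum D2h bounded_linear.has_derivative[OF
      bounded_bilinear.bounded_linear_right[OF bounded_bilinear_blinfun_compose]])

lemma has_derivative_D_joint: "(D_joint has_derivative D2_joint) (at s_opt)"
  unfolding D_joint_def[abs_def] D2_joint_def[abs_def] by (rule has_derivative_sum_inject)

lemma continuous_on_D_joint: "continuous_on UNIV D_joint"
  unfolding D_joint_def[abs_def]
  by (rule has_derivative_continuous_on, rule has_derivative_at_withinI, rule has_derivative_sum_inject)

lemma joint_constraint_maps: "joint_constraint s \<in> multipliers R"
  using h_maps by (simp add: joint_constraint_def multipliers_def)

lemma joint_constraint_eq_0: "joint_constraint s = 0 \<longleftrightarrow> s \<in> feasible_set h"
proof -
  have "joint_constraint s = 0 \<longleftrightarrow> (\<forall>i. block (joint_constraint s) i = block 0 i)"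
    using block_eqI by metis
  then show ?thesis by (simp add: joint_constraint_def feasible_set_def)
qed

lemma joint_regular: "\<mu> \<in> multipliers R \<Longrightarrow> (\<And>\<xi>. D_joint s_opt \<xi> \<bullet> \<mu> = 0) \<Longrightarrow> \<mu> = 0"
  by (rule multiplier_zero) (simp_all add: inner_blocks block_D_joint)

lemma joint_kernel: "(\<And>i. Dh i s_opt \<zeta> = 0) \<Longrightarrow> D_joint s_opt \<zeta> = 0"
  by (rule block_eqI) (simp add: block_D_joint)

lemma has_derivative_total_objective:
  "(total_objective f has_derivative (\<Sum>i\<in>UNIV. Df i s)) (at s)"
proof -
  have "(total_objective f has_derivative (\<lambda>\<xi>. \<Sum>i\<in>UNIV. Df i s \<xi>)) (at s)"
    unfolding total_objective_def[abs_def] by (intro has_derivative_sum Df)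
  then show ?thesis by (simp add: blinfun.sum_left[abs_def])
qed

lemma objective_stationary:
  assumes "\<And>i. Dh i s_opt \<zeta> = 0"
  shows "(\<Sum>i\<in>UNIV. Df i s_opt \<zeta>) = 0"
proof -
  have "(\<Sum>i\<in>UNIV. Df i s_opt) \<zeta> = 0"
  proof (rule constrained_minimizer_stationary[OF has_derivative_joint_constraint continuous_on_D_joint _
        joint_constraint_maps joint_regular has_derivative_total_objective U _ joint_kernel[OF assms]])
    show "joint_constraint s_opt = 0"
      using feasible by (simp add: joint_constraint_eq_0 feasible_set_def)
    fix q assume "q \<in> U" "joint_constraint q = 0"
    then have "total_objective f s_opt + \<rho> / 2 * (norm (q - s_opt))\<^sup>2 \<le> total_objective f q"
      by (intro growth) (simp add: joint_constraint_eq_0)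
    moreover have "0 \<le> \<rho> / 2 * (norm (q - s_opt))\<^sup>2" using rho_pos by simp
    ultimately show "total_objective f s_opt \<le> total_objective f q" by linarith
  qed
  then show ?thesis by (simp add: blinfun.sum_left)
qed

text \<open>
  At the optimum the output is zero, so the field is a tangent vector. Its pairing with tangent
  vectors, itself among them, is minus the derivative of the objective along the constraint set,
  which vanishes.
\<close>

lemma fl_field_opt:
  assumes input: "is_fl_input a R f h G p (u p)"
  shows "X p = 0"
proof -
  have "fl_A a h p *v X p = 0"
    using fl_A_field[OF input] by (simp add: fl_output_opt G_zero)
  then obtain \<xi> where \<xi>: "X p = kron_vec 1 \<xi>" "\<And>i. Dh i s_opt \<xi> = 0"
    using fl_A_kernel by metis
  have "X p \<bullet> X p = kron_vec 1 \<xi> \<bullet> X p" by (simp only: \<xi>(1))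
  also have "\<dots> = 0"
    using objective_stationary[OF \<xi>(2)] by (simp add: inner_consensus_field[OF input] \<xi>(2))
  finally show ?thesis by simp
qed

text \<open>
  The multiplier is the lower part of the input at the optimum: paired with directions of
  consensus, the equation \<open>X p = 0\<close> says that the Lagrangian is stationary.
\<close>

lemma lagrangian_convex_on_tangent:
  assumes input: "is_fl_input a R f h G p (u p)" and \<zeta>: "\<And>i. Dh i s_opt \<zeta> = 0"
  shows "\<rho> * (\<zeta> \<bullet> \<zeta>) \<le> (\<Sum>i\<in>UNIV. D2f i s_opt \<zeta> \<zeta>)
    + (\<Sum>i\<in>UNIV. D2h i s_opt \<zeta> \<zeta> \<bullet> block (lower (u p)) i)"
proof -
  have "\<rho> * (\<zeta> \<bullet> \<zeta>) \<le> (\<Sum>i\<in>UNIV. D2f i s_opt \<zeta>) \<zeta> + D2_joint \<zeta> \<zeta> \<bullet> lower (u p)"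
  proof (rule lagrangian_second_derivative_ge[OF has_derivative_joint_constraint continuous_on_D_joint
        has_derivative_D_joint has_derivative_total_objective _ _ joint_constraint_maps joint_regular _ U _
        joint_kernel[OF \<zeta>]])
    show "((\<lambda>s. \<Sum>i\<in>UNIV. Df i s) has_derivative (\<lambda>w. \<Sum>i\<in>UNIV. D2f i s_opt w)) (at s_opt)"
      by (intro has_derivative_sum D2f)
    show "joint_constraint s_opt = 0"
      using feasible by (simp add: joint_constraint_eq_0 feasible_set_def)
    show "(\<Sum>i\<in>UNIV. Df i s_opt) \<xi> + D_joint s_opt \<xi> \<bullet> lower (u p) = 0" for \<xi>
      using inner_consensus_field[OF input, of \<xi>]
      by (simp add: fl_field_opt[OF input] inner_blocks[of "D_joint s_opt \<xi>"] block_D_joint blinfun.sum_left)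
    show "total_objective f s_opt + \<rho> / 2 * (norm (q - s_opt))\<^sup>2 \<le> total_objective f q"
      if "q \<in> U" "joint_constraint q = 0" for q
      using that by (intro growth) (simp add: joint_constraint_eq_0)
  qed
  then show ?thesis
    by (simp add: blinfun.sum_left inner_blocks[of "D2_joint \<zeta> \<zeta>"] block_D2_joint)
qed

text \<open>
  For \<open>z = kron_vec 1 \<zeta>\<close> the factor \<open>Dh i (block x i) \<zeta>\<close> of the multiplier vanishes at \<open>p\<close>.
  So the multiplier enters the derivative of \<open>z \<bullet> X x\<close> with its value at \<open>p\<close> alone, and in the
  direction \<open>z\<close> this derivative is minus the second derivative of the Lagrangian at \<open>\<zeta>\<close>.
  The number of agents appears because \<open>z \<bullet> z = CARD('n) * (\<zeta> \<bullet> \<zeta>)\<close>.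
\<close>

lemma tangential_linearization:
  assumes e: "0 < e" and input: "\<And>x. x \<in> cball p e \<Longrightarrow> is_fl_input a R f h G x (u x)"
    and lip: "lipschitz_near p u" and z: "fl_A a h p *v z = 0"
  shows "\<exists>k. ((\<lambda>x. z \<bullet> X x) has_derivative k) (at p) \<and> k z \<le> - (\<rho> / CARD('n)) * (z \<bullet> z)"
proof -
  obtain \<zeta> where \<zeta>: "z = kron_vec 1 \<zeta>" "\<And>i. Dh i s_opt \<zeta> = 0"
    using fl_A_kernel[OF z] by metis
  define k where "k = (\<lambda>w. - (\<Sum>i\<in>UNIV. D2f i s_opt (block w i) \<zeta>)
    - (\<Sum>i\<in>UNIV. D2h i s_opt (block w i) \<zeta> \<bullet> block (lower (u p)) i))"
  have input_p: "is_fl_input a R f h G p (u p)" using e by (intro input) simp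
  have block: "((\<lambda>x. block x i) has_derivative (\<lambda>w. block w i)) (at p)" for i
    by (rule bounded_linear_imp_has_derivative[OF bounded_linear_block])
  have f_deriv: "((\<lambda>x. Df i (block x i) \<zeta>) has_derivative (\<lambda>w. D2f i s_opt (block w i) \<zeta>)) (at p)" for i
  proof -
    have "((\<lambda>x. Df i (block x i)) has_derivative (\<lambda>w. D2f i (block p i) (block w i))) (at p)"
      by (rule has_derivative_compose[OF block D2f])
    then show ?thesis
      by (simp add: bounded_linear.has_derivative[OF blinfun.bounded_linear_left])
  qed
  have h_deriv: "((\<lambda>x. Dh i (block x i) \<zeta>) has_derivative (\<lambda>w. D2h i s_opt (block w i) \<zeta>)) (at p)" for i
  proof -
    have "((\<lambda>x. Dh i (block x i)) has_derivative (\<lambda>w. D2h i (block p i) (block w i))) (at p)"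
      by (rule has_derivative_compose[OF block D2h])
    then show ?thesis
      by (simp add: bounded_linear.has_derivative[OF blinfun.bounded_linear_left])
  qed
  have \<mu>: "isCont (\<lambda>x. block (lower (u x)) i) p" for i
    by (intro lipschitz_near_isCont lipschitz_near_compose[OF lip] lipschitz_near_bounded_linear
        bounded_linear_compose[OF bounded_linear_block upper_lower_linear(2)])
  have "((\<lambda>x. - (\<Sum>i\<in>UNIV. Df i (block x i) \<zeta>)
      - (\<Sum>i\<in>UNIV. Dh i (block x i) \<zeta> \<bullet> block (lower (u x)) i)) has_derivative k) (at p)"
    unfolding k_def
    by (intro has_derivative_diff has_derivative_minus has_derivative_sum f_deriv
        has_derivative_inner_vanishing[OF h_deriv _ \<mu>]) (simp add: \<zeta>(2))
  then have "((\<lambda>x. z \<bullet> X x) has_derivative k) (at p)"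
  proof (rule has_derivative_transform_within_open[OF _ open_ball])
    show "p \<in> ball p e" using e by simp
    show "- (\<Sum>i\<in>UNIV. Df i (block x i) \<zeta>) - (\<Sum>i\<in>UNIV. Dh i (block x i) \<zeta> \<bullet> block (lower (u x)) i)
        = z \<bullet> X x" if "x \<in> ball p e" for x
      using that unfolding \<zeta>(1) by (subst inner_consensus_field[OF input]) auto
  qed
  moreover have "k z \<le> - (\<rho> / CARD('n)) * (z \<bullet> z)"
  proof -
    have "z \<bullet> z = CARD('n) * (\<zeta> \<bullet> \<zeta>)"
      by (simp add: \<zeta>(1) inner_blocks)
    moreover have "k z \<le> - \<rho> * (\<zeta> \<bullet> \<zeta>)"
      using lagrangian_convex_on_tangent[OF input_p \<zeta>(2)] by (simp add: k_def \<zeta>(1))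
    ultimately show ?thesis by simp
  qed
  ultimately show ?thesis by blast
qed

lemma fl_equilibrium: "equilibrium (fl_domain a R f h G) X p"
proof -
  obtain e where "0 < e" "cball p e \<subseteq> fl_domain a R f h G"
    "\<And>x. x \<in> cball p e \<Longrightarrow> is_fl_input a R f h G x (u x)"
    using fl_input_near by metis
  then show ?thesis
    using fl_field_opt by (force simp: equilibrium_def)
qed

lemma fl_exponential_estimate:
  assumes G: "origin_globally_exp_stable S G \<alpha>G"
    and \<alpha>: "0 < \<alpha>" "\<alpha> < \<rho> / CARD('n)" "\<alpha> < \<alpha>G"
  shows "\<exists>C>0. \<exists>\<delta>>0. \<forall>x0. norm (x0 - p) < \<delta> \<longrightarrow>
    (\<exists>x. the_solution_from (fl_domain a R f h G) X x0 x \<and>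
      (\<forall>t\<ge>0. norm (x t - p) + norm (L *v x t) + norm (stacked_constraint h (x t))
        \<le> C * exp (- \<alpha> * t) * norm (x0 - p)))"
proof -
  obtain e where e: "0 < e" and D: "cball p e \<subseteq> fl_domain a R f h G" and lip: "lipschitz_near p u"
    and input: "\<And>x. x \<in> cball p e \<Longrightarrow> is_fl_input a R f h G x (u x)"
    using fl_input_near by metis
  obtain r K where r: "0 < r" "r \<le> e" "K-lipschitz_on (cball p r) X"
    using lipschitz_nearE[OF lipschitz_near_fl_field[OF lip] e] by metis
  have sub: "cball p r \<subseteq> cball p e" using r by auto
  have "is_fl_input a R f h G p (u p)" using e by (intro input) simp
  then have "\<exists>C>0. \<exists>\<delta>>0. \<forall>x0. norm (x0 - p) < \<delta> \<longrightarrow>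
    (\<exists>x. the_solution_from (fl_domain a R f h G) X x0 x \<and>
      (\<forall>t\<ge>0. norm (x t - p) + norm (fl_output a h (x t)) \<le> C * exp (- \<alpha> * t) * norm (x0 - p)))"
    using sub D input
    by (intro exp_stable_of_output_dynamics[OF r(1,3) _ _ has_derivative_fl_output fl_output_opt
        fl_output_maps _ G _ \<alpha>(2,3,1)] fl_A_field fl_field_opt tangential_linearization[OF e input lip]) auto
  then obtain C \<delta> where C: "0 < C" and \<delta>: "0 < \<delta>" and est: "\<And>x0. norm (x0 - p) < \<delta> \<Longrightarrow>
    \<exists>x. the_solution_from (fl_domain a R f h G) X x0 x \<and>
      (\<forall>t\<ge>0. norm (x t - p) + norm (fl_output a h (x t)) \<le> C * exp (- \<alpha> * t) * norm (x0 - p))"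
    by blast
  have "\<exists>x. the_solution_from (fl_domain a R f h G) X x0 x \<and>
      (\<forall>t\<ge>0. norm (x t - p) + norm (L *v x t) + norm (stacked_constraint h (x t))
        \<le> (2 * C) * exp (- \<alpha> * t) * norm (x0 - p))"
    if near: "norm (x0 - p) < \<delta>" for x0
  proof -
    obtain x where x: "the_solution_from (fl_domain a R f h G) X x0 x"
      "\<And>t. 0 \<le> t \<Longrightarrow> norm (x t - p) + norm (fl_output a h (x t)) \<le> C * exp (- \<alpha> * t) * norm (x0 - p)"
      using est[OF near] by blast
    have "norm (x t - p) + norm (L *v x t) + norm (stacked_constraint h (x t))
        \<le> (2 * C) * exp (- \<alpha> * t) * norm (x0 - p)" if "0 \<le> t" for t
    proof -
      have "norm (L *v x t) \<le> norm (fl_output a h (x t))"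
        "norm (stacked_constraint h (x t)) \<le> norm (fl_output a h (x t))"
        unfolding fl_output_def by (rule norm_le_norm_col)+
      then show ?thesis using x(2)[OF that] norm_ge_zero[of "x t - p"] by linarith
    qed
    then show ?thesis using x(1) by blast
  qed
  then show ?thesis using C \<delta> by (intro exI[of _ "2 * C"] conjI exI[of _ \<delta>]) auto
qed

end

lemma C2_derivatives:
  assumes "C2 g"
  shows "\<exists>g' g''. C1_on UNIV g' \<and> (\<forall>x. (g has_derivative blinfun_apply (g' x)) (at x)) \<and>
    (\<forall>x. (g' has_derivative blinfun_apply (g'' x)) (at x))"
proof -
  obtain g' where g': "C1_on UNIV g'" "\<forall>x. (g has_derivative blinfun_apply (g' x)) (at x)"
    using assms unfolding C2_def by blast
  then obtain g'' where "\<forall>x. (g' has_derivative blinfun_apply (g'' x)) (at x)"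
    unfolding C1_on_def by auto
  with g' show ?thesis by blast
qed

theorem proposition1:
  fixes a :: "real^'n::finite^'n"
    and R :: "'n \<Rightarrow> 'm::finite set"
    and f :: "'n \<Rightarrow> real^'d::finite \<Rightarrow> real"
    and h :: "'n \<Rightarrow> real^'d \<Rightarrow> real^'m"
    and G :: "real^(('n \<times> 'd) + ('n \<times> 'm)) \<Rightarrow> real^(('n \<times> 'd) + ('n \<times> 'm))"
    and s_opt :: "real^'d" and U :: "(real^'d) set" and \<rho> \<alpha>G :: real
  assumes h_maps: "\<And>i s. h i s \<in> local_multipliers R i"
    and G_maps: "G \<in> output_space a R \<rightarrow> output_space a R"
    and G_C1: "C1_on (output_space a R) G"
    and G_zero: "G 0 = 0"
    and alphaG_pos: "\<alpha>G > 0"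
    and G_stable: "origin_globally_exp_stable (output_space a R) G \<alpha>G"
    and undirected: "undirected_weighted_graph a"
    and connected: "connected_graph a"
    and f_C2: "\<And>i. C2 (f i)"
    and h_C2: "\<And>i. C2 (h i)"
    and hessian_lipschitz: "\<And>i. locally_lipschitz (hessian (f i))"
    and jacobian_lipschitz: "\<And>i. locally_lipschitz (jac (h i))"
    and s_feasible: "s_opt \<in> feasible_set h"
    and U_open: "open U" and s_in_U: "s_opt \<in> U"
    and rho_pos: "\<rho> > 0"
    and s_minimizer: "local_minimizer_on (feasible_set h \<inter> U) (total_objective f) s_opt"
    and quadratic_growth: "\<And>s. s \<in> feasible_set h \<inter> U \<Longrightarrow>
      total_objective f s \<ge> total_objective f s_opt + \<rho> / 2 * (norm (s - s_opt))\<^sup>2"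
    and full_rank: "\<And>x. x \<in> consensus_lift (feasible_set h) \<inter> consensus_lift U \<Longrightarrow>
      rank (col_jacobian h x) = (\<Sum>i\<in>UNIV. card (R i))"
  defines "x_opt \<equiv> kron_vec 1 s_opt"
  shows "equilibrium (fl_domain a R f h G) (fl_field a R f h G) x_opt
    \<and> locally_exp_stable (fl_domain a R f h G) (fl_field a R f h G) x_opt
    \<and> (\<forall>\<alpha>. 0 < \<alpha> \<and> \<alpha> < min (\<rho> / CARD('n)) \<alpha>G \<longrightarrow>
        (\<exists>C>0. \<exists>\<delta>>0. \<forall>x0. norm (x0 - x_opt) < \<delta> \<longrightarrow>
          (\<exists>x. the_solution_from (fl_domain a R f h G) (fl_field a R f h G) x0 x \<and>
            (\<forall>t\<ge>0. norm (x t - x_opt) + norm (stacked_laplacian a *v x t)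
                + norm (stacked_constraint h (x t))
              \<le> C * exp (- \<alpha> * t) * norm (x0 - x_opt)))))"
proof -
  have "\<exists>Df D2f. \<forall>i. C1_on UNIV (Df i) \<and> (\<forall>s. (f i has_derivative blinfun_apply (Df i s)) (at s)) \<and>
      (\<forall>s. (Df i has_derivative blinfun_apply (D2f i s)) (at s))"
    using C2_derivatives[OF f_C2] by metis
  then obtain Df D2f where Df: "\<And>i. C1_on UNIV (Df i)"
    "\<And>i s. (f i has_derivative blinfun_apply (Df i s)) (at s)"
    "\<And>i s. (Df i has_derivative blinfun_apply (D2f i s)) (at s)"
    by blast
  have "\<exists>Dh D2h. \<forall>i. (\<forall>s. (h i has_derivative blinfun_apply (Dh i s)) (at s)) \<and>
      (\<forall>s. (Dh i has_derivative blinfun_apply (D2h i s)) (at s))"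
    using C2_derivatives[OF h_C2] by metis
  then obtain Dh D2h where Dh: "\<And>i s. (h i has_derivative blinfun_apply (Dh i s)) (at s)"
    "\<And>i s. (Dh i has_derivative blinfun_apply (D2h i s)) (at s)"
    by blast
  have "x_opt \<in> consensus_lift (feasible_set h) \<inter> consensus_lift U"
    unfolding x_opt_def consensus_lift_def using s_feasible s_in_U by blast
  then have rank: "rank (col_jacobian h x_opt) = (\<Sum>i\<in>UNIV. card (R i))"
    by (rule full_rank)
  interpret local_equality_problem a R f h G s_opt U \<rho> Df D2f Dh D2h
  proof
    show "G y \<in> output_space a R" if "y \<in> output_space a R" for y
      using G_maps that by (rule funcset_mem)
    show "h i s_opt = 0" for i
      using s_feasible by (simp add: feasible_set_def)
    show "rank (col_jacobian h (kron_vec 1 s_opt)) = (\<Sum>i\<in>UNIV. card (R i))"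
      using rank by (simp only: x_opt_def)
  qed (fact h_maps G_C1 G_zero undirected connected Df Dh jacobian_lipschitz U_open s_in_U rho_pos
      quadratic_growth)+
  let ?D = "fl_domain a R f h G" and ?X = "fl_field a R f h G"
  have estimate: "\<exists>C>0. \<exists>\<delta>>0. \<forall>x0. norm (x0 - x_opt) < \<delta> \<longrightarrow>
      (\<exists>x. the_solution_from ?D ?X x0 x \<and>
        (\<forall>t\<ge>0. norm (x t - x_opt) + norm (stacked_laplacian a *v x t)
            + norm (stacked_constraint h (x t)) \<le> C * exp (- \<alpha> * t) * norm (x0 - x_opt)))"
    if "0 < \<alpha> \<and> \<alpha> < min (\<rho> / CARD('n)) \<alpha>G" for \<alpha>
    unfolding x_opt_def using that by (intro fl_exponential_estimate[OF G_stable]) auto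
  have "locally_exp_stable ?D ?X x_opt"
  proof -
    have "0 < min (\<rho> / CARD('n)) \<alpha>G" using rho_pos alphaG_pos by simp
    then obtain \<alpha> where \<alpha>: "0 < \<alpha>" "\<alpha> < min (\<rho> / CARD('n)) \<alpha>G"
      using dense by blast
    obtain C \<delta> where "0 < C" "0 < \<delta>" and est: "\<forall>x0. norm (x0 - x_opt) < \<delta> \<longrightarrow>
        (\<exists>x. the_solution_from ?D ?X x0 x \<and>
          (\<forall>t\<ge>0. norm (x t - x_opt) + norm (stacked_laplacian a *v x t)
              + norm (stacked_constraint h (x t)) \<le> C * exp (- \<alpha> * t) * norm (x0 - x_opt)))"
      using estimate[of \<alpha>] \<alpha> by blast
    have "\<exists>x. the_solution_from ?D ?X x0 x \<and>
        (\<forall>t\<ge>0. norm (x t - x_opt) \<le> C * exp (- \<alpha> * t) * norm (x0 - x_opt))"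
      if near: "norm (x0 - x_opt) < \<delta>" for x0
    proof -
      obtain x where x: "the_solution_from ?D ?X x0 x"
        and bound: "\<forall>t\<ge>0. norm (x t - x_opt) + norm (stacked_laplacian a *v x t)
            + norm (stacked_constraint h (x t)) \<le> C * exp (- \<alpha> * t) * norm (x0 - x_opt)"
        using est near by blast
      have "norm (x t - x_opt) \<le> C * exp (- \<alpha> * t) * norm (x0 - x_opt)" if "0 \<le> t" for t
        using bound[rule_format, OF that] norm_ge_zero[of "stacked_laplacian a *v x t"]
          norm_ge_zero[of "stacked_constraint h (x t)"] by linarith
      then show ?thesis using x by blast
    qed
    then show ?thesis
      unfolding locally_exp_stable_def using \<open>0 < C\<close> \<open>0 < \<delta>\<close> \<alpha>(1) by blast
  qed
  then show ?thesis
    using fl_equilibrium estimate by (simp add: x_opt_def)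
qed

end
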